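(* Let $X\subset\mathbb{P}^4_{\mathbb{C}}$ be a smooth cubic threefold preserved by $$G_1:=\langle[\mathrm{diag}(1,\xi_3,\xi_3^2,\xi_3^2,1)]\rangle\subset\mathrm{PGL}(5,\mathbb{C}).$$ Then the quotient variety $X/G_1$ is rational.
   Context: $\xi_3$ is a primitive third root of unity. $[A]$ denotes the class in $\mathrm{PGL}(5,\mathbb{C})$ of an invertible matrix $A$. The class of a diagonal matrix $\mathrm{diag}(\lambda_1,\dots,\lambda_5)$ acts on $\mathbb{P}^4$ by $(x_1:\cdots:x_5)\mapsto(\lambda_1x_1:\cdots:\lambda_5x_5)$. "$X$ is preserved by $G_1$" means $g(X)=X$ for all $g\in G_1$. A variety is rational if it is birational to a projective space. *)

theory Defs
  imports
    "Jordan_Normal_Form.Matrix"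
    "HOL-Algebra.Elementary_Groups"
    "HOL-Algebra.Group_Action"
    "HOL-Library.Poly_Mapping"
    "HOL-Analysis.Abstract_Topology"
begin

section \<open>Homogeneous polynomials\<close>

text \<open>
  A multivariate polynomial is a finitely supported map from exponent vectors to coefficients.
  The variables of a form on projective \<open>n\<close>-space are \<open>0, \<dots>, n\<close>.
\<close>

type_synonym cpoly = "(nat \<Rightarrow>\<^sub>0 nat) \<Rightarrow>\<^sub>0 complex"

definition mono_eval :: "(nat \<Rightarrow>\<^sub>0 nat) \<Rightarrow> complex vec \<Rightarrow> complex" where
  "mono_eval m v = (\<Prod>i\<in>Poly_Mapping.keys m. (v $ i) ^ Poly_Mapping.lookup m i)"

definition poly_eval :: "cpoly \<Rightarrow> complex vec \<Rightarrow> complex" where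
  "poly_eval F v = (\<Sum>m\<in>Poly_Mapping.keys F. Poly_Mapping.lookup F m * mono_eval m v)"

definition mono_degree :: "(nat \<Rightarrow>\<^sub>0 nat) \<Rightarrow> nat" where
  "mono_degree m = (\<Sum>i\<in>Poly_Mapping.keys m. Poly_Mapping.lookup m i)"

text \<open>As usual, the zero polynomial is a form of every degree.\<close>

definition is_form :: "nat \<Rightarrow> nat \<Rightarrow> cpoly \<Rightarrow> bool" where
  "is_form n d F \<longleftrightarrow> (\<forall>m\<in>Poly_Mapping.keys F. Poly_Mapping.keys m \<subseteq> {..n} \<and> mono_degree m = d)"

definition partial_deriv :: "nat \<Rightarrow> cpoly \<Rightarrow> cpoly" where
  "partial_deriv i F =
     (\<Sum>m\<in>Poly_Mapping.keys F. Poly_Mapping.single (m - Poly_Mapping.single i 1)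
                                       (of_nat (Poly_Mapping.lookup m i) * Poly_Mapping.lookup F m))"

section \<open>Projective space and the Zariski topology\<close>

text \<open>
  A point of projective \<open>n\<close>-space is a line in affine \<open>(n+1)\<close>-space with the origin removed,
  that is, the set of all its vectors of homogeneous coordinates.
\<close>

type_synonym ppoint = "complex vec set"

definition proj_points :: "nat \<Rightarrow> ppoint set" where
  "proj_points n =
     {{c \<cdot>\<^sub>v v | c. c \<noteq> 0} | v. v \<in> carrier_vec (n + 1) \<and> v \<noteq> 0\<^sub>v (n + 1)}"

definition zero_locus :: "nat \<Rightarrow> cpoly set \<Rightarrow> ppoint set" where
  "zero_locus n S = {p \<in> proj_points n. \<forall>F\<in>S. \<forall>v\<in>p. poly_eval F v = 0}"

definition zariski_open :: "nat \<Rightarrow> ppoint set \<Rightarrow> bool" where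
  "zariski_open n U \<longleftrightarrow>
     (\<exists>S. (\<forall>F\<in>S. \<exists>d. is_form n d F) \<and> U = proj_points n - zero_locus n S)"

definition zariski :: "nat \<Rightarrow> ppoint topology" where
  "zariski n = topology (zariski_open n)"

lemma mono_eval_superset:
  assumes "finite A" "Poly_Mapping.keys m \<subseteq> A"
  shows "mono_eval m v = (\<Prod>i\<in>A. (v $ i) ^ Poly_Mapping.lookup m i)"
  unfolding mono_eval_def
  by (rule prod.mono_neutral_left) (use assms in \<open>auto simp: in_keys_iff\<close>)

lemma mono_eval_add: "mono_eval (m + k) v = mono_eval m v * mono_eval k v"
proof -
  let ?A = "Poly_Mapping.keys m \<union> Poly_Mapping.keys k"
  have "Poly_Mapping.keys (m + k) \<subseteq> ?A" by (rule keys_add)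
  then show ?thesis
    using mono_eval_superset[of ?A "m + k" v] mono_eval_superset[of ?A m v]
      mono_eval_superset[of ?A k v]
    by (simp add: lookup_add power_add prod.distrib)
qed

lemma mono_degree_add: "mono_degree (m + k) = mono_degree m + mono_degree k"
  unfolding mono_degree_def
  by (rule setsum_keys_plus_distrib[where f = "\<lambda>_ x. x"]) auto

lemma poly_eval_zero [simp]: "poly_eval 0 v = 0"
  by (simp add: poly_eval_def)

lemma poly_eval_add: "poly_eval (F + G) v = poly_eval F v + poly_eval G v"
  unfolding poly_eval_def
  by (rule setsum_keys_plus_distrib[where f = "\<lambda>m x. x * mono_eval m v"])
     (auto simp: algebra_simps)

lemma poly_eval_single: "poly_eval (Poly_Mapping.single m c) v = c * mono_eval m v"
  by (simp add: poly_eval_def)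

lemma update_eq_add_single:
  fixes F :: "'a \<Rightarrow>\<^sub>0 'b::comm_monoid_add"
  shows "m \<notin> Poly_Mapping.keys F \<Longrightarrow> Poly_Mapping.update m c F = Poly_Mapping.single m c + F"
  by (rule poly_mapping_eqI) (auto simp: lookup_update lookup_add lookup_single in_keys_iff when_def)

lemma poly_eval_mult_single:
  "poly_eval (Poly_Mapping.single m c * G) v = poly_eval (Poly_Mapping.single m c) v * poly_eval G v"
  by (induction G rule: update_induct)
     (auto simp: update_eq_add_single distrib_left poly_eval_add mult_single poly_eval_single
        mono_eval_add)

lemma poly_eval_mult: "poly_eval (F * G) v = poly_eval F v * poly_eval G v"
  by (induction F rule: update_induct)
     (auto simp: update_eq_add_single distrib_right poly_eval_add poly_eval_mult_single)

lemma is_form_mult: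
  assumes "is_form n d F" "is_form n e G"
  shows "is_form n (d + e) (F * G)"
  unfolding is_form_def
proof
  fix m assume "m \<in> Poly_Mapping.keys (F * G)"
  then obtain a b where "m = a + b" "a \<in> Poly_Mapping.keys F" "b \<in> Poly_Mapping.keys G"
    using keys_mult[of F G] by blast
  then show "Poly_Mapping.keys m \<subseteq> {..n} \<and> mono_degree m = d + e"
    using assms keys_add[of a b] by (fastforce simp: is_form_def mono_degree_add)
qed

lemma is_form_zero [simp]: "is_form n d 0"
  by (simp add: is_form_def)

lemma poly_eval_smult:
  assumes "is_form n d F" "v \<in> carrier_vec (n + 1)"
  shows "poly_eval F (c \<cdot>\<^sub>v v) = c ^ d * poly_eval F v"
proof -
  have "mono_eval m (c \<cdot>\<^sub>v v) = c ^ d * mono_eval m v" if "m \<in> Poly_Mapping.keys F" for m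
  proof -
    have *: "Poly_Mapping.keys m \<subseteq> {..n}" "(\<Sum>i\<in>Poly_Mapping.keys m. Poly_Mapping.lookup m i) = d"
      using assms(1) that by (auto simp: is_form_def mono_degree_def)
    have "mono_eval m (c \<cdot>\<^sub>v v) = (\<Prod>i\<in>Poly_Mapping.keys m. c ^ Poly_Mapping.lookup m i * (v $ i) ^ Poly_Mapping.lookup m i)"
      unfolding mono_eval_def
      by (rule prod.cong) (use * assms(2) in \<open>auto simp: power_mult_distrib subset_iff less_Suc_eq_le\<close>)
    also have "\<dots> = c ^ d * mono_eval m v"
      by (simp add: prod.distrib mono_eval_def *(2) flip: power_sum)
    finally show ?thesis .
  qed
  then show ?thesis
    by (simp add: poly_eval_def sum_distrib_left mult_ac)
qed

lemma form_zero_on_point: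
  assumes "is_form n d F" "p \<in> proj_points n" "v \<in> p" "w \<in> p" "poly_eval F v = 0"
  shows "poly_eval F w = 0"
proof -
  from assms(2) obtain u where u: "u \<in> carrier_vec (n + 1)" "p = {c \<cdot>\<^sub>v u | c. c \<noteq> 0}"
    by (auto simp: proj_points_def)
  with assms(3,4) obtain a b where "v = a \<cdot>\<^sub>v u" "w = b \<cdot>\<^sub>v u" "a \<noteq> 0" by auto
  with assms(5) u(1) show ?thesis
    by (auto simp: poly_eval_smult[OF assms(1)])
qed

lemma istopology_zariski_open: "istopology (zariski_open n)"
  unfolding istopology_def
proof (intro conjI allI impI)
  fix U V assume "zariski_open n U" "zariski_open n V"
  then obtain S T where
    S: "\<forall>F\<in>S. \<exists>d. is_form n d F" "U = proj_points n - zero_locus n S" and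
    T: "\<forall>F\<in>T. \<exists>d. is_form n d F" "V = proj_points n - zero_locus n T"
    by (auto simp: zariski_open_def)
  let ?P = "{F * G | F G. F \<in> S \<and> G \<in> T}"
  have "zero_locus n ?P = zero_locus n S \<union> zero_locus n T" (is "?L = ?R")
  proof
    show "?R \<subseteq> ?L" by (auto simp: zero_locus_def poly_eval_mult)
    show "?L \<subseteq> ?R"
    proof
      fix p assume p: "p \<in> ?L"
      then have pp: "p \<in> proj_points n" by (simp add: zero_locus_def)
      show "p \<in> ?R"
      proof (rule ccontr)
        assume "p \<notin> ?R"
        then obtain F v G w where
          *: "F \<in> S" "v \<in> p" "poly_eval F v \<noteq> 0" "G \<in> T" "w \<in> p" "poly_eval G w \<noteq> 0"
          using pp by (auto simp: zero_locus_def)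
        with T(1) obtain e where "is_form n e G" by auto
        with * pp have "poly_eval G v \<noteq> 0" using form_zero_on_point by blast
        with * have "poly_eval (F * G) v \<noteq> 0" by (simp add: poly_eval_mult)
        moreover have "poly_eval (F * G) v = 0" using p * by (auto simp: zero_locus_def)
        ultimately show False by simp
      qed
    qed
  qed
  moreover have "\<forall>F\<in>?P. \<exists>d. is_form n d F"
    using S(1) T(1) is_form_mult by fastforce
  ultimately show "zariski_open n (U \<inter> V)"
    unfolding zariski_open_def S(2) T(2) by (intro exI[of _ ?P]) auto
next
  fix \<K> assume "\<forall>K\<in>\<K>. zariski_open n K"
  then obtain S where S: "\<forall>K\<in>\<K>. (\<forall>F\<in>S K. \<exists>d. is_form n d F) \<and> K = proj_points n - zero_locus n (S K)"
    unfolding zariski_open_def by metis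
  have "\<Union>\<K> = proj_points n - zero_locus n (\<Union>(S ` \<K>))"
  proof
    show "\<Union>\<K> \<subseteq> proj_points n - zero_locus n (\<Union>(S ` \<K>))"
    proof
      fix p assume "p \<in> \<Union>\<K>"
      then obtain K where "K \<in> \<K>" "p \<in> K" by auto
      with S have "p \<in> proj_points n - zero_locus n (S K)" by auto
      with \<open>K \<in> \<K>\<close> show "p \<in> proj_points n - zero_locus n (\<Union>(S ` \<K>))"
        by (auto simp: zero_locus_def)
    qed
    show "proj_points n - zero_locus n (\<Union>(S ` \<K>)) \<subseteq> \<Union>\<K>"
    proof
      fix p assume p: "p \<in> proj_points n - zero_locus n (\<Union>(S ` \<K>))"
      then obtain K where "K \<in> \<K>" "p \<in> proj_points n - zero_locus n (S K)"
        by (auto simp: zero_locus_def)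
      with S show "p \<in> \<Union>\<K>" by auto
    qed
  qed
  moreover have "\<forall>F\<in>\<Union>(S ` \<K>). \<exists>d. is_form n d F" using S by auto
  ultimately show "zariski_open n (\<Union>\<K>)"
    unfolding zariski_open_def by blast
qed

lemma openin_zariski: "openin (zariski n) = zariski_open n"
  unfolding zariski_def by (rule topology_inverse'[OF istopology_zariski_open])

lemma topspace_zariski: "topspace (zariski n) = proj_points n"
proof -
  have "zariski_open n (proj_points n)"
    unfolding zariski_open_def
  proof (intro exI conjI)
    show "proj_points n = proj_points n - zero_locus n {1}"
    proof -
      have "\<exists>v. v \<in> p" if "p \<in> proj_points n" for p
        using that by (auto simp: proj_points_def intro!: exI[of _ 1])
      moreover have "poly_eval 1 v = 1" for v
        by (simp add: poly_eval_def mono_eval_def)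
      ultimately show ?thesis by (auto simp: zero_locus_def)
    qed
    show "\<forall>F\<in>{1}. \<exists>d. is_form n d F"
      by (auto simp: is_form_def mono_degree_def)
  qed
  moreover have "U \<subseteq> proj_points n" if "zariski_open n U" for U
    using that by (auto simp: zariski_open_def)
  ultimately show ?thesis
    unfolding topspace_def openin_zariski by blast
qed

section \<open>Spaces with functions\<close>

text \<open>
  Varieties are treated as topological spaces together with a sheaf of complex-valued regular
  functions. Only the values of \<open>f\<close> on \<open>U\<close> matter in \<open>regular \<X> U f\<close>, and the predicate is only
  used for open \<open>U\<close>.
\<close>

record 'a fun_space =
  space_top :: "'a topology"
  regular :: "'a set \<Rightarrow> ('a \<Rightarrow> complex) \<Rightarrow> bool"

definition open_subspace :: "'a fun_space \<Rightarrow> 'a set \<Rightarrow> 'a fun_space" where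
  "open_subspace \<X> U = \<X>\<lparr>space_top := subtopology (space_top \<X>) U\<rparr>"

definition morphism :: "'a fun_space \<Rightarrow> 'b fun_space \<Rightarrow> ('a \<Rightarrow> 'b) \<Rightarrow> bool" where
  "morphism \<X> \<Y> \<phi> \<longleftrightarrow>
     continuous_map (space_top \<X>) (space_top \<Y>) \<phi> \<and>
     (\<forall>V f. openin (space_top \<Y>) V \<and> regular \<Y> V f \<longrightarrow>
        regular \<X> {x \<in> topspace (space_top \<X>). \<phi> x \<in> V} (f \<circ> \<phi>))"

definition isomorphic_spaces :: "'a fun_space \<Rightarrow> 'b fun_space \<Rightarrow> bool" where
  "isomorphic_spaces \<X> \<Y> \<longleftrightarrow>
     (\<exists>\<phi> \<psi>. morphism \<X> \<Y> \<phi> \<and> morphism \<Y> \<X> \<psi> \<and>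
        (\<forall>x\<in>topspace (space_top \<X>). \<psi> (\<phi> x) = x) \<and>
        (\<forall>y\<in>topspace (space_top \<Y>). \<phi> (\<psi> y) = y))"

definition dense_open :: "'a fun_space \<Rightarrow> 'a set \<Rightarrow> bool" where
  "dense_open \<X> U \<longleftrightarrow>
     openin (space_top \<X>) U \<and> space_top \<X> closure_of U = topspace (space_top \<X>)"

definition birational :: "'a fun_space \<Rightarrow> 'b fun_space \<Rightarrow> bool" where
  "birational \<X> \<Y> \<longleftrightarrow>
     (\<exists>U V. dense_open \<X> U \<and> dense_open \<Y> V \<and>
        isomorphic_spaces (open_subspace \<X> U) (open_subspace \<Y> V))"

text \<open>
  For a closed subset \<open>X\<close> of projective \<open>n\<close>-space: regular functions are locally quotients of forms
  of equal degree. The quotient does not depend on the chosen homogeneous coordinates \<open>v\<close>.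
\<close>

definition proj_variety :: "nat \<Rightarrow> ppoint set \<Rightarrow> ppoint fun_space" where
  "proj_variety n X =
     \<lparr>space_top = subtopology (zariski n) X,
      regular = (\<lambda>U f. \<forall>p\<in>U. \<exists>W d F G. openin (subtopology (zariski n) X) W \<and> p \<in> W \<and> W \<subseteq> U \<and>
         is_form n d F \<and> is_form n d G \<and>
         (\<forall>q\<in>W. \<forall>v\<in>q. poly_eval G v \<noteq> 0 \<and> f q = poly_eval F v / poly_eval G v))\<rparr>"

definition proj_space :: "nat \<Rightarrow> ppoint fun_space" where
  "proj_space n = proj_variety n (proj_points n)"

definition rational_variety :: "'a fun_space \<Rightarrow> bool" where
  "rational_variety \<X> \<longleftrightarrow> (\<exists>n. birational \<X> (proj_space n))"

section \<open>Quotients by group actions\<close>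

text \<open>
  The points of the quotient are the orbits, its topology is the quotient topology, and a function
  on an open set of orbits is regular iff its pullback along the orbit map is. The pullbacks are
  exactly the invariant regular functions, so for a finite group acting on a projective variety
  this is the usual quotient variety.
\<close>

definition quotient_open ::
  "('g, 'm) monoid_scheme \<Rightarrow> ('g \<Rightarrow> 'a \<Rightarrow> 'a) \<Rightarrow> 'a topology \<Rightarrow> 'a set set \<Rightarrow> bool" where
  "quotient_open G act T U \<longleftrightarrow>
     U \<subseteq> orbits G (topspace T) act \<and> openin T {x \<in> topspace T. orbit G act x \<in> U}"

definition quotient_space ::
  "('g, 'm) monoid_scheme \<Rightarrow> ('g \<Rightarrow> 'a \<Rightarrow> 'a) \<Rightarrow> 'a fun_space \<Rightarrow> 'a set fun_space" where
  "quotient_space G act \<X> =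
     \<lparr>space_top = topology (quotient_open G act (space_top \<X>)),
      regular = (\<lambda>U f. regular \<X> {x \<in> topspace (space_top \<X>). orbit G act x \<in> U}
                                   (\<lambda>x. f (orbit G act x)))\<rparr>"

lemma istopology_quotient_open: "istopology (quotient_open G act T)"
  unfolding istopology_def
proof (intro conjI allI impI)
  fix U V assume "quotient_open G act T U" "quotient_open G act T V"
  moreover have "{x \<in> topspace T. orbit G act x \<in> U \<inter> V} =
      {x \<in> topspace T. orbit G act x \<in> U} \<inter> {x \<in> topspace T. orbit G act x \<in> V}" by auto
  ultimately show "quotient_open G act T (U \<inter> V)"
    unfolding quotient_open_def by auto
next
  fix \<K> assume *: "\<forall>K\<in>\<K>. quotient_open G act T K"
  have "{x \<in> topspace T. orbit G act x \<in> \<Union>\<K>} =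
      (\<Union>K\<in>\<K>. {x \<in> topspace T. orbit G act x \<in> K})" by auto
  with * show "quotient_open G act T (\<Union>\<K>)"
    unfolding quotient_open_def by (auto intro!: openin_Union)
qed

lemma openin_quotient_space:
  "openin (space_top (quotient_space G act \<X>)) = quotient_open G act (space_top \<X>)"
  by (simp add: quotient_space_def topology_inverse'[OF istopology_quotient_open])

section \<open>The projective linear group\<close>

definition GL :: "nat \<Rightarrow> complex mat monoid" where
  "GL n = units_of (ring_mat TYPE(complex) n ())"

definition scalar_mats :: "nat \<Rightarrow> complex mat set" where
  "scalar_mats n = {c \<cdot>\<^sub>m 1\<^sub>m n | c. c \<noteq> 0}"

definition PGL :: "nat \<Rightarrow> complex mat set monoid" where
  "PGL n = GL n Mod scalar_mats n"

definition pgl_class :: "nat \<Rightarrow> complex mat \<Rightarrow> complex mat set" where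
  "pgl_class n A = scalar_mats n #>\<^bsub>GL n\<^esub> A"

text \<open>
  Both elements of \<open>PGL\<close> and points are sets of representatives; the image point consists of all
  products of representatives.
\<close>

definition pgl_act :: "complex mat set \<Rightarrow> ppoint \<Rightarrow> ppoint" where
  "pgl_act g p = {A *\<^sub>v v | A v. A \<in> g \<and> v \<in> p}"

section \<open>Smooth hypersurfaces and the cyclic group of order three\<close>

definition smooth_hypersurface :: "nat \<Rightarrow> nat \<Rightarrow> ppoint set \<Rightarrow> bool" where
  "smooth_hypersurface n d X \<longleftrightarrow>
     (\<exists>F. is_form n d F \<and> F \<noteq> 0 \<and> X = zero_locus n {F} \<and>
        (\<forall>p\<in>X. \<forall>v\<in>p. \<exists>i\<le>n. poly_eval (partial_deriv i F) v \<noteq> 0))"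

definition primitive_root_of_unity :: "nat \<Rightarrow> complex \<Rightarrow> bool" where
  "primitive_root_of_unity k \<xi> \<longleftrightarrow> k > 0 \<and> \<xi> ^ k = 1 \<and> (\<forall>j. 0 < j \<and> j < k \<longrightarrow> \<xi> ^ j \<noteq> 1)"

definition G\<^sub>1 :: "complex \<Rightarrow> complex mat set monoid" where
  "G\<^sub>1 \<xi> = subgroup_generated (PGL 5) {pgl_class 5 (mat_diag 5 (\<lambda>i. [1, \<xi>, \<xi>\<^sup>2, \<xi>\<^sup>2, 1] ! i))}"

end

theory Submission
  imports Defs "HOL-Computational_Algebra.Fundamental_Theorem_Algebra"
begin

text \<open>
  A cubic form vanishing on a smooth cubic is a multiple of its equation \<open>F\<close>: otherwise the
  discriminant of \<open>F\<close> along a fixed direction would vanish identically, and a point with a triple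
  root would be singular. So \<open>F\<close> is semi-invariant; a nontrivial character would produce a
  singular point on a line of fixed points, hence \<open>F\<close> is invariant. Smoothness then yields linear
  coordinates \<open>a, b\<close> (weight 0), \<open>u\<close> (weight 1) and \<open>s, t\<close> (weight 2) with, up to a scalar,
  \<open>F = ab(f\<^sub>1a + f\<^sub>2b) + u\<^sup>3 + uB(a,b;s,t) + st(h\<^sub>1s + h\<^sub>2t)\<close>, where \<open>B\<close> is bilinear.

  The functions \<open>\<alpha> = ab/us\<close>, \<open>\<beta> = st/ua\<close>, \<open>z = t/s\<close> and \<open>y = b/a\<close> generate the invariant rational
  functions, and \<open>F/aus\<close> equals
  \<open>\<alpha>(f\<^sub>1 + f\<^sub>2y) + yz/\<alpha>\<beta> + B(1,y;1,z) + \<beta>(h\<^sub>1 + h\<^sub>2z)\<close>, which is linear in \<open>y\<close>. Hence \<open>\<alpha>, \<beta>, z\<close> are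
  coordinates on a dense open subset of the quotient.
\<close>

section \<open>Forms as functions\<close>

text \<open>Three obstacles shape the proof. No ideals are handled: proportionality of cubics is
  read off from the three roots of \<open>F\<close> on parallel lines, so the fundamental theorem of
  algebra takes the place of the Nullstellensatz. Density of the locus where the coordinates are
  defined is not deduced from irreducibility of X but from continuity of roots: a zero of the cubic
  is followed over a line until it leaves a given proper closed subset. Finally, the point belonging
  to parameters \<alpha>, \<beta>, z is found only after extracting a cube root, so the inverse map
  is not given by regular functions on vectors. It is shown to be a morphism by averaging over the
  group numerators and denominators of functions on X.

  The equation is linear in y for two reasons: both monomials of the cubic in a, b contain ab =
  \<alpha>us, and \<alpha>\<beta> = bt/u^2 is linear in b, which takes care of u^3. Forms are
  treated as functions on vectors, so that substitutions and expansions are proved monomial by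
  monomial.\<close>

definition hform :: "nat \<Rightarrow> nat \<Rightarrow> (complex vec \<Rightarrow> complex) \<Rightarrow> bool" where
  "hform n d \<phi> \<longleftrightarrow> (\<exists>F. is_form n d F \<and> \<phi> = poly_eval F)"

lemma is_form_add: "is_form n d F \<Longrightarrow> is_form n d G \<Longrightarrow> is_form n d (F + G)"
  unfolding is_form_def using keys_add[of F G] by blast

lemma hform_poly_eval: "is_form n d F \<Longrightarrow> hform n d (poly_eval F)"
  by (auto simp: hform_def)

lemma hform_zero: "hform n d (\<lambda>v. 0)"
  unfolding hform_def by (intro exI[of _ 0]) auto

lemma hform_add:
  assumes "hform n d f" "hform n d g" shows "hform n d (\<lambda>v. f v + g v)"
proof -
  obtain F G where F: "is_form n d F" "f = poly_eval F" and G: "is_form n d G" "g = poly_eval G"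
    using assms by (auto simp: hform_def)
  have "(\<lambda>v. f v + g v) = poly_eval (F + G)" by (simp add: F G poly_eval_add[abs_def])
  with is_form_add[OF F(1) G(1)] show ?thesis unfolding hform_def by blast
qed

lemma hform_mult:
  assumes "hform n d f" "hform n e g" shows "hform n (d + e) (\<lambda>v. f v * g v)"
proof -
  obtain F G where F: "is_form n d F" "f = poly_eval F" and G: "is_form n e G" "g = poly_eval G"
    using assms by (auto simp: hform_def)
  have "(\<lambda>v. f v * g v) = poly_eval (F * G)" by (simp add: F G poly_eval_mult[abs_def])
  with is_form_mult[OF F(1) G(1)] show ?thesis unfolding hform_def by blast
qed

lemma hform_const: "hform n 0 (\<lambda>v. c)"
  unfolding hform_def
  by (intro exI[of _ "Poly_Mapping.single 0 c"])
     (auto simp: is_form_def poly_eval_single mono_eval_def mono_degree_def)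

lemma hform_coord: "i \<le> n \<Longrightarrow> hform n 1 (\<lambda>v. v $ i)"
  unfolding hform_def
  by (intro exI[of _ "Poly_Mapping.single (Poly_Mapping.single i 1) 1"])
     (auto simp: is_form_def poly_eval_single mono_eval_def mono_degree_def)

lemma hform_cmult: "hform n d f \<Longrightarrow> hform n d (\<lambda>v. c * f v)"
  using hform_mult[OF hform_const, of n d f c] by simp

lemma hform_uminus: "hform n d f \<Longrightarrow> hform n d (\<lambda>v. - f v)"
  using hform_cmult[of n d f "-1"] by simp

lemma hform_diff: "hform n d f \<Longrightarrow> hform n d g \<Longrightarrow> hform n d (\<lambda>v. f v - g v)"
  using hform_add[of n d f "\<lambda>v. - g v"] hform_uminus[of n d g] by simp

lemma hform_power: "hform n d f \<Longrightarrow> hform n (k * d) (\<lambda>v. f v ^ k)"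
proof (induction k)
  case 0 then show ?case using hform_const by simp
next
  case (Suc k) then show ?case using hform_mult[of n d f "k * d"] by simp
qed

lemma hform_power1: "hform n 1 f \<Longrightarrow> hform n k (\<lambda>v. f v ^ k)"
  using hform_power[of n 1 f k] by simp

lemma hform_prod:
  "finite A \<Longrightarrow> (\<And>i. i \<in> A \<Longrightarrow> hform n (d i) (f i)) \<Longrightarrow> hform n (\<Sum>i\<in>A. d i) (\<lambda>v. \<Prod>i\<in>A. f i v)"
  by (induction A rule: finite_induct) (auto intro!: hform_const hform_mult)

lemma hform_scale:
  "hform n d f \<Longrightarrow> v \<in> carrier_vec (n + 1) \<Longrightarrow> f (c \<cdot>\<^sub>v v) = c ^ d * f v"
  unfolding hform_def using poly_eval_smult by blast

lemma hform_at_zero: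
  assumes "hform n d f" "d > 0" shows "f (0\<^sub>v (n + 1)) = 0"
proof -
  have "0 \<cdot>\<^sub>v 0\<^sub>v (n + 1) = (0\<^sub>v (n + 1) :: complex vec)" by (intro eq_vecI) auto
  then show ?thesis using hform_scale[OF assms(1), of "0\<^sub>v (n+1)" 0] assms(2)
    by (simp add: power_0_left)
qed

lemma mono_eval_atMost:
  "Poly_Mapping.keys m \<subseteq> {..n} \<Longrightarrow> mono_eval m v = (\<Prod>i\<le>n. (v $ i) ^ Poly_Mapping.lookup m i)"
  by (rule mono_eval_superset) auto

lemma mono_degree_atMost:
  "Poly_Mapping.keys m \<subseteq> {..n} \<Longrightarrow> mono_degree m = (\<Sum>i\<le>n. Poly_Mapping.lookup m i)"
  unfolding mono_degree_def by (rule sum.mono_neutral_left) (auto simp: in_keys_iff)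

text \<open>Exponents are indexed by all of \<open>{..n}\<close> and not by the keys of a monomial,
  so that products over the coordinates have a fixed index set in every application.\<close>

lemma hform_induct [consumes 1, case_names zero add mono]:
  assumes "hform n d \<phi>"
    and zero: "Q (\<lambda>v. 0)"
    and add: "\<And>f g. Q f \<Longrightarrow> Q g \<Longrightarrow> Q (\<lambda>v. f v + g v)"
    and mono: "\<And>e c. (\<Sum>i\<le>n. e i) = d \<Longrightarrow> Q (\<lambda>v. c * (\<Prod>i\<le>n. (v $ i) ^ e i))"
  shows "Q \<phi>"
proof -
  obtain F where F: "is_form n d F" "\<phi> = poly_eval F" using assms(1) by (auto simp: hform_def)
  have "Q (\<lambda>v. \<Sum>m\<in>A. Poly_Mapping.lookup F m * mono_eval m v)"
    if "finite A" "A \<subseteq> Poly_Mapping.keys F" for A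
    using that
  proof (induction A rule: finite_induct)
    case empty then show ?case using zero by simp
  next
    case (insert m A)
    then have k: "Poly_Mapping.keys m \<subseteq> {..n}" "mono_degree m = d"
      using F(1) by (auto simp: is_form_def)
    have "Q (\<lambda>v. Poly_Mapping.lookup F m * mono_eval m v)"
      using mono[of "Poly_Mapping.lookup m" "Poly_Mapping.lookup F m"] k
      by (simp add: mono_eval_atMost mono_degree_atMost)
    from add[OF this insert.IH] show ?case using insert by simp
  qed
  from this[of "Poly_Mapping.keys F"] show ?thesis by (simp add: F(2) poly_eval_def[abs_def])
qed

section \<open>Restriction of forms to lines and expansion along a fixed direction\<close>

lemma coeff_mult_top:
  fixes p q :: "'a::comm_semiring_1 poly"
  assumes "degree p \<le> a" "degree q \<le> b"
  shows "coeff (p * q) (a + b) = coeff p a * coeff q b"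
proof -
  have "coeff (p * q) (a + b) = (\<Sum>i\<le>a + b. coeff p i * coeff q (a + b - i))" by (simp add: coeff_mult)
  also have "\<dots> = (\<Sum>i\<in>{a}. coeff p i * coeff q (a + b - i))"
  proof (rule sum.mono_neutral_right)
    show "\<forall>i\<in>{..a + b} - {a}. coeff p i * coeff q (a + b - i) = 0"
    proof
      fix i assume i: "i \<in> {..a + b} - {a}"
      then consider "i > a" | "a + b - i > b" by force
      then show "coeff p i * coeff q (a + b - i) = 0"
        using assms by cases (auto simp: coeff_eq_0)
    qed
  qed auto
  finally show ?thesis by simp
qed

text \<open>The coefficient of t^d is the value at the direction \<open>w\<close>, the point at
  infinity of the line. It is recorded even if it is 0, because a nonzero value at \<open>v\<close>
  or at \<open>w\<close> is enough to make the polynomial nonzero.\<close>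

lemma hform_line:
  assumes "hform n d \<phi>" "v \<in> carrier_vec (n + 1)" "w \<in> carrier_vec (n + 1)"
  obtains P where "degree P \<le> d" "coeff P d = \<phi> w" "\<And>t. poly P t = \<phi> (v + t \<cdot>\<^sub>v w)"
proof -
  have "\<exists>P. degree P \<le> d \<and> coeff P d = \<phi> w \<and> (\<forall>t. poly P t = \<phi> (v + t \<cdot>\<^sub>v w))"
    using assms(1)
  proof (induction rule: hform_induct)
    case zero show ?case by (rule exI[of _ 0]) simp
  next
    case (add f g)
    then obtain P Q where "degree P \<le> d \<and> coeff P d = f w \<and> (\<forall>t. poly P t = f (v + t \<cdot>\<^sub>v w))"
      "degree Q \<le> d \<and> coeff Q d = g w \<and> (\<forall>t. poly Q t = g (v + t \<cdot>\<^sub>v w))" by blast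
    then show ?case by (intro exI[of _ "P + Q"]) (auto intro: degree_add_le)
  next
    case (mono e c)
    have l: "degree [:v $ i, w $ i:] \<le> 1" for i by simp
    have pd: "degree ([:v $ i, w $ i:] ^ k) \<le> k" for i k
      by (rule order.trans[OF degree_power_le]) (use l in simp)
    have pw: "degree ([:v $ i, w $ i:] ^ k) \<le> k \<and> coeff ([:v $ i, w $ i:] ^ k) k = (w $ i) ^ k" for i k
    proof (induction k)
      case (Suc k)
      have "coeff ([:v $ i, w $ i:] ^ Suc k) (1 + k) = coeff [:v $ i, w $ i:] 1 * coeff ([:v $ i, w $ i:] ^ k) k"
        unfolding power_Suc by (rule coeff_mult_top[OF l pd])
      then show ?case using Suc pd[of i "Suc k"] by simp
    qed simp
    have pr: "degree (\<Prod>i\<in>A. [:v $ i, w $ i:] ^ e i) \<le> (\<Sum>i\<in>A. e i) \<and>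
       coeff (\<Prod>i\<in>A. [:v $ i, w $ i:] ^ e i) (\<Sum>i\<in>A. e i) = (\<Prod>i\<in>A. (w $ i) ^ e i)"
      if "finite A" for A using that
    proof (induction A rule: finite_induct)
      case (insert i A)
      then have "degree ([:v $ i, w $ i:] ^ e i * (\<Prod>i\<in>A. [:v $ i, w $ i:] ^ e i)) \<le> e i + (\<Sum>i\<in>A. e i)"
        using pw[where k = "e i"] by (meson add_le_mono degree_mult_le order.trans)
      then show ?case
        using insert pw[where k = "e i"] coeff_mult_top[of "[:v $ i, w $ i:] ^ e i" "e i"
          "\<Prod>i\<in>A. [:v $ i, w $ i:] ^ e i" "\<Sum>i\<in>A. e i"] by simp
    qed auto
    have "poly [:v $ i, w $ i:] t = (v + t \<cdot>\<^sub>v w) $ i" if "i \<le> n" for i t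
      using that assms by simp
    then have "poly (smult c (\<Prod>i\<le>n. [:v $ i, w $ i:] ^ e i)) t = c * (\<Prod>i\<le>n. ((v + t \<cdot>\<^sub>v w) $ i) ^ e i)" for t
      by (simp add: poly_prod)
    then show ?case using pr[of "{..n}"] mono
      by (intro exI[of _ "smult c (\<Prod>i\<le>n. [:v $ i, w $ i:] ^ e i)"])
         (auto intro: order.trans[OF degree_smult_le])
  qed
  then show thesis using that by blast
qed

lemma hform_line_finite:
  assumes "hform n d f" "v \<in> carrier_vec (n + 1)" "w \<in> carrier_vec (n + 1)" "f v \<noteq> 0 \<or> f w \<noteq> 0"
  shows "finite {t. f (v + t \<cdot>\<^sub>v w) = 0}"
proof -
  obtain P where P: "coeff P d = f w" "\<And>t. poly P t = f (v + t \<cdot>\<^sub>v w)"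
    using hform_line[OF assms(1-3)] by blast
  have "v + 0 \<cdot>\<^sub>v w = v" using assms by (intro eq_vecI) auto
  then have "poly P 0 = f v" using P(2)[of 0] by simp
  then have "P \<noteq> 0" using P(1) assms(4) by auto
  then show ?thesis using poly_roots_finite[of P] by (simp add: P(2))
qed

lemma hform_subst:
  assumes "hform n d \<phi>" "\<And>i. i \<le> n \<Longrightarrow> hform m 1 (l i)"
  shows "hform m d (\<lambda>w. \<phi> (vec (n + 1) (\<lambda>i. l i w)))"
  using assms(1)
proof (induction rule: hform_induct)
  case (mono e c)
  have "hform m (\<Sum>i\<le>n. e i) (\<lambda>w. \<Prod>i\<le>n. l i w ^ e i)"
    by (rule hform_prod, simp, rule hform_power1, rule assms(2)) simp
  from hform_cmult[OF this, of c] show ?case using mono by simp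
next
  case zero show ?case by (rule hform_zero)
next
  case (add f g) then show ?case by (rule hform_add)
qed

text \<open>The parameter u becomes a new variable number n + 1, appended by \<open>ext\<close>;
  \<open>\<psi>\<close> is a form in the enlarged set of variables, and its coefficients with
  respect to the new variable are forms in the old ones.\<close>

lemma hform_shift_expand:
  assumes "hform n d \<phi>" "p \<in> carrier_vec (n + 1)"
  obtains e where "\<And>j. j \<le> d \<Longrightarrow> hform n (d - j) (e j)"
    "\<And>x u. x \<in> carrier_vec (n + 1) \<Longrightarrow> \<phi> (x + u \<cdot>\<^sub>v p) = (\<Sum>j\<le>d. e j x * u ^ j)"
proof -
  define ext where "ext = (\<lambda>x u. vec (n + 2) (\<lambda>i. if i \<le> n then x $ i else u :: complex))"
  define \<psi> where "\<psi> = (\<lambda>w. \<phi> (vec (n + 1) (\<lambda>i. w $ i + p $ i * w $ (n + 1))))"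
  have h: "hform (n + 1) d \<psi>"
    unfolding \<psi>_def
    by (rule hform_subst[OF assms(1)])
       (intro hform_add hform_cmult hform_coord, auto)
  have "\<exists>e. (\<forall>j\<le>d. hform n (d - j) (e j)) \<and>
      (\<forall>x u. x \<in> carrier_vec (n + 1) \<longrightarrow> \<psi> (ext x u) = (\<Sum>j\<le>d. e j x * u ^ j))"
    using h
  proof (induction rule: hform_induct)
    case zero show ?case by (rule exI[of _ "\<lambda>_ _. 0"]) (auto intro: hform_zero)
  next
    case (add f g)
    obtain a where "\<forall>j\<le>d. hform n (d - j) (a j)"
      "\<forall>x u. x \<in> carrier_vec (n + 1) \<longrightarrow> f (ext x u) = (\<Sum>j\<le>d. a j x * u ^ j)"
      using add(1) by blast
    moreover obtain b where "\<forall>j\<le>d. hform n (d - j) (b j)"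
      "\<forall>x u. x \<in> carrier_vec (n + 1) \<longrightarrow> g (ext x u) = (\<Sum>j\<le>d. b j x * u ^ j)"
      using add(2) by blast
    ultimately show ?case
      by (intro exI[of _ "\<lambda>j x. a j x + b j x"])
         (auto intro!: hform_add simp: distrib_right sum.distrib)
  next
    case (mono k c)
    define K where "K = k (n + 1)"
    have K: "(\<Sum>i\<le>n. k i) + K = d" using mono by (simp add: K_def)
    have 1: "hform n (\<Sum>i\<le>n. k i) (\<lambda>x. \<Prod>i\<le>n. (x $ i) ^ k i)"
      by (rule hform_prod, simp, rule hform_power1, rule hform_coord) simp
    have "c * (\<Prod>i\<le>n + 1. (ext x u $ i) ^ k i) = (\<Sum>j\<le>d. (if j = K then c * (\<Prod>i\<le>n. (x $ i) ^ k i) else 0) * u ^ j)" for x u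
    proof -
      have "(\<Prod>i\<le>n + 1. (ext x u $ i) ^ k i) = (\<Prod>i\<le>n. (ext x u $ i) ^ k i) * u ^ K"
        by (simp add: ext_def K_def)
      also have "(\<Prod>i\<le>n. (ext x u $ i) ^ k i) = (\<Prod>i\<le>n. (x $ i) ^ k i)"
        by (intro prod.cong) (auto simp: ext_def)
      finally show ?thesis using K by (simp add: if_distrib[of "\<lambda>x. x * _"] cong: if_cong)
    qed
    moreover have "hform n (d - j) (\<lambda>x. if j = K then c * (\<Prod>i\<le>n. (x $ i) ^ k i) else 0)" for j
      using hform_cmult[OF 1, of c] K by (cases "j = K") (auto intro: hform_zero)
    ultimately show ?case
      by (intro exI[of _ "\<lambda>j x. if j = K then c * (\<Prod>i\<le>n. (x $ i) ^ k i) else 0"]) auto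
  qed
  then obtain e where e: "\<forall>j\<le>d. hform n (d - j) (e j)"
      "\<forall>x u. x \<in> carrier_vec (n + 1) \<longrightarrow> \<psi> (ext x u) = (\<Sum>j\<le>d. e j x * u ^ j)" by blast
  moreover have "\<psi> (ext x u) = \<phi> (x + u \<cdot>\<^sub>v p)" if "x \<in> carrier_vec (n + 1)" for x u
    unfolding \<psi>_def using assms(2) that
    by (intro arg_cong[of _ _ \<phi>] eq_vecI) (auto simp: ext_def)
  ultimately have "\<phi> (x + u \<cdot>\<^sub>v p) = (\<Sum>j\<le>d. e j x * u ^ j)" if "x \<in> carrier_vec (n + 1)" for x u
    using that by simp
  with e(1) show thesis using that by blast
qed

section \<open>Cubic forms vanishing on a smooth cubic hypersurface\<close>

lemma cubic_factorization:
  fixes A b c f :: complex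
  assumes "A \<noteq> 0"
  obtains r s t where "\<And>u. A * u ^ 3 + b * u ^ 2 + c * u + f = A * (u - r) * (u - s) * (u - t)"
proof -
  have "\<not> constant (poly [:f, c, b, A:])" using assms by (simp add: constant_degree)
  then obtain r where "poly [:f, c, b, A:] r = 0" using fundamental_theorem_of_algebra by blast
  then have r: "A * r ^ 3 + b * r ^ 2 + c * r + f = 0" by (simp add: algebra_simps power2_eq_square power3_eq_cube)
  define b' c' where "b' = b + A * r" "c' = c + b' * r"
  have "\<not> constant (poly [:c', b', A:])" using assms by (simp add: constant_degree)
  then obtain s where "poly [:c', b', A:] s = 0" using fundamental_theorem_of_algebra by blast
  then have s: "A * s ^ 2 + b' * s + c' = 0" by (simp add: algebra_simps power2_eq_square)
  define t where "t = - (b' + A * s) / A"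
  have t: "A * t = - (b' + A * s)" using assms by (simp add: t_def)
  show thesis
  proof (rule that[of r s t])
    fix u
    have "A * (u - r) * (u - s) * (u - t) = (u - r) * (u - s) * (A * u - A * t)" by Groebner_Basis.algebra
    also have "\<dots> = (u - r) * (A * u ^ 2 + b' * u + c')"
      unfolding t using s by Groebner_Basis.algebra
    also have "\<dots> = A * u ^ 3 + b * u ^ 2 + c * u + f"
      using r unfolding b'_c'_def by Groebner_Basis.algebra
    finally show "A * u ^ 3 + b * u ^ 2 + c * u + f = A * (u - r) * (u - s) * (u - t)" by simp
  qed
qed

text \<open>The discriminant of A u^3 + b u^2 + c u + f.\<close>

definition cubic_disc :: "complex \<Rightarrow> complex \<Rightarrow> complex \<Rightarrow> complex \<Rightarrow> complex" where
  "cubic_disc A b c f = b\<^sup>2 * c\<^sup>2 - 4 * A * c ^ 3 - 4 * b ^ 3 * f + 18 * A * b * c * f - 27 * A\<^sup>2 * f\<^sup>2"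

lemma cubic_coeffs_eq:
  fixes A b c f b' c' f' :: complex
  assumes "\<And>u. A * u ^ 3 + b * u ^ 2 + c * u + f = A * u ^ 3 + b' * u ^ 2 + c' * u + f'"
  shows "b = b'" "c = c'" "f = f'"
proof -
  show f: "f = f'" using assms[of 0] by simp
  have 1: "b + c = b' + c'" using assms[of 1] f by simp
  have 2: "b - c = b' - c'" using assms[of "-1"] f by (simp add: algebra_simps)
  have "2 * b = 2 * b'" using 1 2 by Groebner_Basis.algebra
  then show b: "b = b'" by simp
  show "c = c'" using 1 b by simp
qed

text \<open>Comparing coefficients with the factorisation turns the discriminant into A^4 times the
  squared product of the root differences.\<close>

lemma cubic_disc_nonzero_distinct_roots:
  fixes A b c f :: complex
  assumes "A \<noteq> 0" "cubic_disc A b c f \<noteq> 0"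
  obtains r s t where "r \<noteq> s" "s \<noteq> t" "r \<noteq> t"
    "\<And>u. u \<in> {r, s, t} \<Longrightarrow> A * u ^ 3 + b * u ^ 2 + c * u + f = 0"
proof -
  obtain r s t where rst: "\<And>u. A * u ^ 3 + b * u ^ 2 + c * u + f = A * (u - r) * (u - s) * (u - t)"
    using cubic_factorization[OF assms(1)] by blast
  have "A * u ^ 3 + b * u ^ 2 + c * u + f =
    A * u ^ 3 + (- A * (r + s + t)) * u ^ 2 + (A * (r * s + s * t + r * t)) * u + (- A * r * s * t)" for u
    unfolding rst by Groebner_Basis.algebra
  from cubic_coeffs_eq[OF this]
  have "b = - A * (r + s + t)" "c = A * (r * s + s * t + r * t)" "f = - A * r * s * t" by auto
  then have "cubic_disc A b c f = A ^ 4 * ((r - s) * (s - t) * (r - t))\<^sup>2"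
    unfolding cubic_disc_def by Groebner_Basis.algebra
  with assms(2) have "r \<noteq> s" "s \<noteq> t" "r \<noteq> t" by auto
  with that rst show thesis by auto
qed

text \<open>Only the constant term is recorded, since it will be the value of a form at the base
  point of a line.\<close>

lemma quadratic_three_roots:
  fixes g h k :: complex
  assumes "r \<noteq> s" "s \<noteq> t" "r \<noteq> t" "\<And>u. u \<in> {r, s, t} \<Longrightarrow> g * u ^ 2 + h * u + k = 0"
  shows "k = 0"
proof -
  have 1: "g * r ^ 2 + h * r + k = 0" and 2: "g * s ^ 2 + h * s + k = 0" and 3: "g * t ^ 2 + h * t + k = 0"
    using assms(4) by auto
  have "(r - s) * (g * (r + s) + h) = 0" using 1 2 by Groebner_Basis.algebra
  then have 4: "g * (r + s) + h = 0" using assms(1) by simp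
  have "(r - t) * (g * (r + t) + h) = 0" using 1 3 by Groebner_Basis.algebra
  then have "g * (r + t) + h = 0" using assms(3) by simp
  with 4 have "g * (s - t) = 0" by Groebner_Basis.algebra
  then have "g = 0" using assms(2) by simp
  with 4 1 show ?thesis by simp
qed

text \<open>With r = -b/3A the last hypothesis forces c = 3Ar^2, and then the discriminant becomes
  -27 A^2 (f + A r^3)^2.\<close>

lemma triple_root:
  fixes A b c f :: complex
  assumes "A \<noteq> 0" "cubic_disc A b c f = 0" "b\<^sup>2 = 3 * A * c"
  shows "A * u ^ 3 + b * u ^ 2 + c * u + f = A * (u - (- b / (3 * A))) ^ 3"
proof -
  define r where "r = - b / (3 * A)"
  have b: "b = - 3 * A * r" using assms(1) by (simp add: r_def)
  have "3 * A * (c - 3 * A * r\<^sup>2) = 0" using assms(3) unfolding b by Groebner_Basis.algebra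
  then have c: "c = 3 * A * r\<^sup>2" using assms(1) by simp
  have "A\<^sup>2 * (f + A * r ^ 3)\<^sup>2 * 27 = 0"
    using assms(2) unfolding cubic_disc_def b c by Groebner_Basis.algebra
  then have "f + A * r ^ 3 = 0" using assms(1) by simp
  then have f: "f = - A * r ^ 3" by Groebner_Basis.algebra
  show ?thesis unfolding r_def[symmetric] unfolding b c f by Groebner_Basis.algebra
qed

lemma hform_degree_0:
  assumes "hform n 0 f" "x \<in> carrier_vec (n + 1)"
  shows "f x = f (0\<^sub>v (n + 1))"
proof -
  have "0 \<cdot>\<^sub>v x = 0\<^sub>v (n + 1)" using assms(2) by (intro eq_vecI) auto
  then show ?thesis using hform_scale[OF assms, of 0] by simp
qed

lemma hform_cubic_expand:
  assumes "hform n 3 F" "p \<in> carrier_vec (n + 1)"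
  obtains b c where "hform n 1 b" "hform n 2 c"
    "\<And>x u. x \<in> carrier_vec (n + 1) \<Longrightarrow> F (x + u \<cdot>\<^sub>v p) = F p * u ^ 3 + b x * u ^ 2 + c x * u + F x"
proof -
  obtain e where e: "\<And>j. j \<le> 3 \<Longrightarrow> hform n (3 - j) (e j)"
    "\<And>x u. x \<in> carrier_vec (n + 1) \<Longrightarrow> F (x + u \<cdot>\<^sub>v p) = (\<Sum>j\<le>3. e j x * u ^ j)"
    using hform_shift_expand[OF assms] by blast
  have e': "F (x + u \<cdot>\<^sub>v p) = e 3 x * u ^ 3 + e 2 x * u ^ 2 + e 1 x * u + e 0 x"
    if "x \<in> carrier_vec (n + 1)" for x u
    using e(2)[OF that, of u] by (simp add: eval_nat_numeral algebra_simps)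
  have z: "0\<^sub>v (n + 1) + 1 \<cdot>\<^sub>v p = p" using assms(2) by (intro eq_vecI) auto
  \<comment> \<open>Coefficients of positive degree vanish at the origin, so x = 0, u = 1 identifies
    the constant \<open>e 3\<close> as F(p).\<close>
  have "e j (0\<^sub>v (n + 1)) = 0" if "j < 3" for j
    by (rule hform_at_zero[OF e(1)]) (use that in auto)
  then have "e 3 (0\<^sub>v (n + 1)) = F p" using e'[of "0\<^sub>v (n + 1)" 1] unfolding z by simp
  then have 3: "e 3 x = F p" if "x \<in> carrier_vec (n + 1)" for x
    using hform_degree_0[of n "e 3" x] e(1)[of 3] that by simp
  have 0: "e 0 x = F x" if "x \<in> carrier_vec (n + 1)" for x
  proof -
    have "x + 0 \<cdot>\<^sub>v p = x" using assms(2) that by (intro eq_vecI) auto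
    then show ?thesis using e'[OF that, of 0] by simp
  qed
  show thesis
    using that[of "e 2" "e 1"] e(1)[of 1] e(1)[of 2] e' 0 3 by auto
qed

text \<open>A projective line meets every hypersurface: if the top coefficient \<open>f w\<close> is
  nonzero, the restriction to the affine line has degree d > 0 and hence a root.\<close>

lemma hform_pencil_zero:
  assumes "hform n d f" "d > 0" "v \<in> carrier_vec (n + 1)" "w \<in> carrier_vec (n + 1)"
  obtains "f w = 0" | t where "f (v + t \<cdot>\<^sub>v w) = 0"
proof (cases "f w = 0")
  case False
  obtain P where P: "degree P \<le> d" "coeff P d = f w" "\<And>t. poly P t = f (v + t \<cdot>\<^sub>v w)"
    using hform_line[OF assms(1,3,4)] by blast
  from False P(1,2) have "degree P = d" using le_degree[of P d] by simp
  then have "\<not> constant (poly P)" using assms(2) by (simp add: constant_degree)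
  then obtain t where "poly P t = 0" using fundamental_theorem_of_algebra by blast
  then show ?thesis using that(2) P(3) by simp
qed (use that in auto)

text \<open>On the line v + t w each of the two forms is nonzero at the base point or at the
  direction, so it has finitely many zeros there.\<close>

lemma hform_nonzero_common:
  assumes "hform n d f" "hform n e g" "v \<in> carrier_vec (n + 1)" "w \<in> carrier_vec (n + 1)"
    "f v \<noteq> 0" "g w \<noteq> 0"
  obtains x where "x \<in> carrier_vec (n + 1)" "f x \<noteq> 0" "g x \<noteq> 0"
proof -
  have "finite {t. f (v + t \<cdot>\<^sub>v w) = 0}" "finite {t. g (v + t \<cdot>\<^sub>v w) = 0}"
    using hform_line_finite[OF assms(1,3,4)] hform_line_finite[OF assms(2,3,4)] assms(5,6) by auto
  then have "finite ({t. f (v + t \<cdot>\<^sub>v w) = 0} \<union> {t. g (v + t \<cdot>\<^sub>v w) = 0})" by simp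
  then obtain t where "t \<notin> {t. f (v + t \<cdot>\<^sub>v w) = 0} \<union> {t. g (v + t \<cdot>\<^sub>v w) = 0}"
    using ex_new_if_finite[OF infinite_UNIV_char_0] by blast
  with that[of "v + t \<cdot>\<^sub>v w"] assms(3,4) show thesis by auto
qed

text \<open>Derivatives are taken of the function along coordinate lines, so the notion applies to
  any \<open>hform\<close> without choosing a polynomial; \<open>poly_eval_has_partial_deriv\<close>
  gives the agreement with formal partial derivatives.\<close>

definition singular_at :: "nat \<Rightarrow> (complex vec \<Rightarrow> complex) \<Rightarrow> complex vec \<Rightarrow> bool" where
  "singular_at n F v \<longleftrightarrow> F v = 0 \<and>
     (\<forall>i\<le>n. ((\<lambda>t. F (v + t \<cdot>\<^sub>v unit_vec (n + 1) i)) has_field_derivative 0) (at 0))"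

text \<open>
  Along any line through the point, the discriminant vanishes to second order with leading
  coefficient \<open>-27 F(p)\<^sup>2 F'\<^sup>2\<close>, where \<open>F'\<close> is the derivative of \<open>F\<close> in the direction of the line.
\<close>

lemma singular_at_triple_root:
  assumes F: "hform n 3 F" "p \<in> carrier_vec (n + 1)" "F p \<noteq> 0"
    and b: "hform n 1 b" and c: "hform n 2 c"
    and disc: "\<And>x. x \<in> carrier_vec (n + 1) \<Longrightarrow> cubic_disc (F p) (b x) (c x) (F x) = 0"
    and v: "v \<in> carrier_vec (n + 1)" "b v = 0" "c v = 0" "F v = 0"
  shows "singular_at n F v"
  unfolding singular_at_def
proof (intro conjI allI impI)
  fix i assume "i \<le> n"
  define d :: "complex vec" where "d = unit_vec (n + 1) i"
  have d: "d \<in> carrier_vec (n + 1)" by (simp add: d_def)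
  have v0: "v + 0 \<cdot>\<^sub>v d = v" using v(1) d by (intro eq_vecI) auto
  obtain B where B: "\<And>t. poly B t = b (v + t \<cdot>\<^sub>v d)" using hform_line[OF b v(1) d] by blast
  obtain C where C: "\<And>t. poly C t = c (v + t \<cdot>\<^sub>v d)" using hform_line[OF c v(1) d] by blast
  obtain E where E: "\<And>t. poly E t = F (v + t \<cdot>\<^sub>v d)" using hform_line[OF F(1) v(1) d] by blast
  have "poly B 0 = 0" "poly C 0 = 0" "poly E 0 = 0" unfolding B C E v0 using v by auto
  then have "[:0, 1:] dvd B" "[:0, 1:] dvd C" "[:0, 1:] dvd E" by (auto simp: poly_eq_0_iff_dvd)
  then obtain B1 C1 E1 where 1: "B = [:0, 1:] * B1" "C = [:0, 1:] * C1" "E = [:0, 1:] * E1"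
    unfolding dvd_def by blast
  define A where "A = F p"
  \<comment> \<open>The discriminant along the line divided by t^2. It vanishes for t \<noteq> 0,
    hence by continuity at 0, where only the last term survives.\<close>
  define Q where "Q = (\<lambda>t. t\<^sup>2 * (poly B1 t)\<^sup>2 * (poly C1 t)\<^sup>2 - 4 * A * t * poly C1 t ^ 3
      - 4 * t\<^sup>2 * poly B1 t ^ 3 * poly E1 t + 18 * A * t * poly B1 t * poly C1 t * poly E1 t
      - 27 * A\<^sup>2 * (poly E1 t)\<^sup>2)"
  have "t\<^sup>2 * Q t = 0" for t
  proof -
    have "cubic_disc A (poly B t) (poly C t) (poly E t) = 0"
      using disc[of "v + t \<cdot>\<^sub>v d"] v(1) d by (simp add: B C E A_def)
    moreover have "cubic_disc A (poly B t) (poly C t) (poly E t) = t\<^sup>2 * Q t"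
      unfolding cubic_disc_def 1 Q_def by (simp del: mult_pCons_left) Groebner_Basis.algebra
    ultimately show ?thesis by simp
  qed
  then have Q0: "Q t = 0" if "t \<noteq> 0" for t using that by (metis mult_eq_0_iff power_eq_0_iff)
  have "isCont Q 0" unfolding Q_def by (intro continuous_intros)
  then have "(Q \<longlongrightarrow> Q 0) (at 0)" by (simp add: isCont_def)
  moreover have "(Q \<longlongrightarrow> 0) (at 0)"
    by (rule tendsto_eventually) (auto simp: eventually_at_filter Q0)
  ultimately have "Q 0 = 0" using LIM_unique by blast
  then have "poly E1 0 = 0" using F(3) by (simp add: Q_def A_def)
  moreover have "poly E = (\<lambda>t. F (v + t \<cdot>\<^sub>v unit_vec (n + 1) i))" unfolding d_def[symmetric] by (rule ext) (rule E)
  moreover have "(poly E has_field_derivative poly (pderiv E) 0) (at 0)" by (rule poly_DERIV)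
  moreover have "pderiv E = E1 + [:0, 1:] * pderiv E1" unfolding 1 by (simp add: pderiv_mult pderiv_pCons del: mult_pCons_left)
  ultimately show "((\<lambda>t. F (v + t \<cdot>\<^sub>v unit_vec (n + 1) i)) has_field_derivative 0) (at 0)"
    by simp
qed (use v in auto)

lemma cubic_vanishing_proportional:
  assumes n: "n \<ge> 2" and F: "hform n 3 F" and P: "hform n 3 P"
    and smooth: "\<And>v. v \<in> carrier_vec (n + 1) \<Longrightarrow> v \<noteq> 0\<^sub>v (n + 1) \<Longrightarrow> \<not> singular_at n F v"
    and van: "\<And>v. v \<in> carrier_vec (n + 1) \<Longrightarrow> F v = 0 \<Longrightarrow> P v = 0"
  obtains k p where "p \<in> carrier_vec (n + 1)" "F p \<noteq> 0" "\<And>v. v \<in> carrier_vec (n + 1) \<Longrightarrow> P v = k * F v"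
proof -
  have u0: "unit_vec (n + 1) i \<noteq> (0\<^sub>v (n + 1) :: complex vec)" if "i < n + 1" for i
    using that by (metis index_unit_vec(1) index_zero_vec(1) zero_neq_one)
  obtain p where p: "p \<in> carrier_vec (n + 1)" "F p \<noteq> 0"
  proof (rule ccontr)
    assume "\<not> thesis"
    with that have *: "F v = 0" if "v \<in> carrier_vec (n + 1)" for v using that by blast
    have "singular_at n F (unit_vec (n + 1) 0)"
      unfolding singular_at_def by (simp add: *)
    then show False using smooth[of "unit_vec (n + 1) 0"] u0 by simp
  qed
  then have p0: "p \<noteq> 0\<^sub>v (n + 1)" using hform_at_zero[OF F] by auto
  define A where "A = F p"
  obtain b c where b: "hform n 1 b" and c: "hform n 2 c" and
    ex: "\<And>x u. x \<in> carrier_vec (n + 1) \<Longrightarrow> F (x + u \<cdot>\<^sub>v p) = A * u ^ 3 + b x * u ^ 2 + c x * u + F x"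
    using hform_cubic_expand[OF F p(1)] unfolding A_def by blast
  \<comment> \<open>With this \<open>k\<close> the form \<open>G\<close> vanishes at
    \<open>p\<close>, so along the direction \<open>p\<close> it has degree at most 2 and cannot
    have the three roots of \<open>F\<close> without being zero.\<close>
  define k where "k = P p / A"
  define G where "G = (\<lambda>v. P v - k * F v)"
  have G: "hform n 3 G" unfolding G_def by (intro hform_diff hform_cmult F P)
  have Gp: "G p = 0" using p by (simp add: G_def k_def A_def)
  obtain g h where gh: "\<And>x u. x \<in> carrier_vec (n + 1) \<Longrightarrow> G (x + u \<cdot>\<^sub>v p) = g x * u ^ 2 + h x * u + G x"
    using hform_cubic_expand[OF G p(1)] unfolding Gp by (metis add_0 mult_zero_left)
  define disc where "disc = (\<lambda>x. cubic_disc A (b x) (c x) (F x))"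
  have "disc = (\<lambda>x. (b x ^ 2 * c x ^ 2 - 4 * A * c x ^ 3) - 4 * (b x ^ 3 * F x) + 18 * A * (b x * c x * F x) - 27 * A\<^sup>2 * F x ^ 2)"
    unfolding disc_def cubic_disc_def by (intro ext) Groebner_Basis.algebra
  moreover have "hform n (2 * 1 + 2 * 2) (\<lambda>x. b x ^ 2 * c x ^ 2)" "hform n (3 * 2) (\<lambda>x. c x ^ 3)"
      "hform n (3 * 1 + 3) (\<lambda>x. b x ^ 3 * F x)" "hform n (1 + 2 + 3) (\<lambda>x. b x * c x * F x)"
      "hform n (2 * 3) (\<lambda>x. F x ^ 2)"
    by (intro hform_mult hform_power b c F)+
  ultimately have disc: "hform n 6 disc"
    by (auto intro!: hform_add hform_diff hform_cmult)
  have *: "G x = 0" if x: "x \<in> carrier_vec (n + 1)" and dx: "disc x \<noteq> 0" for x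
  proof -
    obtain r s t where rst: "r \<noteq> s" "s \<noteq> t" "r \<noteq> t"
      "\<And>u. u \<in> {r, s, t} \<Longrightarrow> A * u ^ 3 + b x * u ^ 2 + c x * u + F x = 0"
      using cubic_disc_nonzero_distinct_roots[of A "b x" "c x" "F x"] dx p(2)
      unfolding A_def disc_def by blast
    have "g x * u ^ 2 + h x * u + G x = 0" if "u \<in> {r, s, t}" for u
    proof -
      have "F (x + u \<cdot>\<^sub>v p) = 0" using rst(4)[OF that] ex x by simp
      then have "G (x + u \<cdot>\<^sub>v p) = 0" using van p(1) x by (simp add: G_def)
      then show ?thesis using gh x by simp
    qed
    from quadratic_three_roots[OF rst(1-3) this] show ?thesis .
  qed
  have "G x = 0" if x: "x \<in> carrier_vec (n + 1)" for x
  proof (rule ccontr)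
    assume "G x \<noteq> 0"
    \<comment> \<open>Otherwise \<open>G\<close> and \<open>disc\<close> would be nonzero at a
      common point, contrary to the previous step.\<close>
    have d0: "disc y = 0" if y: "y \<in> carrier_vec (n + 1)" for y
    proof (rule ccontr)
      assume "disc y \<noteq> 0"
      obtain z where "z \<in> carrier_vec (n + 1)" "G z \<noteq> 0" "disc z \<noteq> 0"
        using hform_nonzero_common[OF G disc x y \<open>G x \<noteq> 0\<close> \<open>disc y \<noteq> 0\<close>] by blast
      with * show False by blast
    qed
    \<comment> \<open>When the discriminant is 0, a zero of this quadratic form is a line on which
      \<open>F\<close> has a triple root.\<close>
    define \<Delta> where "\<Delta> = (\<lambda>x. b x ^ 2 - 3 * A * c x)"
    have "hform n (2 * 1) (\<lambda>x. b x ^ 2)" by (intro hform_power b)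
    then have \<Delta>: "hform n 2 \<Delta>" unfolding \<Delta>_def by (auto intro!: hform_diff hform_cmult c)
    obtain j where j: "j < n + 1" "p $ j \<noteq> 0"
      using p0 p(1) by (metis carrier_vecD eq_vecI index_zero_vec)
    \<comment> \<open>The zero of \<open>\<Delta>\<close> is sought in a pencil of vectors with
      coordinate \<open>j\<close> equal to 0, whereas p $ j is nonzero; therefore no y + r p with y
      nonzero in this pencil can be 0. The bound on \<open>n\<close> provides the two coordinate
      directions needed.\<close>
    have "card ({..n} - {j}) \<ge> 2" using n j by (simp add: card_Diff_singleton)
    then obtain i1 i2 where i: "i1 \<le> n" "i2 \<le> n" "i1 \<noteq> i2" "i1 \<noteq> j" "i2 \<noteq> j"
      by (auto simp: card_le_Suc_iff numeral_2_eq_2)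
    define v w :: "complex vec" where "v = unit_vec (n + 1) i1" and "w = unit_vec (n + 1) i2"
    have vw: "v \<in> carrier_vec (n + 1)" "w \<in> carrier_vec (n + 1)" by (auto simp: v_def w_def)
    obtain y where y: "y \<in> carrier_vec (n + 1)" "\<Delta> y = 0" "y $ j = 0" "\<exists>l<n + 1. y $ l \<noteq> 0"
    proof -
      consider "\<Delta> w = 0" | t where "\<Delta> (v + t \<cdot>\<^sub>v w) = 0"
        using hform_pencil_zero[OF \<Delta> _ vw] by auto
      then show thesis
      proof cases
        case 1
        have "w $ j = 0" "w $ i2 = 1" "i2 < n + 1" using i j(1) by (auto simp: w_def)
        then have "\<exists>l<n + 1. w $ l \<noteq> 0" by (metis zero_neq_one)
        then show ?thesis using that[of w] vw 1 \<open>w $ j = 0\<close> by blast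
      next
        case (2 t)
        have "(v + t \<cdot>\<^sub>v w) $ i1 = 1" "(v + t \<cdot>\<^sub>v w) $ j = 0" using i j(1) by (auto simp: v_def w_def)
        moreover have "i1 < n + 1" using i by simp
        ultimately have "\<exists>l<n + 1. (v + t \<cdot>\<^sub>v w) $ l \<noteq> 0" by (metis zero_neq_one)
        moreover have "v + t \<cdot>\<^sub>v w \<in> carrier_vec (n + 1)" using vw by simp
        ultimately show ?thesis using 2 that[of "v + t \<cdot>\<^sub>v w"] \<open>(v + t \<cdot>\<^sub>v w) $ j = 0\<close> by blast
      qed
    qed
    define r where "r = - b y / (3 * A)"
    have tr: "F (y + u \<cdot>\<^sub>v p) = A * (u - r) ^ 3" for u
      unfolding ex[OF y(1)] r_def
      by (rule triple_root) (use y d0[OF y(1)] p(2) in \<open>auto simp: A_def \<Delta>_def disc_def\<close>)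
    \<comment> \<open>The base point is moved to the triple root, so the root becomes u = 0 and
      \<open>b\<close>, \<open>c\<close>, \<open>F\<close> all vanish at \<open>q\<close>.\<close>
    define q where "q = y + r \<cdot>\<^sub>v p"
    have q: "q \<in> carrier_vec (n + 1)" using y p by (simp add: q_def)
    have qu: "F (q + u \<cdot>\<^sub>v p) = A * u ^ 3" for u
    proof -
      have "q + u \<cdot>\<^sub>v p = y + (r + u) \<cdot>\<^sub>v p"
        using y p by (intro eq_vecI) (auto simp: q_def algebra_simps)
      then show ?thesis by (simp add: tr)
    qed
    have "A * u ^ 3 + b q * u ^ 2 + c q * u + F q = A * u ^ 3 + 0 * u ^ 2 + 0 * u + 0" for u
      using ex[OF q, of u] qu[of u] by simp
    from cubic_coeffs_eq[OF this] have z: "b q = 0" "c q = 0" "F q = 0" by auto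
    have "singular_at n F q"
      by (rule singular_at_triple_root[OF F p b c]) (use d0 z q in \<open>auto simp: disc_def A_def\<close>)
    moreover have "q \<noteq> 0\<^sub>v (n + 1)"
    proof
      assume q0: "q = 0\<^sub>v (n + 1)"
      have "q $ l = y $ l + r * p $ l" if "l < n + 1" for l
        using that y p by (simp add: q_def)
      with q0 have e: "y $ l + r * p $ l = 0" if "l < n + 1" for l using that by simp
      from e[OF j(1)] y(3) j(2) have "r = 0" by simp
      with e y(4) show False by auto
    qed
    ultimately show False using smooth q by blast
  qed
  then have "P v = k * F v" if "v \<in> carrier_vec (n + 1)" for v using that by (simp add: G_def)
  with p show thesis by (rule that)
qed

section \<open>Points, partial derivatives and the diagonal action\<close>

definition pt :: "complex vec \<Rightarrow> ppoint" where
  "pt v = {c \<cdot>\<^sub>v v | c. c \<noteq> 0}"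

lemma pt_self: "v \<in> pt v"
proof -
  have "v = 1 \<cdot>\<^sub>v v" by (intro eq_vecI) auto
  then show ?thesis unfolding pt_def by (intro CollectI exI[of _ 1]) auto
qed

lemma pt_in_proj_points:
  "v \<in> carrier_vec (n + 1) \<Longrightarrow> v \<noteq> 0\<^sub>v (n + 1) \<Longrightarrow> pt v \<in> proj_points n"
  unfolding pt_def proj_points_def by blast

lemma proj_points_cases:
  assumes "p \<in> proj_points n"
  obtains v where "v \<in> carrier_vec (n + 1)" "v \<noteq> 0\<^sub>v (n + 1)" "p = pt v"
  using assms unfolding pt_def proj_points_def by blast

lemma smult_smult_vec: "a \<cdot>\<^sub>v (b \<cdot>\<^sub>v (v :: complex vec)) = (a * b) \<cdot>\<^sub>v v"
  by (intro eq_vecI) auto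

lemma pt_smult:
  assumes "c \<noteq> 0" shows "pt (c \<cdot>\<^sub>v v) = pt v"
proof
  show "pt (c \<cdot>\<^sub>v v) \<subseteq> pt v"
  proof
    fix w assume "w \<in> pt (c \<cdot>\<^sub>v v)"
    then obtain a where "a \<noteq> 0" "w = (a * c) \<cdot>\<^sub>v v" by (auto simp: pt_def smult_smult_vec)
    then show "w \<in> pt v" using assms by (auto simp: pt_def)
  qed
  show "pt v \<subseteq> pt (c \<cdot>\<^sub>v v)"
  proof
    fix w assume "w \<in> pt v"
    then obtain a where a: "a \<noteq> 0" "w = a \<cdot>\<^sub>v v" by (auto simp: pt_def)
    then have "w = (a / c) \<cdot>\<^sub>v (c \<cdot>\<^sub>v v)" "a / c \<noteq> 0" using assms by (auto simp: smult_smult_vec)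
    then show "w \<in> pt (c \<cdot>\<^sub>v v)" unfolding pt_def by blast
  qed
qed

lemma proj_points_mem:
  assumes "p \<in> proj_points n" "v \<in> p"
  shows "v \<in> carrier_vec (n + 1)" "v \<noteq> 0\<^sub>v (n + 1)" "p = pt v"
proof -
  obtain w where w: "w \<in> carrier_vec (n + 1)" "w \<noteq> 0\<^sub>v (n + 1)" "p = pt w"
    using proj_points_cases[OF assms(1)] by blast
  then obtain c where c: "c \<noteq> 0" "v = c \<cdot>\<^sub>v w" using assms(2) by (auto simp: pt_def)
  show "v \<in> carrier_vec (n + 1)" using c w by simp
  show "p = pt v" using w c by (simp add: pt_smult)
  show "v \<noteq> 0\<^sub>v (n + 1)"
  proof
    assume "v = 0\<^sub>v (n + 1)"
    then have "w $ i = 0" if "i < n + 1" for i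
      using c w that by (metis carrier_vecD index_smult_vec(1) index_zero_vec(1) mult_eq_0_iff)
    then have "w = 0\<^sub>v (n + 1)" using w by (intro eq_vecI) auto
    with w show False by simp
  qed
qed

lemma hform_zero_pt:
  assumes "hform n d f" "v \<in> carrier_vec (n + 1)" "w \<in> pt v"
  shows "f w = 0 \<longleftrightarrow> f v = 0"
proof -
  obtain c where "c \<noteq> 0" "w = c \<cdot>\<^sub>v v" using assms(3) by (auto simp: pt_def)
  then show ?thesis using hform_scale[OF assms(1,2), of c] by simp
qed

lemma poly_eval_sum: "finite A \<Longrightarrow> poly_eval (\<Sum>i\<in>A. G i) v = (\<Sum>i\<in>A. poly_eval (G i) v)"
  by (induction A rule: finite_induct) (auto simp: poly_eval_add)

text \<open>In each monomial only the factor of index \<open>i\<close> varies; \<open>R\<close>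
  collects the others. Truncated subtraction of the exponent does no harm where the exponent is 0,
  because the derivative then carries the factor 0.\<close>

lemma poly_eval_has_partial_deriv:
  assumes "is_form n d F" "v \<in> carrier_vec (n + 1)" "i \<le> n"
  shows "((\<lambda>t. poly_eval F (v + t \<cdot>\<^sub>v unit_vec (n + 1) i)) has_field_derivative
      poly_eval (partial_deriv i F) v) (at 0)"
proof -
  have *: "((\<lambda>t. mono_eval m (v + t \<cdot>\<^sub>v unit_vec (n + 1) i)) has_field_derivative
      of_nat (Poly_Mapping.lookup m i) * mono_eval (m - Poly_Mapping.single i 1) v) (at 0)"
    if "m \<in> Poly_Mapping.keys F" for m
  proof -
    define R where "R = (\<Prod>j\<in>{..n} - {i}. (v $ j) ^ Poly_Mapping.lookup m j)"
    have k: "Poly_Mapping.keys m \<subseteq> {..n}" using assms(1) that by (auto simp: is_form_def)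
    have k': "Poly_Mapping.keys (m - Poly_Mapping.single i 1) \<subseteq> {..n}"
    proof
      fix j assume "j \<in> Poly_Mapping.keys (m - Poly_Mapping.single i 1)"
      then have "Poly_Mapping.lookup m j \<noteq> 0" by (auto simp: in_keys_iff lookup_minus)
      then have "j \<in> Poly_Mapping.keys m" by (simp add: in_keys_iff)
      then show "j \<in> {..n}" using k by blast
    qed
    have "mono_eval m (v + t \<cdot>\<^sub>v unit_vec (n + 1) i) = (v $ i + t) ^ Poly_Mapping.lookup m i * R" for t
      unfolding mono_eval_atMost[OF k] R_def
      by (subst prod.remove[of _ i])
         (use assms in \<open>auto intro!: arg_cong2[of _ _ _ _ "(*)"] prod.cong\<close>)
    moreover have "mono_eval (m - Poly_Mapping.single i 1) v = (v $ i) ^ (Poly_Mapping.lookup m i - 1) * R"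
      unfolding mono_eval_atMost[OF k'] R_def
      by (subst prod.remove[of _ i])
         (use assms in \<open>auto simp: lookup_minus lookup_single intro!: prod.cong\<close>)
    moreover have "((\<lambda>t. (v $ i + t) ^ Poly_Mapping.lookup m i * R) has_field_derivative
        of_nat (Poly_Mapping.lookup m i) * ((v $ i) ^ (Poly_Mapping.lookup m i - 1) * R)) (at 0)"
      by (auto intro!: derivative_eq_intros)
    ultimately show ?thesis by simp
  qed
  have "((\<lambda>t. \<Sum>m\<in>Poly_Mapping.keys F. Poly_Mapping.lookup F m * mono_eval m (v + t \<cdot>\<^sub>v unit_vec (n + 1) i))
      has_field_derivative (\<Sum>m\<in>Poly_Mapping.keys F. Poly_Mapping.lookup F m *
        (of_nat (Poly_Mapping.lookup m i) * mono_eval (m - Poly_Mapping.single i 1) v))) (at 0)"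
    by (intro DERIV_sum DERIV_cmult *)
  moreover have "(\<Sum>m\<in>Poly_Mapping.keys F. Poly_Mapping.lookup F m *
        (of_nat (Poly_Mapping.lookup m i) * mono_eval (m - Poly_Mapping.single i 1) v)) = poly_eval (partial_deriv i F) v"
    by (simp add: partial_deriv_def poly_eval_sum poly_eval_single mult_ac)
  ultimately show ?thesis by (simp add: poly_eval_def)
qed

lemma smooth_hypersurface_hform:
  assumes "smooth_hypersurface n d X"
  obtains F where "hform n d F" "X = {p \<in> proj_points n. \<forall>v\<in>p. F v = 0}"
    "\<And>v. v \<in> carrier_vec (n + 1) \<Longrightarrow> v \<noteq> 0\<^sub>v (n + 1) \<Longrightarrow> \<not> singular_at n F v"
proof -
  obtain F where F: "is_form n d F" "X = zero_locus n {F}"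
    "\<forall>p\<in>X. \<forall>v\<in>p. \<exists>i\<le>n. poly_eval (partial_deriv i F) v \<noteq> 0"
    using assms by (auto simp: smooth_hypersurface_def)
  have "\<not> singular_at n (poly_eval F) v" if v: "v \<in> carrier_vec (n + 1)" "v \<noteq> 0\<^sub>v (n + 1)" for v
  proof
    assume s: "singular_at n (poly_eval F) v"
    then have "poly_eval F w = 0" if "w \<in> pt v" for w
      using hform_zero_pt[OF hform_poly_eval[OF F(1)] v(1) that] by (simp add: singular_at_def)
    then have "pt v \<in> X" using F(2) pt_in_proj_points[OF v] by (auto simp: zero_locus_def)
    then obtain i where i: "i \<le> n" "poly_eval (partial_deriv i F) v \<noteq> 0" using F(3) pt_self by blast
    with s have "((\<lambda>t. poly_eval F (v + t \<cdot>\<^sub>v unit_vec (n + 1) i)) has_field_derivative 0) (at 0)"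
      by (simp add: singular_at_def)
    then show False
      using DERIV_unique[OF poly_eval_has_partial_deriv[OF F(1) v(1) i(1)]] i(2) by blast
  qed
  with that[OF hform_poly_eval[OF F(1)]] F(2) show thesis by (auto simp: zero_locus_def)
qed

section \<open>The action of the generator on vectors; semi-invariant cubics\<close>

definition weight :: "nat \<Rightarrow> nat" where
  "weight i = [0, 1, 2, 2, 0] ! i"

lemma weight_simps [simp]:
  "weight 0 = 0" "weight 1 = 1" "weight (Suc 0) = 1" "weight 2 = 2" "weight 3 = 2" "weight 4 = 0"
  by (auto simp: weight_def)

text \<open>The k-th power of the diagonal generator, acting on vectors. Natural exponents represent
  the whole group because the cube is the identity.\<close>

definition dg :: "complex \<Rightarrow> nat \<Rightarrow> complex vec \<Rightarrow> complex vec" where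
  "dg \<xi> k v = vec 5 (\<lambda>i. \<xi> ^ (k * weight i) * v $ i)"

lemma dg_carrier [simp]: "dg \<xi> k v \<in> carrier_vec 5"
  by (simp add: dg_def)

lemma dg_index [simp]: "i < 5 \<Longrightarrow> dg \<xi> k v $ i = \<xi> ^ (k * weight i) * v $ i"
  by (simp add: dg_def)

lemma dg_add: "dg \<xi> (k + l) v = dg \<xi> k (dg \<xi> l v)"
  by (intro eq_vecI) (auto simp: dg_def power_add algebra_simps)

lemma dg_3: 
  assumes "\<xi> ^ 3 = 1" "v \<in> carrier_vec 5" shows "dg \<xi> 3 v = v"
proof -
  have "\<xi> ^ (3 * j) = 1" for j using assms(1) by (simp add: power_mult)
  then show ?thesis using assms(2) by (intro eq_vecI) (auto simp: dg_def)
qed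

lemma dg_0: "v \<in> carrier_vec 5 \<Longrightarrow> dg \<xi> 0 v = v"
  by (intro eq_vecI) (auto simp: dg_def)

lemma hform_dg:
  assumes "hform 4 d F" shows "hform 4 d (\<lambda>v. F (dg \<xi> k v))"
proof -
  have "hform 4 d (\<lambda>v. F (vec (4 + 1) (\<lambda>i. \<xi> ^ (k * weight i) * v $ i)))"
    by (rule hform_subst[OF assms]) (intro hform_cmult hform_coord)
  then show ?thesis by (simp add: dg_def)
qed

text \<open>Only the linear coefficient is recorded: for a form along a coordinate line it is the
  partial derivative.\<close>

lemma cubic_poly_zero:
  fixes a b c d :: complex
  assumes "\<And>u. a * u ^ 3 + b * u ^ 2 + c * u + d = 0"
  shows "c = 0"
proof -
  have 0: "d = 0" using assms[of 0] by simp
  have 1: "a + b + c = 0" using assms[of 1] 0 by simp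
  have 2: "- a + b - c = 0" using assms[of "-1"] 0 by simp
  have 3: "8 * a + 4 * b + 2 * c = 0" using assms[of 2] 0 by (simp add: mult.commute)
  have "6 * c = 0" using 1 2 3 by Groebner_Basis.algebra
  then show ?thesis by simp
qed

lemma primitive_root_3:
  assumes "primitive_root_of_unity 3 \<xi>"
  shows "\<xi> ^ 3 = 1" "\<xi> \<noteq> 1" "\<xi>\<^sup>2 \<noteq> 1" "\<xi> \<noteq> 0" "1 + \<xi> + \<xi>\<^sup>2 = 0" "\<xi>\<^sup>2 \<noteq> \<xi>"
proof -
  show a: "\<xi> ^ 3 = 1" using assms by (simp add: primitive_root_of_unity_def)
  have "\<xi> ^ 1 \<noteq> 1" using assms unfolding primitive_root_of_unity_def by (metis One_nat_def lessI numeral_3_eq_3 zero_less_one less_Suc_eq)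
  then show b: "\<xi> \<noteq> 1" by simp
  show "\<xi>\<^sup>2 \<noteq> 1" using assms unfolding primitive_root_of_unity_def by (metis numeral_less_iff semiring_norm(79) zero_less_numeral numeral_2_eq_2 numeral_3_eq_3 lessI)
  show c: "\<xi> \<noteq> 0" using a by auto
  have "(\<xi> - 1) * (1 + \<xi> + \<xi>\<^sup>2) = 0" using a by Groebner_Basis.algebra
  then show "1 + \<xi> + \<xi>\<^sup>2 = 0" using b by simp
  have "\<xi> * (\<xi> - 1) \<noteq> 0" using b c by simp
  then show "\<xi>\<^sup>2 \<noteq> \<xi>" by (auto simp: power2_eq_square algebra_simps)
qed

lemma cube_root_of_unity_cases:
  assumes "primitive_root_of_unity 3 \<xi>" "k ^ 3 = 1"
  shows "k = 1 \<or> k = \<xi> \<or> k = \<xi>\<^sup>2"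
proof -
  note r = primitive_root_3[OF assms(1)]
  have "(k - 1) * (k - \<xi>) * (k - \<xi>\<^sup>2) = 0"
    using r(1,5) assms(2) by Groebner_Basis.algebra
  then show ?thesis by simp
qed

lemma nat_le_4_cases: "i \<le> 4 \<Longrightarrow> i = 0 \<or> i = 1 \<or> i = 2 \<or> i = 3 \<or> i = (4::nat)"
  by auto

text \<open>
  If \<open>k\<close> were nontrivial, \<open>F\<close> would vanish on a line of fixed points on which all partial
  derivatives but the one in direction \<open>1\<close> vanish as well; that one has a zero on the line.
\<close>

lemma smooth_semi_invariant:
  assumes \<xi>: "primitive_root_of_unity 3 \<xi>" and F: "hform 4 3 F"
    and smooth: "\<And>v. v \<in> carrier_vec 5 \<Longrightarrow> v \<noteq> 0\<^sub>v 5 \<Longrightarrow> \<not> singular_at 4 F v"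
    and semi: "\<And>v. v \<in> carrier_vec 5 \<Longrightarrow> F (dg \<xi> 1 v) = k * F v"
    and nz: "p \<in> carrier_vec 5" "F p \<noteq> 0"
  shows "k = 1"
proof (rule ccontr)
  assume "k \<noteq> 1"
  note r = primitive_root_3[OF \<xi>]
  have r': "\<xi> ^ 4 = \<xi>" "\<xi> ^ 6 = 1" using r(1) by Groebner_Basis.algebra+
  have "dg \<xi> 1 (dg \<xi> 1 (dg \<xi> 1 p)) = dg \<xi> 3 p"
    by (simp flip: dg_add add: numeral_3_eq_3)
  then have "F p = k * (k * (k * F p))" using semi[of p] semi[of "dg \<xi> 1 p"] semi[of "dg \<xi> 1 (dg \<xi> 1 p)"]
    dg_3[OF r(1) nz(1)] nz(1) by simp
  then have "k ^ 3 = 1" using nz by (simp add: power3_eq_cube mult.assoc)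
  then have k: "k = \<xi> \<or> k = \<xi>\<^sup>2" using cube_root_of_unity_cases[OF \<xi>] \<open>k \<noteq> 1\<close> by blast
  \<comment> \<open>The coefficient \<open>c i x\<close> of u is the partial derivative of
    \<open>F\<close> at \<open>x\<close> in direction \<open>i\<close>, available as a quadratic
    form in \<open>x\<close>.\<close>
  have "\<forall>i. \<exists>b c. hform 4 1 b \<and> hform 4 2 c \<and>
    (\<forall>x u. x \<in> carrier_vec 5 \<longrightarrow> F (x + u \<cdot>\<^sub>v unit_vec 5 i) = F (unit_vec 5 i) * u ^ 3 + b x * u ^ 2 + c x * u + F x)"
  proof
    fix i
    have "unit_vec 5 i \<in> carrier_vec (4 + 1)" by simp
    from hform_cubic_expand[OF F this] obtain b c where "hform 4 1 b" "hform 4 2 c"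
      "\<And>x u. x \<in> carrier_vec (4 + 1) \<Longrightarrow> F (x + u \<cdot>\<^sub>v unit_vec 5 i) = F (unit_vec 5 i) * u ^ 3 + b x * u ^ 2 + c x * u + F x"
      by blast
    then show "\<exists>b c. hform 4 1 b \<and> hform 4 2 c \<and>
    (\<forall>x u. x \<in> carrier_vec 5 \<longrightarrow> F (x + u \<cdot>\<^sub>v unit_vec 5 i) = F (unit_vec 5 i) * u ^ 3 + b x * u ^ 2 + c x * u + F x)"
      by (intro exI[of _ b] exI[of _ c]) simp
  qed
  then obtain b c where c: "\<And>i. hform 4 2 (c i)" and
    ex: "\<And>i x u. x \<in> carrier_vec 5 \<Longrightarrow> F (x + u \<cdot>\<^sub>v unit_vec 5 i) = F (unit_vec 5 i) * u ^ 3 + b i x * u ^ 2 + c i x * u + F x"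
    by metis
  have sing: "singular_at 4 F x" if x: "x \<in> carrier_vec 5" "F x = 0" "\<And>i. i \<le> 4 \<Longrightarrow> c i x = 0" for x
    unfolding singular_at_def
  proof (intro conjI allI impI)
    fix i :: nat assume "i \<le> 4"
    have "((\<lambda>t. F (unit_vec 5 i) * t ^ 3 + b i x * t ^ 2 + c i x * t + F x) has_field_derivative 0) (at 0)"
      using x(3)[OF \<open>i \<le> 4\<close>] by (auto intro!: derivative_eq_intros)
    then show "((\<lambda>t. F (x + t \<cdot>\<^sub>v unit_vec (4 + 1) i)) has_field_derivative 0) (at 0)"
      using ex[OF x(1)] by simp
  qed (use x in auto)
  \<comment> \<open>Semi-invariance differentiated: the linear terms in u of F(g(x + u e_i)) = k F(x
    + u e_i) are compared.\<close>
  have ceq: "c i (dg \<xi> 1 x) * \<xi> ^ weight i = k * c i x" if x: "x \<in> carrier_vec 5" and i: "i \<le> 4" for i x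
  proof -
    define w where "w = \<xi> ^ weight i"
    have "dg \<xi> 1 (x + u \<cdot>\<^sub>v unit_vec 5 i) = dg \<xi> 1 x + (u * w) \<cdot>\<^sub>v unit_vec 5 i" for u
      using x i by (intro eq_vecI) (auto simp: dg_def w_def algebra_simps)
    then have e: "F (unit_vec 5 i) * (u * w) ^ 3 + b i (dg \<xi> 1 x) * (u * w) ^ 2 + c i (dg \<xi> 1 x) * (u * w) + F (dg \<xi> 1 x) =
       k * (F (unit_vec 5 i) * u ^ 3 + b i x * u ^ 2 + c i x * u + F x)" for u
      using semi[of "x + u \<cdot>\<^sub>v unit_vec 5 i"] ex[of "dg \<xi> 1 x" "u * w" i] ex[OF x, of u i] x by simp
    have "(F (unit_vec 5 i) * (w ^ 3 - k)) * u ^ 3 + (b i (dg \<xi> 1 x) * w ^ 2 - k * b i x) * u ^ 2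
       + (c i (dg \<xi> 1 x) * w - k * c i x) * u + (F (dg \<xi> 1 x) - k * F x) = 0" for u
      using e[of u] by Groebner_Basis.algebra
    from cubic_poly_zero[OF this] show ?thesis by (simp add: w_def)
  qed
  have pencil: "\<exists>x. x \<in> carrier_vec 5 \<and> x \<noteq> 0\<^sub>v 5 \<and> c 1 x = 0 \<and> (\<forall>l<5. l \<noteq> i \<and> l \<noteq> j \<longrightarrow> x $ l = 0)"
    if ij: "i < 5" "j < 5" "i \<noteq> j" for i j
  proof -
    define v w :: "complex vec" where "v = unit_vec 5 i" and "w = unit_vec 5 j"
    have vw: "v \<in> carrier_vec (4 + 1)" "w \<in> carrier_vec (4 + 1)" by (auto simp: v_def w_def)
    consider "c 1 w = 0" | t where "c 1 (v + t \<cdot>\<^sub>v w) = 0"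
      using hform_pencil_zero[OF c[of 1] _ vw] by auto
    then show ?thesis
    proof cases
      case 1
      have "w $ j \<noteq> 0\<^sub>v 5 $ j" using ij by (simp add: w_def)
      then have "w \<noteq> 0\<^sub>v 5" by auto
      then show ?thesis using 1 vw ij by (intro exI[of _ w]) (auto simp: w_def)
    next
      case (2 t)
      have "(v + t \<cdot>\<^sub>v w) $ i \<noteq> 0\<^sub>v 5 $ i" using ij by (simp add: v_def w_def)
      then have "v + t \<cdot>\<^sub>v w \<noteq> 0\<^sub>v 5" by auto
      then show ?thesis using 2 vw ij by (intro exI[of _ "v + t \<cdot>\<^sub>v w"]) (auto simp: v_def w_def)
    qed
  qed
  from k show False
  proof
    \<comment> \<open>On the line of weight 0 the generator fixes x. Hence F x = \<xi> F x, and
      \<open>ceq\<close> kills every partial derivative except the one of weight 1, which vanishes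
      by the choice of x.\<close>
    assume k1: "k = \<xi>"
    obtain x where x: "x \<in> carrier_vec 5" "x \<noteq> 0\<^sub>v 5" "c 1 x = 0" "\<forall>l<5. l \<noteq> 0 \<and> l \<noteq> 4 \<longrightarrow> x $ l = 0"
      using pencil[of 0 4] by auto
    have dx: "dg \<xi> 1 x = x"
    proof (intro eq_vecI)
      fix l assume "l < dim_vec x"
      then have "l \<le> 4" using x(1) by simp
      then show "dg \<xi> 1 x $ l = x $ l" using nat_le_4_cases[of l] x(4) by auto
    qed (use x in \<open>auto simp: dg_def\<close>)
    have "F x = 0" using semi[OF x(1)] r(2) unfolding dx k1 by simp
    moreover have "c i x = 0" if "i \<le> 4" for i
      using ceq[OF x(1) that] nat_le_4_cases[OF that] x(3) r unfolding dx k1 by auto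
    ultimately show False using sing smooth x by blast
  next
    \<comment> \<open>On the line of weight 2 the generator scales x by \<xi>^2, hence leaves F x
      unchanged and multiplies quadratic forms by \<xi>^4 = \<xi>. Again only the direction of
      weight 1 escapes \<open>ceq\<close>.\<close>
    assume k2: "k = \<xi>\<^sup>2"
    obtain x where x: "x \<in> carrier_vec 5" "x \<noteq> 0\<^sub>v 5" "c 1 x = 0" "\<forall>l<5. l \<noteq> 2 \<and> l \<noteq> 3 \<longrightarrow> x $ l = 0"
      using pencil[of 2 3] by auto
    have dx: "dg \<xi> 1 x = \<xi>\<^sup>2 \<cdot>\<^sub>v x"
    proof (intro eq_vecI)
      fix l assume "l < dim_vec (\<xi>\<^sup>2 \<cdot>\<^sub>v x)"
      then have "l \<le> 4" using x(1) by simp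
      then show "dg \<xi> 1 x $ l = (\<xi>\<^sup>2 \<cdot>\<^sub>v x) $ l" using nat_le_4_cases[of l] x(1,4) by auto
    qed (use x in \<open>auto simp: dg_def\<close>)
    have "F (dg \<xi> 1 x) = F x" unfolding dx using hform_scale[OF F, of x "\<xi>\<^sup>2"] x(1) r' by (simp flip: power_mult)
    then have "F x = 0" using semi[OF x(1)] r(3) by (simp add: k2)
    moreover have "c i x = 0" if "i \<le> 4" for i
    proof -
      have "c i (dg \<xi> 1 x) = \<xi> * c i x"
        unfolding dx using hform_scale[OF c[of i], of x "\<xi>\<^sup>2"] x(1) r' by (simp flip: power_mult)
      then have "\<xi> * \<xi> ^ weight i * c i x = \<xi>\<^sup>2 * c i x" using ceq[OF x(1) that] by (simp add: k2 mult_ac)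
      then have "(\<xi> * \<xi> ^ weight i - \<xi>\<^sup>2) * c i x = 0" by (simp add: left_diff_distrib)
      moreover have "\<xi> * \<xi>\<^sup>2 = 1" using r(1) by (simp add: power2_eq_square power3_eq_cube mult.assoc)
      then have "\<xi> * \<xi> ^ weight i \<noteq> \<xi>\<^sup>2" if "i \<noteq> 1"
        using nat_le_4_cases[OF \<open>i \<le> 4\<close>] that r(3,6) by auto
      ultimately show ?thesis using x(3) by (cases "i = 1") auto
    qed
    ultimately show False using sing smooth x by blast
  qed
qed

section \<open>Normal form of smooth invariant cubics\<close>

definition vec5 :: "complex \<Rightarrow> complex \<Rightarrow> complex \<Rightarrow> complex \<Rightarrow> complex \<Rightarrow> complex vec" where
  "vec5 x0 x1 x2 x3 x4 = vec 5 (\<lambda>i. [x0, x1, x2, x3, x4] ! i)"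

lemma vec5_simps [simp]:
  "vec5 x0 x1 x2 x3 x4 \<in> carrier_vec 5" "vec5 x0 x1 x2 x3 x4 $ 0 = x0" "vec5 x0 x1 x2 x3 x4 $ 1 = x1"
  "vec5 x0 x1 x2 x3 x4 $ Suc 0 = x1" "vec5 x0 x1 x2 x3 x4 $ 2 = x2" "vec5 x0 x1 x2 x3 x4 $ 3 = x3"
  "vec5 x0 x1 x2 x3 x4 $ 4 = x4"
  by (auto simp: vec5_def)

definition binary_cubic :: "(nat \<Rightarrow> complex) \<Rightarrow> complex \<Rightarrow> complex \<Rightarrow> complex" where
  "binary_cubic C a b = C 0 * a ^ 3 + C 1 * a ^ 2 * b + C 2 * a * b ^ 2 + C 3 * b ^ 3"

text \<open>The general cubic in monomials of weight divisible by 3: a and b stand for the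
  coordinates 0 and 4, u for 1, s and t for 2 and 3. The 13 coefficients are numbered in the order
  of the list in \<open>invariant_exponents\<close>.\<close>

definition invariant_cubic :: "(nat \<Rightarrow> complex) \<Rightarrow> complex \<Rightarrow> complex \<Rightarrow> complex \<Rightarrow> complex \<Rightarrow> complex \<Rightarrow> complex" where
  "invariant_cubic C a b u s t = binary_cubic C a b + C 4 * u ^ 3
     + u * (C 5 * a * s + C 6 * b * s + C 7 * a * t + C 8 * b * t) + binary_cubic (\<lambda>i. C (i + 9)) s t"

text \<open>The weight is at most 6, hence 0, 3 or 6, and b + c + d \<le> 3 leaves four cases. The
  position of an entry in the list serves later as the index of its coefficient in
  \<open>invariant_cubic\<close>.\<close>

lemma invariant_exponents:
  assumes "a + b + c + d + e = (3::nat)" "3 dvd b + 2 * c + 2 * d"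
  shows "(a, b, c, d, e) \<in> set [(3,0,0,0,0), (2,0,0,0,1), (1,0,0,0,2), (0,0,0,0,3), (0,3,0,0,0),
    (1,1,1,0,0), (0,1,1,0,1), (1,1,0,1,0), (0,1,0,1,1), (0,0,3,0,0), (0,0,2,1,0), (0,0,1,2,0), (0,0,0,3,0)]"
proof -
  define n where "n = b + 2 * (c + d)"
  have "n \<le> 6" using assms(1) by (simp add: n_def)
  moreover have "3 dvd n" using assms(2) by (simp add: n_def add.assoc)
  then obtain k where "n = 3 * k" ..
  ultimately have "k = 0 \<or> k = 1 \<or> k = 2" by auto
  moreover have "b + (c + d) \<le> 3" using assms(1) by simp
  ultimately have "b = 0 \<and> c + d = 0 \<or> b = 3 \<and> c + d = 0 \<or> b = 1 \<and> c + d = 1 \<or> b = 0 \<and> c + d = 3"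
    using \<open>n = 3 * k\<close> unfolding n_def by presburger
  then consider "b = 0" "c = 0" "d = 0" | "b = 3" "c = 0" "d = 0" | "b = 1" "c + d = 1" | "b = 0" "c + d = 3"
    by auto
  then show ?thesis
  proof cases
    case 1
    then consider "e = 0" "a = 3" | "e = 1" "a = 2" | "e = 2" "a = 1" | "e = 3" "a = 0" using assms(1) by linarith
    then show ?thesis using 1 by cases simp_all
  next
    case 2 then show ?thesis using assms(1) by simp
  next
    case 3
    then have "a + e = 1" using assms(1) by simp
    then consider "d = 0" "c = 1" "e = 0" "a = 1" | "d = 0" "c = 1" "e = 1" "a = 0"
      | "d = 1" "c = 0" "e = 0" "a = 1" | "d = 1" "c = 0" "e = 1" "a = 0" using 3(2) by linarith
    then show ?thesis using 3 by cases simp_all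
  next
    case 4
    then consider "d = 0" "c = 3" | "d = 1" "c = 2" | "d = 2" "c = 1" | "d = 3" "c = 0" by linarith
    moreover have "e = 0" "a = 0" using assms(1) 4 by auto
    ultimately show ?thesis using 4 by cases simp_all
  qed
qed

lemma invariant_cubic_add:
  "invariant_cubic C a b u s t + invariant_cubic D a b u s t = invariant_cubic (\<lambda>i. C i + D i) a b u s t"
  by (simp add: invariant_cubic_def binary_cubic_def algebra_simps)

lemma invariant_cubic_mult:
  "k * invariant_cubic C a b u s t = invariant_cubic (\<lambda>i. k * C i) a b u s t"
  by (simp add: invariant_cubic_def binary_cubic_def algebra_simps)

lemma prod_atMost_4: "(\<Prod>i\<le>4::nat. f i) = f 0 * f 1 * f 2 * f 3 * (f 4 :: complex)"
proof -
  have "{..4::nat} = {0, 1, 2, 3, 4}" by auto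
  then show ?thesis by (simp add: mult.assoc)
qed

lemma sum_atMost_4: "(\<Sum>i\<le>4::nat. f i) = f 0 + f 1 + f 2 + f 3 + (f 4 :: nat)"
proof -
  have "{..4::nat} = {0, 1, 2, 3, 4}" by auto
  then show ?thesis by (simp add: add.assoc)
qed

lemma dg_monomial:
  "(\<Prod>i\<le>4. (dg \<xi> k v $ i) ^ e i) = (\<xi> ^ (e 1 + 2 * e 2 + 2 * e 3)) ^ k * (\<Prod>i\<le>4. (v $ i) ^ e i)"
proof -
  have "(dg \<xi> k v $ i) ^ e i = \<xi> ^ (k * (weight i * e i)) * (v $ i) ^ e i" if "i \<le> 4" for i
    using that by (simp add: power_mult_distrib mult.assoc flip: power_mult)
  then have "(\<Prod>i\<le>4. (dg \<xi> k v $ i) ^ e i) = (\<Prod>i\<le>4. \<xi> ^ (k * (weight i * e i))) * (\<Prod>i\<le>4. (v $ i) ^ e i)"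
    by (simp flip: prod.distrib)
  also have "(\<Prod>i\<le>4. \<xi> ^ (k * (weight i * e i))) = \<xi> ^ (k * (\<Sum>i\<le>4. weight i * e i))"
    unfolding power_sum[symmetric] sum_distrib_left[symmetric] ..
  also have "(\<Sum>i\<le>4. weight i * e i) = e 1 + 2 * e 2 + 2 * e 3" unfolding sum_atMost_4 by simp
  finally show ?thesis by (simp only: mult.commute[of k] power_mult)
qed

text \<open>Orthogonality of characters: for \<zeta> = \<xi>^W different from 1 the sum is
  (\<zeta>^3 - 1)/(\<zeta> - 1) = 0.\<close>

lemma root_of_unity_power_sum:
  assumes "primitive_root_of_unity 3 \<xi>"
  shows "1 + \<xi> ^ W + (\<xi> ^ W)\<^sup>2 = (if 3 dvd W then 3 else 0)"
proof (cases "3 dvd W")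
  case True
  then show ?thesis using primitive_root_3(1)[OF assms] by (auto simp: power_mult elim!: dvdE)
next
  case False
  note r = primitive_root_3[OF assms]
  have "(\<xi> ^ W) ^ 3 = (\<xi> ^ 3) ^ W" by (simp only: power_mult[symmetric] mult.commute)
  then have 1: "(\<xi> ^ W) ^ 3 = 1" using r(1) by simp
  have "\<xi> ^ W = \<xi> ^ (3 * (W div 3) + W mod 3)" by simp
  also have "\<dots> = (\<xi> ^ 3) ^ (W div 3) * \<xi> ^ (W mod 3)" by (simp only: power_add power_mult)
  finally have "\<xi> ^ W = \<xi> ^ (W mod 3)" by (simp add: r(1))
  moreover have "W mod 3 = 1 \<or> W mod 3 = 2" using False by presburger
  ultimately have 2: "\<xi> ^ W \<noteq> 1" using r(2,3) by auto
  have "(\<xi> ^ W - 1) * (1 + \<xi> ^ W + (\<xi> ^ W)\<^sup>2) = (\<xi> ^ W) ^ 3 - 1"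
    by (simp add: algebra_simps power2_eq_square power3_eq_cube)
  then show ?thesis using 1 2 False by simp
qed

text \<open>Summation over the group triples \<open>F\<close>, while it multiplies a monomial by 3
  or by 0 according to its weight. So only the monomials of \<open>invariant_exponents\<close>
  survive.\<close>

lemma invariant_cubic_form:
  assumes \<xi>: "primitive_root_of_unity 3 \<xi>" and F: "hform 4 3 F"
    and inv: "\<And>v. v \<in> carrier_vec 5 \<Longrightarrow> F (dg \<xi> 1 v) = F v"
  obtains C where "\<And>v. v \<in> carrier_vec 5 \<Longrightarrow> F v = invariant_cubic C (v $ 0) (v $ 4) (v $ 1) (v $ 2) (v $ 3)"
proof -
  note r = primitive_root_3[OF \<xi>]
  let ?I = "\<lambda>C v. invariant_cubic C (v $ 0) (v $ 4) (v $ 1) (v $ 2) (v $ 3)"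
  have "\<exists>C. \<forall>v\<in>carrier_vec 5. F v + F (dg \<xi> 1 v) + F (dg \<xi> 2 v) = ?I C v"
    using F
  proof (induction rule: hform_induct)
    case zero
    show ?case by (rule exI[of _ "\<lambda>_. 0"]) (simp add: invariant_cubic_def binary_cubic_def)
  next
    case (add f g)
    obtain C where C: "\<forall>v\<in>carrier_vec 5. f v + f (dg \<xi> 1 v) + f (dg \<xi> 2 v) = ?I C v" using add by blast
    obtain D where D: "\<forall>v\<in>carrier_vec 5. g v + g (dg \<xi> 1 v) + g (dg \<xi> 2 v) = ?I D v" using add by blast
    show ?case
    proof (intro exI[of _ "\<lambda>i. C i + D i"] ballI)
      fix v :: "complex vec" assume v: "v \<in> carrier_vec 5"
      have "f v + g v + (f (dg \<xi> 1 v) + g (dg \<xi> 1 v)) + (f (dg \<xi> 2 v) + g (dg \<xi> 2 v)) = ?I C v + ?I D v"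
        using bspec[OF C v, symmetric] bspec[OF D v, symmetric] by simp
      then show "f v + g v + (f (dg \<xi> 1 v) + g (dg \<xi> 1 v)) + (f (dg \<xi> 2 v) + g (dg \<xi> 2 v)) = ?I (\<lambda>i. C i + D i) v"
        by (simp add: invariant_cubic_add)
    qed
  next
    case (mono e c)
    define W where "W = e 1 + 2 * e 2 + 2 * e 3"
    have pr: "(\<Prod>i\<le>4. f i ^ e i) = f 0 ^ e 0 * f 1 ^ e 1 * f 2 ^ e 2 * f 3 ^ e 3 * f 4 ^ e 4" for f :: "nat \<Rightarrow> complex"
      by (rule prod_atMost_4)
    have se: "e 0 + e 1 + e 2 + e 3 + e 4 = 3" using mono unfolding sum_atMost_4 .
    have sum: "c * (\<Prod>i\<le>4. (v $ i) ^ e i) + c * (\<Prod>i\<le>4. (dg \<xi> 1 v $ i) ^ e i) + c * (\<Prod>i\<le>4. (dg \<xi> 2 v $ i) ^ e i)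
      = (1 + \<xi> ^ W + (\<xi> ^ W)\<^sup>2) * c * (\<Prod>i\<le>4. (v $ i) ^ e i)" for v
      unfolding dg_monomial W_def by (simp add: algebra_simps)
    show ?case
    proof (cases "3 dvd W")
      case True
      have w: "1 + \<xi> ^ W + (\<xi> ^ W)\<^sup>2 = 3" using True root_of_unity_power_sum[OF \<xi>] by simp
      define L :: "(nat \<times> nat \<times> nat \<times> nat \<times> nat) list" where "L = [(3,0,0,0,0), (2,0,0,0,1), (1,0,0,0,2), (0,0,0,0,3), (0,3,0,0,0),
    (1,1,1,0,0), (0,1,1,0,1), (1,1,0,1,0), (0,1,0,1,1), (0,0,3,0,0), (0,0,2,1,0), (0,0,1,2,0), (0,0,0,3,0)]"
      have "(e 0, e 1, e 2, e 3, e 4) \<in> set L"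
        unfolding L_def by (rule invariant_exponents) (use se True in \<open>auto simp: W_def\<close>)
      then obtain j where j: "j < length L" "(e 0, e 1, e 2, e 3, e 4) = L ! j"
        unfolding in_set_conv_nth by metis
      have "length L = 13" by (simp add: L_def)
      then have "j \<in> {0, 1, 2, 3, 4, 5, 6, 7, 8, 9, 10, 11, 12}" using j(1) by (auto simp: eval_nat_numeral less_Suc_eq)
      then have m: "3 * c * (v $ 0 ^ e 0 * v $ 1 ^ e 1 * v $ 2 ^ e 2 * v $ 3 ^ e 3 * v $ 4 ^ e 4)
          = ?I (\<lambda>i. if i = j then 3 * c else 0) v" for v
        using j(2) unfolding L_def
        by (elim insertE emptyE) (simp_all add: invariant_cubic_def binary_cubic_def)
      show ?thesis unfolding sum w
        by (rule exI[of _ "\<lambda>i. if i = j then 3 * c else 0"], intro ballI, subst pr, rule m)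
    next
      case False
      then have "1 + \<xi> ^ W + (\<xi> ^ W)\<^sup>2 = 0" using root_of_unity_power_sum[OF \<xi>] by simp
      then show ?thesis unfolding sum
        by (intro exI[of _ "\<lambda>_. 0"]) (simp add: invariant_cubic_def binary_cubic_def)
    qed
  qed
  then obtain C where C: "\<forall>v\<in>carrier_vec 5. F v + F (dg \<xi> 1 v) + F (dg \<xi> 2 v) = ?I C v" by blast
  have "F v = ?I (\<lambda>i. 1 / 3 * C i) v" if v: "v \<in> carrier_vec 5" for v
  proof -
    have "dg \<xi> 2 v = dg \<xi> 1 (dg \<xi> 1 v)" by (simp flip: dg_add add: numeral_2_eq_2)
    then have "F (dg \<xi> 2 v) = F v" using inv[of v] inv[of "dg \<xi> 1 v"] v by simp
    then have "3 * F v = ?I C v" using C v inv[OF v] by fastforce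
    then show ?thesis unfolding invariant_cubic_mult[symmetric] by (simp add: mult.commute)
  qed
  then show thesis by (rule that)
qed

text \<open>(x, y) is a projective zero of the form, normalised to (0, 1) or x = 1 so that
  proportional zeros are equal.\<close>

lemma linear_factor_quadratic:
  fixes p q r :: complex
  obtains x y n0 n1 where "(x, y) = (0, 1) \<or> x = 1"
    "\<And>a b. p * a ^ 2 + q * a * b + r * b ^ 2 = (y * a - x * b) * (n0 * a + n1 * b)"
proof (cases "r = 0")
  case True
  show ?thesis by (rule that[of 0 1 p q]) (use True in \<open>auto simp: algebra_simps power2_eq_square\<close>)
next
  case False
  have "\<not> constant (poly [:p, q, r:])" using False by (simp add: constant_degree)
  then obtain y where "poly [:p, q, r:] y = 0" using fundamental_theorem_of_algebra by blast
  then have y: "p = - (q * y + r * y ^ 2)" by (simp add: algebra_simps power2_eq_square eq_neg_iff_add_eq_0)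
  show ?thesis by (rule that[of 1 y "- r * y - q" "- r"]) (auto simp: y algebra_simps power2_eq_square)
qed

lemma linear_factor_cubic:
  obtains x y p q r where "(x, y) = (0, 1) \<or> x = 1"
    "\<And>a b. binary_cubic C a b = (y * a - x * b) * (p * a ^ 2 + q * a * b + r * b ^ 2)"
proof (cases "C 3 = 0")
  case True
  show ?thesis by (rule that[of 0 1 "C 0" "C 1" "C 2"])
     (use True in \<open>auto simp: binary_cubic_def algebra_simps power2_eq_square power3_eq_cube\<close>)
next
  case False
  have "\<not> constant (poly [:C 0, C 1, C 2, C 3:])" using False by (simp add: constant_degree)
  then obtain y where "poly [:C 0, C 1, C 2, C 3:] y = 0" using fundamental_theorem_of_algebra by blast
  then have y: "C 0 = - (C 1 * y + C 2 * y ^ 2 + C 3 * y ^ 3)"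
    by (simp add: algebra_simps power2_eq_square power3_eq_cube eq_neg_iff_add_eq_0)
  define r q p where "r = - C 3" and "q = y * r - C 2" and "p = y * q - C 1"
  show ?thesis
    by (rule that[of 1 y p q r])
       (auto simp: binary_cubic_def y p_def q_def r_def algebra_simps power2_eq_square power3_eq_cube)
qed

text \<open>At the first zero (x, y) the gradient is the value of the quadratic cofactor times (y,
  -x). Hence the cofactor does not vanish there, its zeros differ from the first one, and two linear
  factors can serve as new coordinates in which the third is expressed.\<close>

lemma binary_cubic_factorization:
  assumes nonsing: "\<And>a b. (a, b) \<noteq> (0, 0) \<Longrightarrow> binary_cubic C a b = 0 \<Longrightarrow>
    3 * C 0 * a ^ 2 + 2 * C 1 * a * b + C 2 * b ^ 2 \<noteq> 0 \<or> C 1 * a ^ 2 + 2 * C 2 * a * b + 3 * C 3 * b ^ 2 \<noteq> 0"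
  obtains l0 l1 m0 m1 g0 g1 where "l0 * m1 - l1 * m0 \<noteq> 0" "g0 \<noteq> 0 \<or> g1 \<noteq> 0"
    "\<And>a b. binary_cubic C a b = (l0 * a + l1 * b) * (m0 * a + m1 * b) * (g0 * (l0 * a + l1 * b) + g1 * (m0 * a + m1 * b))"
proof -
  obtain x y p q r where xy: "(x, y) = (0, 1) \<or> x = 1" and
    f1: "\<And>a b. binary_cubic C a b = (y * a - x * b) * (p * a ^ 2 + q * a * b + r * b ^ 2)"
    using linear_factor_cubic[of C] by blast
  have coeffs: "C 0 = y * p" "C 1 = y * q - x * p" "C 2 = y * r - x * q" "C 3 = - x * r"
  proof -
    have e1: "C 0 + C 1 + C 2 + C 3 = (y - x) * (p + q + r)" using f1[of 1 1] by (simp add: binary_cubic_def)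
    have e2: "C 0 - C 1 + C 2 - C 3 = (y + x) * (p - q + r)" using f1[of 1 "-1"] by (simp add: binary_cubic_def)
    have e3: "C 0 + 2 * C 1 + 4 * C 2 + 8 * C 3 = (y - 2 * x) * (p + 2 * q + 4 * r)"
      using f1[of 1 2] by (simp add: binary_cubic_def mult_ac)
    show c0: "C 0 = y * p" using f1[of 1 0] by (simp add: binary_cubic_def)
    show c3: "C 3 = - x * r" using f1[of 0 1] by (simp add: binary_cubic_def)
    have "2 * (C 2 - (y * r - x * q)) = 0" using e1 e2 c0 c3 by Groebner_Basis.algebra
    then show c2: "C 2 = y * r - x * q" by (metis eq_iff_diff_eq_0 mult_eq_0_iff zero_neq_numeral)
    show "C 1 = y * q - x * p" using e1 c0 c3 c2 by Groebner_Basis.algebra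
  qed
  obtain x' y' n0 n1 where xy': "(x', y') = (0, 1) \<or> x' = 1" and
    f2: "\<And>a b. p * a ^ 2 + q * a * b + r * b ^ 2 = (y' * a - x' * b) * (n0 * a + n1 * b)"
    using linear_factor_quadratic[of p q r] by blast
  have q0: "p * x ^ 2 + q * x * y + r * y ^ 2 \<noteq> 0"
  proof
    assume q: "p * x ^ 2 + q * x * y + r * y ^ 2 = 0"
    have "(x, y) \<noteq> (0, 0)" using xy by auto
    moreover have "binary_cubic C x y = 0" unfolding f1 by simp
    moreover have "3 * C 0 * x ^ 2 + 2 * C 1 * x * y + C 2 * y ^ 2 = 0"
      unfolding coeffs using q by Groebner_Basis.algebra
    moreover have "C 1 * x ^ 2 + 2 * C 2 * x * y + 3 * C 3 * y ^ 2 = 0"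
      unfolding coeffs using q by Groebner_Basis.algebra
    ultimately show False using nonsing by blast
  qed
  define D where "D = x * y' - y * x'"
  have D: "D \<noteq> 0"
  proof
    assume "D = 0"
    then have "(x, y) = (x', y')" using xy xy' by (auto simp: D_def)
    then show False using q0 unfolding f2 by auto
  qed
  \<comment> \<open>Cramer's rule: the third factor is evaluated at the zeros of the second and of
    the first.\<close>
  define g0 g1 where "g0 = (n0 * x' + n1 * y') / - D" and "g1 = (n0 * x + n1 * y) / D"
  have gD: "g0 * D = - (n0 * x' + n1 * y')" "g1 * D = n0 * x + n1 * y"
    using D by (auto simp: g0_def g1_def)
  have lin: "n0 * a + n1 * b = g0 * (y * a - x * b) + g1 * (y' * a - x' * b)" for a b
  proof -
    have "D * (n0 * a + n1 * b) = D * (g0 * (y * a - x * b) + g1 * (y' * a - x' * b))"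
      using gD unfolding D_def by Groebner_Basis.algebra
    then show ?thesis using D by simp
  qed
  show thesis
  proof (rule that[of y "- x'" "- x" y' g0 g1])
    show "y * - x' - - x * y' \<noteq> 0" using D by (simp add: D_def)
    show "g0 \<noteq> 0 \<or> g1 \<noteq> 0"
    proof (rule ccontr)
      assume "\<not> (g0 \<noteq> 0 \<or> g1 \<noteq> 0)"
      then have "n0 * x + n1 * y = 0" using lin[of x y] by simp
      then show False using q0 unfolding f2 by simp
    qed
    show "binary_cubic C a b = (y * a + - x * b) * (y' * a + - x' * b) * (g0 * (y * a + - x * b) + g1 * (y' * a + - x' * b))" for a b
      unfolding f1 f2 lin by simp
  qed
qed

text \<open>The hypotheses \<open>z\<close> are the value and the partial derivatives in a, b, u, s,
  t. The derivative is computed in an arbitrary direction once, which covers all coordinate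
  directions.\<close>

lemma invariant_cubic_singular:
  assumes F: "\<And>v. v \<in> carrier_vec 5 \<Longrightarrow> F v = invariant_cubic C (v $ 0) (v $ 4) (v $ 1) (v $ 2) (v $ 3)"
    and v: "v = vec5 a u s t b"
    and z: "invariant_cubic C a b u s t = 0"
      "3 * C 0 * a ^ 2 + 2 * C 1 * a * b + C 2 * b ^ 2 + u * (C 5 * s + C 7 * t) = 0"
      "C 1 * a ^ 2 + 2 * C 2 * a * b + 3 * C 3 * b ^ 2 + u * (C 6 * s + C 8 * t) = 0"
      "3 * C 4 * u ^ 2 + (C 5 * a * s + C 6 * b * s + C 7 * a * t + C 8 * b * t) = 0"
      "3 * C 9 * s ^ 2 + 2 * C 10 * s * t + C 11 * t ^ 2 + u * (C 5 * a + C 6 * b) = 0"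
      "C 10 * s ^ 2 + 2 * C 11 * s * t + 3 * C 12 * t ^ 2 + u * (C 7 * a + C 8 * b) = 0"
  shows "singular_at 4 F v"
proof -
  have vc: "v \<in> carrier_vec 5" by (simp add: v)
  have vi: "v $ 0 = a" "v $ 1 = u" "v $ 2 = s" "v $ 3 = t" "v $ 4 = b"
    by (auto simp: v simp del: One_nat_def)
  have D: "((\<lambda>x. invariant_cubic C (a + x * da) (b + x * db) (u + x * du) (s + x * ds) (t + x * dt))
      has_field_derivative 0) (at 0)" for da db du ds dt
  proof -
    have "((\<lambda>x. invariant_cubic C (a + x * da) (b + x * db) (u + x * du) (s + x * ds) (t + x * dt))
      has_field_derivative
        da * (3 * C 0 * a ^ 2 + 2 * C 1 * a * b + C 2 * b ^ 2 + u * (C 5 * s + C 7 * t))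
      + db * (C 1 * a ^ 2 + 2 * C 2 * a * b + 3 * C 3 * b ^ 2 + u * (C 6 * s + C 8 * t))
      + du * (3 * C 4 * u ^ 2 + (C 5 * a * s + C 6 * b * s + C 7 * a * t + C 8 * b * t))
      + ds * (3 * C 9 * s ^ 2 + 2 * C 10 * s * t + C 11 * t ^ 2 + u * (C 5 * a + C 6 * b))
      + dt * (C 10 * s ^ 2 + 2 * C 11 * s * t + 3 * C 12 * t ^ 2 + u * (C 7 * a + C 8 * b))) (at 0)"
      unfolding invariant_cubic_def binary_cubic_def
      by (rule derivative_eq_intros refl)+ (simp add: algebra_simps power2_eq_square)
    then show ?thesis unfolding z by simp
  qed
  show ?thesis
    unfolding singular_at_def
  proof (intro conjI allI impI)
    show "F v = 0" using F[OF vc] z(1) by (simp only: vi)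
    fix i :: nat assume i: "i \<le> 4"
    define e where "e = (\<lambda>j. if j = i then 1 else 0 :: complex)"
    have e: "(v + x \<cdot>\<^sub>v unit_vec 5 i) $ j = v $ j + x * e j" if "j < 5" for j x
      using that i vc by (auto simp: e_def)
    have "F (v + x \<cdot>\<^sub>v unit_vec (4 + 1) i) =
      invariant_cubic C (a + x * e 0) (b + x * e 4) (u + x * e 1) (s + x * e 2) (t + x * e 3)" for x
      using F[of "v + x \<cdot>\<^sub>v unit_vec 5 i"] vc
        e[of 0 x, unfolded vi] e[of 1 x, unfolded vi] e[of 2 x, unfolded vi] e[of 3 x, unfolded vi] e[of 4 x, unfolded vi]
      by (simp del: index_add_vec One_nat_def)
    then show "((\<lambda>x. F (v + x \<cdot>\<^sub>v unit_vec (4 + 1) i)) has_field_derivative 0) (at 0)"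
      using D by simp
  qed
qed

text \<open>If \<open>C 4\<close> were 0, the point with only u nonzero would be singular. On the
  line u = s = t = 0 the derivatives in u, s, t vanish, and on a = b = u = 0 those in a, b, u; so a
  singular zero of either binary cubic would be a singular point of \<open>F\<close>. The new
  coordinates are two linear factors of each binary cubic, and division by \<open>C 4\<close> makes
  u^3 monic.\<close>

lemma smooth_invariant_normal_form:
  assumes F: "\<And>v. v \<in> carrier_vec 5 \<Longrightarrow> F v = invariant_cubic C (v $ 0) (v $ 4) (v $ 1) (v $ 2) (v $ 3)"
    and smooth: "\<And>v. v \<in> carrier_vec 5 \<Longrightarrow> v \<noteq> 0\<^sub>v 5 \<Longrightarrow> \<not> singular_at 4 F v"
  obtains k l0 l1 m0 m1 s2 s3 t2 t3 f1 f2 h1 h2 b00 b10 b01 b11 where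
    "k \<noteq> 0" "l0 * m1 - l1 * m0 \<noteq> 0" "s2 * t3 - s3 * t2 \<noteq> 0" "h1 \<noteq> 0 \<or> h2 \<noteq> 0"
    "\<And>v a b u s t. v \<in> carrier_vec 5 \<Longrightarrow> a = l0 * v $ 0 + l1 * v $ 4 \<Longrightarrow> b = m0 * v $ 0 + m1 * v $ 4 \<Longrightarrow>
       u = v $ 1 \<Longrightarrow> s = s2 * v $ 2 + s3 * v $ 3 \<Longrightarrow> t = t2 * v $ 2 + t3 * v $ 3 \<Longrightarrow>
       F v = k * (a * b * (f1 * a + f2 * b) + u ^ 3 + u * (b00 * a * s + b10 * b * s + b01 * a * t + b11 * b * t)
          + s * t * (h1 * s + h2 * t))"
proof -
  have nz: "vec5 a u s t b \<noteq> (0\<^sub>v 5 :: complex vec)" "vec5 a u s t b \<in> carrier_vec 5"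
    if "(a, u, s, t, b) \<noteq> (0, 0, 0, 0, 0)" for a u s t b :: complex
  proof -
    show "vec5 a u s t b \<in> carrier_vec 5" by simp
    show "vec5 a u s t b \<noteq> 0\<^sub>v 5"
    proof
      assume z: "vec5 a u s t b = 0\<^sub>v 5"
      have "vec5 a u s t b $ i = 0" if "i < 5" for i using that by (simp add: z)
      from this[of 0] this[of 1] this[of 2] this[of 3] this[of 4] show False using that by auto
    qed
  qed
  have k: "C 4 \<noteq> 0"
  proof
    assume "C 4 = 0"
    then have "singular_at 4 F (vec5 0 1 0 0 0)"
      by (intro invariant_cubic_singular[OF F refl]) (auto simp: invariant_cubic_def binary_cubic_def)
    then show False using smooth nz[of 0 1 0 0 0] by simp
  qed
  have f: "3 * C 0 * a ^ 2 + 2 * C 1 * a * b + C 2 * b ^ 2 \<noteq> 0 \<or> C 1 * a ^ 2 + 2 * C 2 * a * b + 3 * C 3 * b ^ 2 \<noteq> 0"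
    if "(a, b) \<noteq> (0, 0)" "binary_cubic C a b = 0" for a b
  proof (rule ccontr)
    assume "\<not> ?thesis"
    then have "singular_at 4 F (vec5 a 0 0 0 b)"
      using that(2) by (intro invariant_cubic_singular[OF F refl]) (auto simp: invariant_cubic_def binary_cubic_def)
    then show False using smooth nz[of a 0 0 0 b] that(1) by auto
  qed
  define E where "E = (\<lambda>i. C (i + 9))"
  have h: "3 * E 0 * s ^ 2 + 2 * E 1 * s * t + E 2 * t ^ 2 \<noteq> 0 \<or> E 1 * s ^ 2 + 2 * E 2 * s * t + 3 * E 3 * t ^ 2 \<noteq> 0"
    if "(s, t) \<noteq> (0, 0)" "binary_cubic E s t = 0" for s t
  proof (rule ccontr)
    assume "\<not> ?thesis"
    then have "singular_at 4 F (vec5 0 0 s t 0)"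
      using that(2) by (intro invariant_cubic_singular[OF F refl]) (auto simp: invariant_cubic_def binary_cubic_def E_def)
    then show False using smooth nz[of 0 0 s t 0] that(1) by auto
  qed
  obtain l0 l1 m0 m1 g0 g1 where 1: "l0 * m1 - l1 * m0 \<noteq> 0" "\<And>a b. binary_cubic C a b =
      (l0 * a + l1 * b) * (m0 * a + m1 * b) * (g0 * (l0 * a + l1 * b) + g1 * (m0 * a + m1 * b))"
    using binary_cubic_factorization[OF f] by metis
  obtain s2 s3 t2 t3 h0 h1 where 2: "s2 * t3 - s3 * t2 \<noteq> 0" "h0 \<noteq> 0 \<or> h1 \<noteq> 0" "\<And>a b. binary_cubic E a b =
      (s2 * a + s3 * b) * (t2 * a + t3 * b) * (h0 * (s2 * a + s3 * b) + h1 * (t2 * a + t3 * b))"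
    using binary_cubic_factorization[OF h] by metis
  define d e where "d = l0 * m1 - l1 * m0" and "e = s2 * t3 - s3 * t2"
  \<comment> \<open>Entries of the inverse matrices, which express v $ 0, v $ 4 through a, b and v $
    2, v $ 3 through s, t; they are needed to rewrite the bilinear part.\<close>
  define a0 a4 b0 b4 where "a0 = m1 / d" and "a4 = - m0 / d" and "b0 = - l1 / d" and "b4 = l0 / d"
  define c2 c3 d2 d3 where "c2 = t3 / e" and "c3 = - t2 / e" and "d2 = - s3 / e" and "d3 = s2 / e"
  show thesis
  proof (rule that[OF k 1(1) 2(1), of "h0 / C 4" "h1 / C 4" "g0 / C 4" "g1 / C 4"
      "(C 5 * a0 * c2 + C 6 * a4 * c2 + C 7 * a0 * c3 + C 8 * a4 * c3) / C 4"
      "(C 5 * b0 * c2 + C 6 * b4 * c2 + C 7 * b0 * c3 + C 8 * b4 * c3) / C 4"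
      "(C 5 * a0 * d2 + C 6 * a4 * d2 + C 7 * a0 * d3 + C 8 * a4 * d3) / C 4"
      "(C 5 * b0 * d2 + C 6 * b4 * d2 + C 7 * b0 * d3 + C 8 * b4 * d3) / C 4"])
    show "h0 / C 4 \<noteq> 0 \<or> h1 / C 4 \<noteq> 0" using 2(2) k by simp
    fix v a b u s t
    assume v: "v \<in> carrier_vec 5" and a: "a = l0 * v $ 0 + l1 * v $ 4" and b: "b = m0 * v $ 0 + m1 * v $ 4"
      and u: "u = v $ 1" and s: "s = s2 * v $ 2 + s3 * v $ 3" and t: "t = t2 * v $ 2 + t3 * v $ 3"
    have de: "d \<noteq> 0" "e \<noteq> 0" using 1 2 by (auto simp: d_def e_def)
    have da: "d * a0 = m1" "d * b0 = - l1" "d * a4 = - m0" "d * b4 = l0"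
      using de by (auto simp: a0_def b0_def a4_def b4_def)
    have ea: "e * c2 = t3" "e * d2 = - s3" "e * c3 = - t2" "e * d3 = s2"
      using de by (auto simp: c2_def c3_def d2_def d3_def)
    have v0: "v $ 0 = a0 * a + b0 * b"
    proof -
      have "d * (a0 * a + b0 * b) = (d * a0) * a + (d * b0) * b" by (simp add: algebra_simps)
      also have "\<dots> = d * v $ 0" unfolding da unfolding d_def a b by (simp add: algebra_simps)
      finally have "d * (a0 * a + b0 * b) = d * v $ 0" .
      then show ?thesis using de by simp
    qed
    have v4: "v $ 4 = a4 * a + b4 * b"
    proof -
      have "d * (a4 * a + b4 * b) = (d * a4) * a + (d * b4) * b" by (simp add: algebra_simps)
      also have "\<dots> = d * v $ 4" unfolding da unfolding d_def a b by (simp add: algebra_simps)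
      finally have "d * (a4 * a + b4 * b) = d * v $ 4" .
      then show ?thesis using de by simp
    qed
    have v2: "v $ 2 = c2 * s + d2 * t"
    proof -
      have "e * (c2 * s + d2 * t) = (e * c2) * s + (e * d2) * t" by (simp add: algebra_simps)
      also have "\<dots> = e * v $ 2" unfolding ea unfolding e_def s t by (simp add: algebra_simps)
      finally have "e * (c2 * s + d2 * t) = e * v $ 2" .
      then show ?thesis using de by simp
    qed
    have v3: "v $ 3 = c3 * s + d3 * t"
    proof -
      have "e * (c3 * s + d3 * t) = (e * c3) * s + (e * d3) * t" by (simp add: algebra_simps)
      also have "\<dots> = e * v $ 3" unfolding ea unfolding e_def s t by (simp add: algebra_simps)
      finally have "e * (c3 * s + d3 * t) = e * v $ 3" .
      then show ?thesis using de by simp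
    qed
    define B0 B1 B2 B3 where "B0 = C 5 * a0 * c2 + C 6 * a4 * c2 + C 7 * a0 * c3 + C 8 * a4 * c3"
      and "B1 = C 5 * b0 * c2 + C 6 * b4 * c2 + C 7 * b0 * c3 + C 8 * b4 * c3"
      and "B2 = C 5 * a0 * d2 + C 6 * a4 * d2 + C 7 * a0 * d3 + C 8 * a4 * d3"
      and "B3 = C 5 * b0 * d2 + C 6 * b4 * d2 + C 7 * b0 * d3 + C 8 * b4 * d3"
    have B: "C 5 * v $ 0 * v $ 2 + C 6 * v $ 4 * v $ 2 + C 7 * v $ 0 * v $ 3 + C 8 * v $ 4 * v $ 3 =
        B0 * a * s + B1 * b * s + B2 * a * t + B3 * b * t"
      unfolding v0 v2 v3 v4 B0_def B1_def B2_def B3_def by Groebner_Basis.algebra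
    have fa: "binary_cubic C (v $ 0) (v $ 4) = a * b * (g0 * a + g1 * b)" unfolding 1(2) a b ..
    have hs: "binary_cubic E (v $ 2) (v $ 3) = s * t * (h0 * s + h1 * t)" unfolding 2(3) s t ..
    have Fv: "F v = a * b * (g0 * a + g1 * b) + C 4 * u ^ 3
      + u * (B0 * a * s + B1 * b * s + B2 * a * t + B3 * b * t) + s * t * (h0 * s + h1 * t)"
      unfolding F[OF v] invariant_cubic_def E_def[symmetric] fa hs B u ..
    have kk: "x = C 4 * (x / C 4)" for x using k by simp
    have "F v = C 4 * (a * b * (g0 / C 4 * a + g1 / C 4 * b) + u ^ 3 +
      u * (B0 / C 4 * a * s + B1 / C 4 * b * s + B2 / C 4 * a * t + B3 / C 4 * b * t)
      + s * t * (h0 / C 4 * s + h1 / C 4 * t))"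
      unfolding Fv using kk[of g0] kk[of g1] kk[of h0] kk[of h1] kk[of B0] kk[of B1] kk[of B2] kk[of B3]
      by Groebner_Basis.algebra
    then show "F v = C 4 * (a * b * (g0 / C 4 * a + g1 / C 4 * b) + u ^ 3 +
      u * ((C 5 * a0 * c2 + C 6 * a4 * c2 + C 7 * a0 * c3 + C 8 * a4 * c3) / C 4 * a * s
      + (C 5 * b0 * c2 + C 6 * b4 * c2 + C 7 * b0 * c3 + C 8 * b4 * c3) / C 4 * b * s
      + (C 5 * a0 * d2 + C 6 * a4 * d2 + C 7 * a0 * d3 + C 8 * a4 * d3) / C 4 * a * t
      + (C 5 * b0 * d2 + C 6 * b4 * d2 + C 7 * b0 * d3 + C 8 * b4 * d3) / C 4 * b * t)
      + s * t * (h0 / C 4 * s + h1 / C 4 * t))"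
      unfolding B0_def B1_def B2_def B3_def .
  qed
qed

section \<open>Rings of regular functions\<close>

lemma openin_hform_nonzero:
  assumes "hform n d F"
  shows "openin (zariski n) {p \<in> proj_points n. \<forall>v\<in>p. F v \<noteq> 0}"
proof -
  obtain P where P: "is_form n d P" "F = poly_eval P" using assms by (auto simp: hform_def)
  have "{p \<in> proj_points n. \<forall>v\<in>p. F v \<noteq> 0} = proj_points n - zero_locus n {P}"
  proof (intro equalityI subsetI)
    fix p assume p: "p \<in> {p \<in> proj_points n. \<forall>v\<in>p. F v \<noteq> 0}"
    then obtain v where "p = pt v" using proj_points_cases by blast
    then have "v \<in> p" using pt_self by simp
    with p show "p \<in> proj_points n - zero_locus n {P}" by (auto simp: zero_locus_def P(2))
  next
    fix p assume p: "p \<in> proj_points n - zero_locus n {P}"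
    then have "\<forall>v\<in>p. poly_eval P v \<noteq> 0"
      using form_zero_on_point[OF P(1)] by (auto simp: zero_locus_def)
    with p show "p \<in> {p \<in> proj_points n. \<forall>v\<in>p. F v \<noteq> 0}" by (auto simp: P(2))
  qed
  then show ?thesis using P(1) unfolding openin_zariski zariski_open_def by blast
qed

text \<open>One form of the defining set that is nonzero at \<open>p\<close> already cuts out a
  neighbourhood; vanishing does not depend on the representative.\<close>

lemma zariski_basis:
  assumes "openin (zariski n) U" "p \<in> U"
  obtains d H where "hform n d H" "\<And>v. v \<in> p \<Longrightarrow> H v \<noteq> 0"
    "{q \<in> proj_points n. \<forall>v\<in>q. H v \<noteq> 0} \<subseteq> U"
proof -
  obtain S where S: "\<forall>F\<in>S. \<exists>d. is_form n d F" "U = proj_points n - zero_locus n S"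
    using assms(1) unfolding openin_zariski zariski_open_def by blast
  with assms(2) obtain P w where P: "P \<in> S" "w \<in> p" "poly_eval P w \<noteq> 0" and p: "p \<in> proj_points n"
    by (auto simp: zero_locus_def)
  then obtain d where d: "is_form n d P" using S(1) by blast
  show thesis
  proof (rule that[OF hform_poly_eval[OF d]])
    show "poly_eval P v \<noteq> 0" if "v \<in> p" for v
      using form_zero_on_point[OF d p that P(2)] P(3) by blast
    show "{q \<in> proj_points n. \<forall>v\<in>q. poly_eval P v \<noteq> 0} \<subseteq> U"
    proof
      fix q assume q: "q \<in> {q \<in> proj_points n. \<forall>v\<in>q. poly_eval P v \<noteq> 0}"
      then obtain v where "q = pt v" using proj_points_cases by blast
      then have "v \<in> q" using pt_self by simp
      with q P(1) show "q \<in> U" by (auto simp: S(2) zero_locus_def)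
    qed
  qed
qed

text \<open>The properties shared by projective varieties, their open subspaces and quotients.
  \<open>reg_nonzero_open\<close> is the source of continuity of maps given by regular functions;
  \<open>reg_cong\<close> expresses that only values on U count.\<close>

locale ringed_space =
  fixes \<X> :: "'a fun_space"
  assumes reg_const: "openin (space_top \<X>) U \<Longrightarrow> regular \<X> U (\<lambda>x. c)"
    and reg_add: "openin (space_top \<X>) U \<Longrightarrow> regular \<X> U f \<Longrightarrow> regular \<X> U g \<Longrightarrow> regular \<X> U (\<lambda>x. f x + g x)"
    and reg_mult: "openin (space_top \<X>) U \<Longrightarrow> regular \<X> U f \<Longrightarrow> regular \<X> U g \<Longrightarrow> regular \<X> U (\<lambda>x. f x * g x)"
    and reg_inverse: "openin (space_top \<X>) U \<Longrightarrow> regular \<X> U f \<Longrightarrow> (\<And>x. x \<in> U \<Longrightarrow> f x \<noteq> 0) \<Longrightarrow>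
      regular \<X> U (\<lambda>x. inverse (f x))"
    and reg_nonzero_open: "openin (space_top \<X>) U \<Longrightarrow> regular \<X> U f \<Longrightarrow> openin (space_top \<X>) {x \<in> U. f x \<noteq> 0}"
    and reg_local: "openin (space_top \<X>) U \<Longrightarrow>
      (\<And>x. x \<in> U \<Longrightarrow> \<exists>W. openin (space_top \<X>) W \<and> x \<in> W \<and> W \<subseteq> U \<and> regular \<X> W f) \<Longrightarrow> regular \<X> U f"
    and reg_restrict: "openin (space_top \<X>) U \<Longrightarrow> regular \<X> U f \<Longrightarrow> openin (space_top \<X>) W \<Longrightarrow> W \<subseteq> U \<Longrightarrow> regular \<X> W f"
    and reg_cong: "openin (space_top \<X>) U \<Longrightarrow> regular \<X> U f \<Longrightarrow> (\<And>x. x \<in> U \<Longrightarrow> f x = g x) \<Longrightarrow> regular \<X> U g"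
begin

lemma reg_divide:
  assumes "openin (space_top \<X>) U" "regular \<X> U f" "regular \<X> U g" "\<And>x. x \<in> U \<Longrightarrow> g x \<noteq> 0"
  shows "regular \<X> U (\<lambda>x. f x / g x)"
  using reg_mult[OF assms(1,2) reg_inverse[OF assms(1,3,4)]] by (simp add: divide_inverse)

lemma reg_uminus:
  assumes "openin (space_top \<X>) U" "regular \<X> U f"
  shows "regular \<X> U (\<lambda>x. - f x)"
  using reg_mult[OF assms(1) reg_const[OF assms(1), of "-1"] assms(2)] by simp

lemma reg_power:
  assumes "openin (space_top \<X>) U" "regular \<X> U f"
  shows "regular \<X> U (\<lambda>x. f x ^ k)"
  by (induction k) (use reg_const[OF assms(1)] reg_mult[OF assms] in auto)

lemma reg_prod:
  assumes "openin (space_top \<X>) U" "finite A" "\<And>i. i \<in> A \<Longrightarrow> regular \<X> U (f i)"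
  shows "regular \<X> U (\<lambda>x. \<Prod>i\<in>A. f i x)"
  using assms(2,3)
  by (induction A rule: finite_induct) (use reg_const[OF assms(1)] reg_mult[OF assms(1)] in auto)

lemma reg_hform:
  assumes "hform m d H" "openin (space_top \<X>) U" "\<And>i. i \<le> m \<Longrightarrow> regular \<X> U (g i)"
  shows "regular \<X> U (\<lambda>x. H (vec (m + 1) (\<lambda>i. g i x)))"
  using assms(1)
proof (induction rule: hform_induct)
  case zero show ?case by (rule reg_const[OF assms(2)])
next
  case (add f h) then show ?case by (rule reg_add[OF assms(2)])
next
  case (mono e c)
  have "regular \<X> U (\<lambda>x. c * (\<Prod>i\<le>m. g i x ^ e i))"
    by (rule reg_mult[OF assms(2) reg_const[OF assms(2)] reg_prod[OF assms(2)]])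
       (auto intro!: reg_power[OF assms(2) assms(3)])
  then show ?case by simp
qed

end

definition frac_on :: "ppoint set \<Rightarrow> (ppoint \<Rightarrow> complex) \<Rightarrow> (complex vec \<Rightarrow> complex) \<Rightarrow> (complex vec \<Rightarrow> complex) \<Rightarrow> bool" where
  "frac_on W f F G \<longleftrightarrow> (\<forall>q\<in>W. \<forall>v\<in>q. G v \<noteq> 0 \<and> f q = F v / G v)"

definition quotient_on :: "nat \<Rightarrow> ppoint set \<Rightarrow> (ppoint \<Rightarrow> complex) \<Rightarrow> bool" where
  "quotient_on n W f \<longleftrightarrow> (\<exists>d F G. hform n d F \<and> hform n d G \<and> frac_on W f F G)"

lemma frac_onD:
  assumes "frac_on W f F G" "q \<in> W" "v \<in> q" shows "G v \<noteq> 0" "f q = F v / G v"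
  using assms by (auto simp: frac_on_def)

lemma quotient_onI:
  assumes "hform n d F" "hform n d G" "\<And>q v. q \<in> W \<Longrightarrow> v \<in> q \<Longrightarrow> G v \<noteq> 0 \<and> f q = F v / G v"
  shows "quotient_on n W f"
proof -
  have "frac_on W f F G" by (simp add: frac_on_def assms(3))
  with assms(1,2) show ?thesis unfolding quotient_on_def by blast
qed

lemma quotient_onE:
  assumes "quotient_on n W f"
  obtains d F G where "hform n d F" "hform n d G" "frac_on W f F G"
  using assms unfolding quotient_on_def by blast

lemma quotient_on_const: "quotient_on n W (\<lambda>x. c)"
  by (rule quotient_onI[OF hform_const[of n c] hform_const[of n 1]]) simp

lemma quotient_on_subset_cong:
  assumes "quotient_on n W f" "W' \<subseteq> W" "\<And>x. x \<in> W' \<Longrightarrow> f x = g x" shows "quotient_on n W' g"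
proof -
  obtain d F G where 1: "hform n d F" "hform n d G" "frac_on W f F G" using assms(1) by (rule quotient_onE)
  have "G v \<noteq> 0 \<and> g q = F v / G v" if "q \<in> W'" "v \<in> q" for q v
  proof -
    have "q \<in> W" using that(1) assms(2) by blast
    then show ?thesis using frac_onD[OF 1(3) _ that(2)] assms(3)[OF that(1)] by simp
  qed
  then show ?thesis by (rule quotient_onI[OF 1(1,2)])
qed

lemmas quotient_on_subset = quotient_on_subset_cong[OF _ _ refl]

lemma quotient_on_add_mult:
  assumes "quotient_on n W f" "quotient_on n W g"
  shows "quotient_on n W (\<lambda>x. f x + g x)" "quotient_on n W (\<lambda>x. f x * g x)"
proof -
  obtain d F G where 1: "hform n d F" "hform n d G" "frac_on W f F G" using assms(1) by (rule quotient_onE)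
  obtain e H K where 2: "hform n e H" "hform n e K" "frac_on W g H K" using assms(2) by (rule quotient_onE)
  note fr = frac_onD[OF 1(3)] frac_onD[OF 2(3)]
  show "quotient_on n W (\<lambda>x. f x + g x)"
    by (rule quotient_onI[OF hform_add[OF hform_mult[OF 1(1) 2(2)] hform_mult[OF 2(1) 1(2), unfolded add.commute[of e d]]]
          hform_mult[OF 1(2) 2(2)]])
       (simp add: fr add_frac_eq)
  show "quotient_on n W (\<lambda>x. f x * g x)"
    by (rule quotient_onI[OF hform_mult[OF 1(1) 2(1)] hform_mult[OF 1(2) 2(2)]]) (simp add: fr)
qed

lemma quotient_on_inverse:
  assumes "quotient_on n W f" "\<And>x. x \<in> W \<Longrightarrow> f x \<noteq> 0" shows "quotient_on n W (\<lambda>x. inverse (f x))"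
proof -
  obtain d F G where 1: "hform n d F" "hform n d G" "frac_on W f F G" using assms(1) by (rule quotient_onE)
  have "F v \<noteq> 0 \<and> inverse (f q) = G v / F v" if "q \<in> W" "v \<in> q" for q v
    using frac_onD[OF 1(3) that] assms(2)[OF that(1)] by auto
  then show ?thesis by (rule quotient_onI[OF 1(2,1)])
qed

lemma regular_proj_variety_iff:
  "regular (proj_variety n X) U f \<longleftrightarrow>
     (\<forall>p\<in>U. \<exists>W. openin (subtopology (zariski n) X) W \<and> p \<in> W \<and> W \<subseteq> U \<and> quotient_on n W f)"
proof -
  have "quotient_on n W f \<longleftrightarrow> (\<exists>d F G. is_form n d F \<and> is_form n d G \<and>
      (\<forall>q\<in>W. \<forall>v\<in>q. poly_eval G v \<noteq> 0 \<and> f q = poly_eval F v / poly_eval G v))" for W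
    unfolding quotient_on_def frac_on_def hform_def by auto
  then show ?thesis by (simp add: proj_variety_def)
qed

lemma ringed_space_proj_variety:
  assumes "X \<subseteq> proj_points n"
  shows "ringed_space (proj_variety n X)"
proof -
  define T where "T = subtopology (zariski n) X"
  have top: "space_top (proj_variety n X) = T" by (simp add: proj_variety_def T_def)
  define R where "R = regular (proj_variety n X)"
  have RI: "R U f" if "\<And>p. p \<in> U \<Longrightarrow> \<exists>W. openin T W \<and> p \<in> W \<and> W \<subseteq> U \<and> quotient_on n W f" for U f
    using that unfolding R_def T_def regular_proj_variety_iff by blast
  have RE: "\<exists>W. openin T W \<and> p \<in> W \<and> W \<subseteq> U \<and> quotient_on n W f" if "R U f" "p \<in> U" for U f p
    using that unfolding R_def T_def regular_proj_variety_iff by blast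
  show ?thesis
  proof (unfold_locales; unfold top R_def[symmetric])
    fix U and c :: complex
    assume "openin T U"
    then show "R U (\<lambda>x. c)" using quotient_on_const by (intro RI exI[of _ U]) simp
  next
    fix U f g assume f: "R U f" and g: "R U g"
    have ex: "\<exists>W. openin T W \<and> p \<in> W \<and> W \<subseteq> U \<and> quotient_on n W f \<and> quotient_on n W g" if p: "p \<in> U" for p
    proof -
      obtain W1 where 1: "openin T W1" "p \<in> W1" "W1 \<subseteq> U" "quotient_on n W1 f" using RE[OF f p] by blast
      obtain W2 where 2: "openin T W2" "p \<in> W2" "W2 \<subseteq> U" "quotient_on n W2 g" using RE[OF g p] by blast
      show ?thesis
        using 1 2 quotient_on_subset[OF 1(4), of "W1 \<inter> W2"] quotient_on_subset[OF 2(4), of "W1 \<inter> W2"]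
        by (intro exI[of _ "W1 \<inter> W2"]) auto
    qed
    show "R U (\<lambda>x. f x + g x)" "R U (\<lambda>x. f x * g x)"
    proof (rule_tac [!] RI)
      fix p assume "p \<in> U"
      from ex[OF this] obtain W where "openin T W" "p \<in> W" "W \<subseteq> U" "quotient_on n W f" "quotient_on n W g" by blast
      then show "\<exists>W. openin T W \<and> p \<in> W \<and> W \<subseteq> U \<and> quotient_on n W (\<lambda>x. f x + g x)"
        "\<exists>W. openin T W \<and> p \<in> W \<and> W \<subseteq> U \<and> quotient_on n W (\<lambda>x. f x * g x)"
        using quotient_on_add_mult[of n W f g] by (intro exI[of _ W]; simp)+
    qed
  next
    fix U f assume f: "R U f" and nz: "\<And>x. x \<in> U \<Longrightarrow> f x \<noteq> 0"
    show "R U (\<lambda>x. inverse (f x))"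
    proof (rule RI)
      fix p assume "p \<in> U"
      with RE[OF f] obtain W where W: "openin T W" "p \<in> W" "W \<subseteq> U" "quotient_on n W f" by blast
      then have "quotient_on n W (\<lambda>x. inverse (f x))" using nz by (intro quotient_on_inverse) auto
      with W show "\<exists>W. openin T W \<and> p \<in> W \<and> W \<subseteq> U \<and> quotient_on n W (\<lambda>x. inverse (f x))" by blast
    qed
  next
    fix U f assume f: "R U f"
    show "openin T {x \<in> U. f x \<noteq> 0}"
    proof (subst openin_subopen, intro ballI)
      fix p assume "p \<in> {x \<in> U. f x \<noteq> 0}"
      then have p: "p \<in> U" "f p \<noteq> 0" by auto
      obtain W where W: "openin T W" "p \<in> W" "W \<subseteq> U" "quotient_on n W f" using RE[OF f p(1)] by blast
      obtain d F G where 1: "hform n d F" "hform n d G" "frac_on W f F G" using W(4) by (rule quotient_onE)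
      \<comment> \<open>Near \<open>p\<close> the zeros of f are the zeros of its numerator.\<close>
      define W' where "W' = W \<inter> (X \<inter> {p \<in> proj_points n. \<forall>v\<in>p. F v \<noteq> 0})"
      have "openin T W'"
        unfolding W'_def T_def
        by (intro openin_Int openin_subtopology_Int2 openin_hform_nonzero[OF 1(1)] W(1)[unfolded T_def])
      moreover have "p \<in> X" "p \<in> proj_points n"
        using openin_subset[OF W(1)] W(2) assms by (auto simp: T_def)
      then have "p \<in> W'" using W(2) frac_onD(2)[OF 1(3) W(2)] p(2) by (auto simp: W'_def)
      moreover have "W' \<subseteq> {x \<in> U. f x \<noteq> 0}"
      proof
        fix q assume q: "q \<in> W'"
        then have "q \<in> proj_points n" by (simp add: W'_def)
        then obtain v where "q = pt v" using proj_points_cases by blast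
        then have "v \<in> q" using pt_self by simp
        then show "q \<in> {x \<in> U. f x \<noteq> 0}" using q W(3) frac_onD[OF 1(3), of q v] by (auto simp: W'_def)
      qed
      ultimately show "\<exists>T'. openin T T' \<and> p \<in> T' \<and> T' \<subseteq> {x \<in> U. f x \<noteq> 0}" by blast
    qed
  next
    fix U f assume l: "\<And>x. x \<in> U \<Longrightarrow> \<exists>W. openin T W \<and> x \<in> W \<and> W \<subseteq> U \<and> R W f"
    show "R U f"
    proof (rule RI)
      fix p assume "p \<in> U"
      then obtain W where W: "p \<in> W" "W \<subseteq> U" "R W f" using l by blast
      from RE[OF W(3,1)] W(2) show "\<exists>W. openin T W \<and> p \<in> W \<and> W \<subseteq> U \<and> quotient_on n W f" by blast
    qed
  next
    fix U W f assume f: "R U f" and W: "openin T W" "W \<subseteq> U"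
    show "R W f"
    proof (rule RI)
      fix p assume p: "p \<in> W"
      with W(2) obtain W1 where 1: "openin T W1" "p \<in> W1" "quotient_on n W1 f" using RE[OF f] by blast
      then show "\<exists>W'. openin T W' \<and> p \<in> W' \<and> W' \<subseteq> W \<and> quotient_on n W' f"
        using W p quotient_on_subset[OF 1(3), of "W1 \<inter> W"] by (intro exI[of _ "W1 \<inter> W"]) auto
    qed
  next
    fix U f g assume f: "R U f" and e: "\<And>x. x \<in> U \<Longrightarrow> f x = g x"
    show "R U g"
    proof (rule RI)
      fix p assume "p \<in> U"
      with RE[OF f] obtain W where W: "openin T W" "p \<in> W" "W \<subseteq> U" "quotient_on n W f" by blast
      then have "quotient_on n W g" using e by (intro quotient_on_subset_cong[OF W(4)]) auto
      with W show "\<exists>W. openin T W \<and> p \<in> W \<and> W \<subseteq> U \<and> quotient_on n W g" by blast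
    qed
  qed
qed

lemma ringed_space_open_subspace:
  assumes "ringed_space \<X>" "openin (space_top \<X>) S"
  shows "ringed_space (open_subspace \<X> S)"
proof -
  interpret ringed_space \<X> by fact
  have o: "openin (space_top (open_subspace \<X> S)) U \<longleftrightarrow> openin (space_top \<X>) U \<and> U \<subseteq> S" for U
    using openin_open_subtopology[OF assms(2)] by (simp add: open_subspace_def)
  have r: "regular (open_subspace \<X> S) = regular \<X>" by (simp add: open_subspace_def)
  show ?thesis
  proof (unfold_locales; unfold o r)
    fix U f assume U: "openin (space_top \<X>) U \<and> U \<subseteq> S"
      and l: "\<And>x. x \<in> U \<Longrightarrow> \<exists>W. (openin (space_top \<X>) W \<and> W \<subseteq> S) \<and> x \<in> W \<and> W \<subseteq> U \<and> regular \<X> W f"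
    show "regular \<X> U f"
    proof (rule reg_local)
      show "openin (space_top \<X>) U" using U by simp
      fix x assume "x \<in> U"
      from l[OF this] show "\<exists>W. openin (space_top \<X>) W \<and> x \<in> W \<and> W \<subseteq> U \<and> regular \<X> W f" by blast
    qed
  next
    fix U f g assume "openin (space_top \<X>) U \<and> U \<subseteq> S" "regular \<X> U f" "\<And>x. x \<in> U \<Longrightarrow> f x = g x"
    then show "regular \<X> U g" using reg_cong[of U f g] by simp
  next
    fix U f assume "openin (space_top \<X>) U \<and> U \<subseteq> S" "regular \<X> U f"
    then show "openin (space_top \<X>) {x \<in> U. f x \<noteq> 0} \<and> {x \<in> U. f x \<noteq> 0} \<subseteq> S"
      using reg_nonzero_open[of U f] by auto
  next
    fix U f assume "openin (space_top \<X>) U \<and> U \<subseteq> S" "regular \<X> U f" "\<And>x. x \<in> U \<Longrightarrow> f x \<noteq> 0"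
    then show "regular \<X> U (\<lambda>x. inverse (f x))" using reg_inverse[of U f] by simp
  next
    fix U W f assume "openin (space_top \<X>) U \<and> U \<subseteq> S" "regular \<X> U f" "openin (space_top \<X>) W \<and> W \<subseteq> S" "W \<subseteq> U"
    then show "regular \<X> W f" using reg_restrict[of U f W] by simp
  next
    fix U f g assume "openin (space_top \<X>) U \<and> U \<subseteq> S" "regular \<X> U f" "regular \<X> U g"
    then show "regular \<X> U (\<lambda>x. f x + g x)" "regular \<X> U (\<lambda>x. f x * g x)"
      using reg_add[of U f g] reg_mult[of U f g] by auto
  next
    fix U and c :: complex assume "openin (space_top \<X>) U \<and> U \<subseteq> S"
    then show "regular \<X> U (\<lambda>x. c)" using reg_const[of U c] by simp
  qed
qed

text \<open>Preimages under the orbit map commute with restriction, with passing to nonvanishing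
  sets and with the ring operations, so every axiom is inherited from \<open>\<X>\<close>.\<close>

lemma ringed_space_quotient:
  assumes "ringed_space \<X>"
  shows "ringed_space (quotient_space G act \<X>)"
proof -
  interpret ringed_space \<X> by fact
  define \<pi> where "\<pi> = orbit G act"
  define T where "T = space_top \<X>"
  define pre where "pre = (\<lambda>U. {x \<in> topspace T. \<pi> x \<in> U})"
  have o: "openin (space_top (quotient_space G act \<X>)) U \<longleftrightarrow> U \<subseteq> orbits G (topspace T) act \<and> openin T (pre U)" for U
    by (simp add: openin_quotient_space quotient_open_def pre_def T_def \<pi>_def)
  have r: "regular (quotient_space G act \<X>) U f = regular \<X> (pre U) (\<lambda>x. f (\<pi> x))" for U f
    by (simp add: quotient_space_def pre_def T_def \<pi>_def)
  have preD: "\<pi> x \<in> U" if "x \<in> pre U" for x U using that by (simp add: pre_def)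
  show ?thesis
  proof (unfold_locales; unfold o r)
    fix U f assume "U \<subseteq> orbits G (topspace T) act \<and> openin T (pre U)" and f: "regular \<X> (pre U) (\<lambda>x. f (\<pi> x))"
    then have "openin T {x \<in> pre U. f (\<pi> x) \<noteq> 0}" using reg_nonzero_open[of "pre U"] by (simp add: T_def)
    moreover have "{x \<in> pre U. f (\<pi> x) \<noteq> 0} = pre {x \<in> U. f x \<noteq> 0}" by (auto simp: pre_def)
    ultimately show "{x \<in> U. f x \<noteq> 0} \<subseteq> orbits G (topspace T) act \<and> openin T (pre {x \<in> U. f x \<noteq> 0})"
      using \<open>U \<subseteq> _ \<and> _\<close> by auto
  next
    fix U f assume U: "U \<subseteq> orbits G (topspace T) act \<and> openin T (pre U)"
      and l: "\<And>x. x \<in> U \<Longrightarrow> \<exists>W. (W \<subseteq> orbits G (topspace T) act \<and> openin T (pre W)) \<and> x \<in> W \<and> W \<subseteq> U \<and>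
          regular \<X> (pre W) (\<lambda>x. f (\<pi> x))"
    show "regular \<X> (pre U) (\<lambda>x. f (\<pi> x))"
    proof (rule reg_local)
      show "openin (space_top \<X>) (pre U)" using U by (simp add: T_def)
      fix x assume x: "x \<in> pre U"
      then obtain W where W: "openin T (pre W)" "\<pi> x \<in> W" "W \<subseteq> U" "regular \<X> (pre W) (\<lambda>x. f (\<pi> x))"
        using l[OF preD[OF x]] by blast
      then show "\<exists>W. openin (space_top \<X>) W \<and> x \<in> W \<and> W \<subseteq> pre U \<and> regular \<X> W (\<lambda>x. f (\<pi> x))"
        using x by (intro exI[of _ "pre W"]) (auto simp: pre_def T_def)
    qed
  next
    fix U W f assume "U \<subseteq> orbits G (topspace T) act \<and> openin T (pre U)" "regular \<X> (pre U) (\<lambda>x. f (\<pi> x))"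
      "W \<subseteq> orbits G (topspace T) act \<and> openin T (pre W)" "W \<subseteq> U"
    then show "regular \<X> (pre W) (\<lambda>x. f (\<pi> x))"
      using reg_restrict[of "pre U" "\<lambda>x. f (\<pi> x)" "pre W"] by (auto simp: T_def pre_def)
  next
    fix U f g assume "U \<subseteq> orbits G (topspace T) act \<and> openin T (pre U)" "regular \<X> (pre U) (\<lambda>x. f (\<pi> x))"
      "\<And>x. x \<in> U \<Longrightarrow> f x = g x"
    then show "regular \<X> (pre U) (\<lambda>x. g (\<pi> x))"
      using reg_cong[of "pre U" "\<lambda>x. f (\<pi> x)" "\<lambda>x. g (\<pi> x)"] preD by (simp add: T_def)
  next
    fix U f assume "U \<subseteq> orbits G (topspace T) act \<and> openin T (pre U)" "regular \<X> (pre U) (\<lambda>x. f (\<pi> x))"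
      "\<And>x. x \<in> U \<Longrightarrow> f x \<noteq> 0"
    then show "regular \<X> (pre U) (\<lambda>x. inverse (f (\<pi> x)))"
      using reg_inverse[of "pre U" "\<lambda>x. f (\<pi> x)"] preD by (simp add: T_def)
  next
    fix U f g assume "U \<subseteq> orbits G (topspace T) act \<and> openin T (pre U)" "regular \<X> (pre U) (\<lambda>x. f (\<pi> x))"
      "regular \<X> (pre U) (\<lambda>x. g (\<pi> x))"
    then show "regular \<X> (pre U) (\<lambda>x. f (\<pi> x) + g (\<pi> x))" "regular \<X> (pre U) (\<lambda>x. f (\<pi> x) * g (\<pi> x))"
      using reg_add[of "pre U"] reg_mult[of "pre U"] by (auto simp: T_def)
  next
    fix U and c :: complex assume "U \<subseteq> orbits G (topspace T) act \<and> openin T (pre U)"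
    then show "regular \<X> (pre U) (\<lambda>x. c)" using reg_const[of "pre U" c] by (auto simp: T_def)
  qed
qed

lemma space_top_proj_space: "space_top (proj_space m) = zariski m"
  using subtopology_topspace[of "zariski m"] by (simp add: proj_space_def proj_variety_def topspace_zariski)

text \<open>A form in the regular functions \<open>g i\<close> is regular. Hence preimages of
  principal open sets are open, and local quotients of forms pull back to quotients of regular
  functions.\<close>

lemma (in ringed_space) morphism_to_proj_space:
  assumes g: "\<And>i. i \<le> m \<Longrightarrow> regular \<X> (topspace (space_top \<X>)) (g i)"
    and nz: "\<And>x. x \<in> topspace (space_top \<X>) \<Longrightarrow> \<exists>i\<le>m. g i x \<noteq> 0"
    and V: "openin (zariski m) V" "\<And>x. x \<in> topspace (space_top \<X>) \<Longrightarrow> pt (vec (m + 1) (\<lambda>i. g i x)) \<in> V"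
  shows "morphism \<X> (open_subspace (proj_space m) V) (\<lambda>x. pt (vec (m + 1) (\<lambda>i. g i x)))"
proof -
  define T where "T = space_top \<X>"
  define w where "w = (\<lambda>x. vec (m + 1) (\<lambda>i. g i x))"
  have weq: "vec (m + 1) (\<lambda>i. g i x) = w x" for x by (simp add: w_def)
  have wc: "w x \<in> carrier_vec (m + 1)" for x by (simp add: w_def)
  have Tt: "openin T (topspace T)" by simp
  have H: "regular \<X> (topspace T) (\<lambda>x. H (w x))" if "hform m d H" for H d
    using reg_hform[OF that Tt[unfolded T_def]] g by (simp add: w_def T_def)
  have top: "space_top (open_subspace (proj_space m) V) = subtopology (zariski m) V"
    by (simp add: open_subspace_def space_top_proj_space)
  have pw: "pt (w x) \<in> proj_points m" if "x \<in> topspace T" for x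
    using V(2)[of x] openin_subset[OF V(1)] that by (auto simp: topspace_zariski T_def w_def)
  have op: "openin T {x \<in> topspace T. pt (w x) \<in> W}" if W: "openin (zariski m) W" for W
  proof (subst openin_subopen, intro ballI)
    fix x assume x: "x \<in> {x \<in> topspace T. pt (w x) \<in> W}"
    obtain d K where K: "hform m d K" "\<And>v. v \<in> pt (w x) \<Longrightarrow> K v \<noteq> 0"
      "{q \<in> proj_points m. \<forall>v\<in>q. K v \<noteq> 0} \<subseteq> W" using zariski_basis[OF W, of "pt (w x)"] x by blast
    have "openin T {y \<in> topspace T. K (w y) \<noteq> 0}" using reg_nonzero_open[OF Tt[unfolded T_def] H[OF K(1), unfolded T_def]] by (simp add: T_def)
    moreover have "x \<in> {y \<in> topspace T. K (w y) \<noteq> 0}" using x K(2) pt_self by auto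
    moreover have "{y \<in> topspace T. K (w y) \<noteq> 0} \<subseteq> {x \<in> topspace T. pt (w x) \<in> W}"
    proof
      fix y assume y: "y \<in> {y \<in> topspace T. K (w y) \<noteq> 0}"
      then have "\<forall>v\<in>pt (w y). K v \<noteq> 0" using hform_zero_pt[OF K(1) wc] by blast
      with pw y have "pt (w y) \<in> {q \<in> proj_points m. \<forall>v\<in>q. K v \<noteq> 0}" by simp
      then show "y \<in> {x \<in> topspace T. pt (w x) \<in> W}" using K(3) y by auto
    qed
    ultimately show "\<exists>T'. openin T T' \<and> x \<in> T' \<and> T' \<subseteq> {x \<in> topspace T. pt (w x) \<in> W}" by blast
  qed
  show ?thesis
    unfolding morphism_def top weq T_def[symmetric]
  proof (intro conjI allI impI)
    have "pt (w x) \<in> topspace (subtopology (zariski m) V)" if "x \<in> topspace T" for x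
      using pw V(2) that by (simp add: topspace_zariski T_def w_def)
    moreover have "openin T {x \<in> topspace T. pt (w x) \<in> W}" if "openin (subtopology (zariski m) V) W" for W
      using that openin_open_subtopology[OF V(1)] op by blast
    ultimately show "continuous_map T (subtopology (zariski m) V) (\<lambda>x. pt (w x))"
      unfolding continuous_map_def by auto
    fix W f
    assume a: "openin (subtopology (zariski m) V) W \<and> regular (open_subspace (proj_space m) V) W f"
    then have W: "openin (zariski m) W" "W \<subseteq> V" using openin_open_subtopology[OF V(1)] by auto
    have "regular (proj_space m) W f" using a by (simp add: open_subspace_def)
    then have f: "\<forall>p\<in>W. \<exists>W'. openin (zariski m) W' \<and> p \<in> W' \<and> W' \<subseteq> W \<and> quotient_on m W' f"
      using space_top_proj_space[of m] unfolding proj_space_def regular_proj_variety_iff by (simp add: proj_variety_def)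
    show "regular \<X> {x \<in> topspace T. pt (w x) \<in> W} (f \<circ> (\<lambda>x. pt (w x)))"
    proof (rule reg_local)
      show "openin (space_top \<X>) {x \<in> topspace T. pt (w x) \<in> W}" using op[OF W(1)] by (simp add: T_def)
      fix x assume x: "x \<in> {x \<in> topspace T. pt (w x) \<in> W}"
      then have "pt (w x) \<in> W" by simp
      with f obtain W' where W': "openin (zariski m) W'" "pt (w x) \<in> W'" "W' \<subseteq> W" "quotient_on m W' f" by blast
      obtain d F G where FG: "hform m d F" "hform m d G" "frac_on W' f F G" using W'(4) by (rule quotient_onE)
      define P where "P = {x \<in> topspace T. pt (w x) \<in> W'}"
      have P: "openin (space_top \<X>) P" using op[OF W'(1)] by (simp add: P_def T_def)
      have eq: "G (w y) \<noteq> 0" "f (pt (w y)) = F (w y) / G (w y)" if "y \<in> P" for y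
        using frac_onD[OF FG(3) _ pt_self] that by (auto simp: P_def)
      have sub: "P \<subseteq> topspace (space_top \<X>)" by (auto simp: P_def T_def)
      have rr: "regular \<X> P (\<lambda>y. K (w y))" if "hform m d K" for K
        by (rule reg_restrict[OF _ H[OF that, unfolded T_def] P sub]) simp
      have "regular \<X> P (\<lambda>y. F (w y) / G (w y))"
        by (rule reg_divide[OF P rr[OF FG(1)] rr[OF FG(2)]]) (rule eq(1))
      then have "regular \<X> P (f \<circ> (\<lambda>x. pt (w x)))"
        by (rule reg_cong[OF P]) (use eq in auto)
      moreover have "x \<in> P" "P \<subseteq> {x \<in> topspace T. pt (w x) \<in> W}" using x W'(2,3) by (auto simp: P_def)
      ultimately show "\<exists>P. openin (space_top \<X>) P \<and> x \<in> P \<and> P \<subseteq> {x \<in> topspace T. pt (w x) \<in> W} \<and>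
          regular \<X> P (f \<circ> (\<lambda>x. pt (w x)))" using P by blast
    qed
  qed
qed

lemma dense_open_proj_space:
  assumes "openin (zariski m) V" "V \<noteq> {}"
  shows "dense_open (proj_space m) V"
proof -
  have "W \<inter> V \<noteq> {}" if W: "openin (zariski m) W" "W \<noteq> {}" for W
  proof -
    obtain p q where p: "p \<in> W" and q: "q \<in> V" using W(2) assms(2) by blast
    obtain d H where H: "hform m d H" "\<And>v. v \<in> p \<Longrightarrow> H v \<noteq> 0" "{q \<in> proj_points m. \<forall>v\<in>q. H v \<noteq> 0} \<subseteq> W"
      using zariski_basis[OF W(1) p] by blast
    obtain e K where K: "hform m e K" "\<And>v. v \<in> q \<Longrightarrow> K v \<noteq> 0" "{q \<in> proj_points m. \<forall>v\<in>q. K v \<noteq> 0} \<subseteq> V"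
      using zariski_basis[OF assms(1) q] by blast
    have pq: "p \<in> proj_points m" "q \<in> proj_points m"
      using p q openin_subset[OF W(1)] openin_subset[OF assms(1)] by (auto simp: topspace_zariski)
    obtain v where v: "v \<in> carrier_vec (m + 1)" "v \<noteq> 0\<^sub>v (m + 1)" "p = pt v" using proj_points_cases[OF pq(1)] by blast
    obtain w where w: "w \<in> carrier_vec (m + 1)" "w \<noteq> 0\<^sub>v (m + 1)" "q = pt w" using proj_points_cases[OF pq(2)] by blast
    obtain i where i: "i < m + 1" "v $ i \<noteq> 0"
    proof (rule ccontr)
      assume "\<not> thesis"
      then have "v $ i = 0" if "i < m + 1" for i using that \<open>\<And>i. i < m + 1 \<Longrightarrow> v $ i \<noteq> 0 \<Longrightarrow> thesis\<close> by blast
      then have "v = 0\<^sub>v (m + 1)" using v(1) by (intro eq_vecI) auto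
      with v(2) show False by simp
    qed
    \<comment> \<open>The extra factor v $ i guarantees that the common point is a nonzero vector,
      even if \<open>H\<close> and \<open>K\<close> are constants.\<close>
    have h: "hform m (d + 1) (\<lambda>v. H v * v $ i)" by (rule hform_mult[OF H(1) hform_coord]) (use i in simp)
    have "H v \<noteq> 0" "K w \<noteq> 0" using H(2) K(2) v(3) w(3) pt_self by auto
    then obtain x where x: "x \<in> carrier_vec (m + 1)" "H x * x $ i \<noteq> 0" "K x \<noteq> 0"
      using hform_nonzero_common[OF h K(1) v(1) w(1)] i(2) by auto
    have "x \<noteq> 0\<^sub>v (m + 1)" using x(2) i(1) by auto
    then have "pt x \<in> proj_points m" using pt_in_proj_points x(1) by blast
    moreover have "\<forall>v\<in>pt x. H v \<noteq> 0" "\<forall>v\<in>pt x. K v \<noteq> 0"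
      using hform_zero_pt[OF H(1) x(1)] hform_zero_pt[OF K(1) x(1)] x(2,3) by auto
    ultimately show ?thesis using H(3) K(3) by blast
  qed
  then show ?thesis
    unfolding dense_open_def space_top_proj_space dense_intersects_open using assms(1) by blast
qed

section \<open>The cyclic group in the projective linear group\<close>

lemma GL_simps:
  "carrier (GL n) = Units (ring_mat TYPE(complex) n ())" "mult (GL n) = (*)" "one (GL n) = 1\<^sub>m n"
  by (auto simp: GL_def units_of_carrier units_of_mult units_of_one ring_mat_simps)

lemma group_GL: "group (GL n)"
proof -
  interpret ring "ring_mat TYPE(complex) n ()" by (rule ring_mat)
  show ?thesis unfolding GL_def by (rule units_group)
qed

lemma GL_I:
  assumes "A \<in> carrier_mat n n" "B \<in> carrier_mat n n" "A * B = 1\<^sub>m n" "B * A = 1\<^sub>m n"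
  shows "A \<in> carrier (GL n)"
  using assms by (auto simp: GL_simps Units_def ring_mat_simps)

lemma GL_carrier_mat: "A \<in> carrier (GL n) \<Longrightarrow> A \<in> carrier_mat n n"
  by (auto simp: GL_simps Units_def ring_mat_simps)

lemma scalar_mat_mult_left:
  fixes A :: "complex mat"
  assumes "A \<in> carrier_mat n n" shows "(c \<cdot>\<^sub>m 1\<^sub>m n) * A = c \<cdot>\<^sub>m A"
  using assms by (subst mult_smult_assoc_mat[of _ n n _ n]) auto

lemma scalar_mat_mult_right:
  fixes A :: "complex mat"
  assumes "A \<in> carrier_mat n n" shows "A * (c \<cdot>\<^sub>m 1\<^sub>m n) = c \<cdot>\<^sub>m A"
  using assms by (subst mult_smult_distrib[of _ n n _ n]) auto

lemma smult_smult_mat: "a \<cdot>\<^sub>m (b \<cdot>\<^sub>m (A :: complex mat)) = (a * b) \<cdot>\<^sub>m A"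
  by (intro eq_matI) auto

lemma scalar_mats_normal: "scalar_mats n \<lhd> GL n"
proof -
  interpret group "GL n" by (rule group_GL)
  have inv_mult: "(c \<cdot>\<^sub>m 1\<^sub>m n) * (inverse c \<cdot>\<^sub>m 1\<^sub>m n) = 1\<^sub>m n" if "c \<noteq> 0" for c :: complex
    using that by (subst scalar_mat_mult_left) (auto simp: smult_smult_mat intro!: eq_matI)
  have sub: "c \<cdot>\<^sub>m 1\<^sub>m n \<in> carrier (GL n)" if "c \<noteq> 0" for c
    by (rule GL_I[of _ _ "inverse c \<cdot>\<^sub>m 1\<^sub>m n"])
       (use inv_mult[OF that] inv_mult[of "inverse c"] that in auto)
  have "subgroup (scalar_mats n) (GL n)"
  proof (rule subgroupI)
    show "scalar_mats n \<subseteq> carrier (GL n)" using sub by (auto simp: scalar_mats_def)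
    have "1 \<cdot>\<^sub>m 1\<^sub>m n \<in> scalar_mats n" 
      unfolding scalar_mats_def by (rule CollectI, rule exI[of _ 1]) simp
    then show "scalar_mats n \<noteq> {}" by auto
    fix A assume "A \<in> scalar_mats n"
    then obtain a where a: "a \<noteq> 0" "A = a \<cdot>\<^sub>m 1\<^sub>m n" by (auto simp: scalar_mats_def)
    have "inv\<^bsub>GL n\<^esub> A = inverse a \<cdot>\<^sub>m 1\<^sub>m n"
      using inv_mult[of "inverse a"] a sub
      by (intro inv_equality) (auto simp: GL_simps(2,3))
    then show "inv\<^bsub>GL n\<^esub> A \<in> scalar_mats n" 
      unfolding scalar_mats_def by (intro CollectI exI[of _ "inverse a"]) (use a(1) in simp)
    fix B assume "B \<in> scalar_mats n"
    then obtain b where b: "b \<noteq> 0" "B = b \<cdot>\<^sub>m 1\<^sub>m n" by (auto simp: scalar_mats_def)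
    have "A * B = (a * b) \<cdot>\<^sub>m 1\<^sub>m n" unfolding a b
      by (subst scalar_mat_mult_left) (auto simp: smult_smult_mat)
    then show "A \<otimes>\<^bsub>GL n\<^esub> B \<in> scalar_mats n" 
      unfolding scalar_mats_def GL_simps(2) by (intro CollectI exI[of _ "a * b"]) (use a(1) b(1) in simp)
  qed
  moreover have "scalar_mats n #>\<^bsub>GL n\<^esub> A = A <#\<^bsub>GL n\<^esub> scalar_mats n" if "A \<in> carrier (GL n)" for A
    unfolding r_coset_def l_coset_def GL_simps(2) scalar_mats_def
    using scalar_mat_mult_left[OF GL_carrier_mat[OF that]] scalar_mat_mult_right[OF GL_carrier_mat[OF that]] by auto
  ultimately show ?thesis by (intro normalI) auto
qed

lemma pgl_class_eq:
  assumes "A \<in> carrier_mat n n" shows "pgl_class n A = {c \<cdot>\<^sub>m A | c. c \<noteq> 0}"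
  unfolding pgl_class_def r_coset_def GL_simps(2) scalar_mats_def
  using scalar_mat_mult_left[OF assms] by auto

lemma PGL_simps:
  "carrier (PGL n) = pgl_class n ` carrier (GL n)" "one (PGL n) = pgl_class n (1\<^sub>m n)"
proof -
  interpret group "GL n" by (rule group_GL)
  interpret N: normal "scalar_mats n" "GL n" by (rule scalar_mats_normal)
  show "carrier (PGL n) = pgl_class n ` carrier (GL n)"
    by (auto simp: PGL_def FactGroup_def RCOSETS_def pgl_class_def)
  have "scalar_mats n #>\<^bsub>GL n\<^esub> \<one>\<^bsub>GL n\<^esub> = scalar_mats n"
    using N.subset coset_mult_one by blast
  then show "one (PGL n) = pgl_class n (1\<^sub>m n)"
    by (simp add: PGL_def FactGroup_def pgl_class_def GL_simps(3))
qed

lemma group_PGL: "group (PGL n)"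
  unfolding PGL_def by (rule normal.factorgroup_is_group[OF scalar_mats_normal])

lemma PGL_mult:
  assumes "A \<in> carrier (GL n)" "B \<in> carrier (GL n)"
  shows "pgl_class n A \<otimes>\<^bsub>PGL n\<^esub> pgl_class n B = pgl_class n (A * B)"
  using normal.rcos_sum[OF scalar_mats_normal assms]
  by (simp add: PGL_def FactGroup_def pgl_class_def GL_simps(2))

section \<open>The generator, its powers and its orbits\<close>

definition dg_mat :: "complex \<Rightarrow> nat \<Rightarrow> complex mat" where
  "dg_mat \<xi> k = mat_diag 5 (\<lambda>i. \<xi> ^ (k * weight i))"

lemma dg_mat_carrier: "dg_mat \<xi> k \<in> carrier_mat 5 5"
  by (simp add: dg_mat_def)

lemma dg_mat_mult: "dg_mat \<xi> k * dg_mat \<xi> l = dg_mat \<xi> (k + l)"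
  by (simp add: dg_mat_def algebra_simps flip: power_add)

lemma dg_mat_3: assumes "\<xi> ^ 3 = 1" shows "dg_mat \<xi> (3 * k) = 1\<^sub>m 5"
proof -
  have "\<xi> ^ (3 * k * j) = 1" for j using assms by (simp add: power_mult)
  then show ?thesis by (simp add: dg_mat_def)
qed

lemma dg_mat_GL:
  assumes "\<xi> ^ 3 = 1" shows "dg_mat \<xi> k \<in> carrier (GL 5)"
  by (rule GL_I[of _ _ "dg_mat \<xi> (2 * k)"])
     (use dg_mat_3[OF assms, of k] in \<open>auto simp: dg_mat_carrier dg_mat_mult\<close>)

text \<open>The generated group consists of integer powers; as the cube is trivial, an exponent may
  be replaced by its remainder mod 3, which is natural.\<close>

lemma carrier_G1:
  assumes \<xi>: "\<xi> ^ 3 = 1"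
  shows "carrier (G\<^sub>1 \<xi>) = range (\<lambda>k. pgl_class 5 (dg_mat \<xi> k))"
proof -
  interpret group "PGL 5" by (rule group_PGL)
  define x where "x = pgl_class 5 (dg_mat \<xi> 1)"
  have x: "x \<in> carrier (PGL 5)" using dg_mat_GL[OF \<xi>] by (auto simp: x_def PGL_simps)
  have "mat_diag 5 (\<lambda>i. [1, \<xi>, \<xi>\<^sup>2, \<xi>\<^sup>2, 1] ! i) = dg_mat \<xi> 1"
    unfolding dg_mat_def mat_diag_def
    by (intro eq_matI) (auto simp: weight_def less_Suc_eq numeral_nat power2_eq_square)
  then have G: "carrier (G\<^sub>1 \<xi>) = range (\<lambda>n::int. x [^]\<^bsub>PGL 5\<^esub> n)"
    using carrier_subgroup_generated_by_singleton[OF x] by (simp add: G\<^sub>1_def x_def)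
  have pow: "x [^]\<^bsub>PGL 5\<^esub> k = pgl_class 5 (dg_mat \<xi> k)" for k :: nat
  proof (induction k)
    case 0 show ?case using dg_mat_3[OF \<xi>, of 0] by (simp add: PGL_simps)
  next
    case (Suc k)
    then show ?case using PGL_mult[OF dg_mat_GL[OF \<xi>] dg_mat_GL[OF \<xi>], of k 1]
      by (simp add: x_def dg_mat_mult)
  qed
  have "x [^]\<^bsub>PGL 5\<^esub> (3 :: nat) = \<one>\<^bsub>PGL 5\<^esub>"
    using dg_mat_3[OF \<xi>, of 1] by (simp add: pow PGL_simps)
  then have 3: "x [^]\<^bsub>PGL 5\<^esub> (3 :: int) = \<one>\<^bsub>PGL 5\<^esub>"
    using int_pow_int[of "PGL 5" x 3] by simp
  have ex: "\<exists>k::nat. x [^]\<^bsub>PGL 5\<^esub> n = x [^]\<^bsub>PGL 5\<^esub> k" for n :: int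
  proof -
    have "x [^]\<^bsub>PGL 5\<^esub> n = x [^]\<^bsub>PGL 5\<^esub> (3 * (n div 3) + n mod 3)" by simp
    also have "\<dots> = x [^]\<^bsub>PGL 5\<^esub> (3 * (n div 3)) \<otimes>\<^bsub>PGL 5\<^esub> x [^]\<^bsub>PGL 5\<^esub> (n mod 3)"
      by (rule int_pow_mult[OF x])
    also have "x [^]\<^bsub>PGL 5\<^esub> (3 * (n div 3)) = \<one>\<^bsub>PGL 5\<^esub>"
      using int_pow_pow[OF x, of 3 "n div 3"] by (simp add: 3 int_pow_one)
    also have "\<one>\<^bsub>PGL 5\<^esub> \<otimes>\<^bsub>PGL 5\<^esub> x [^]\<^bsub>PGL 5\<^esub> (n mod 3) = x [^]\<^bsub>PGL 5\<^esub> (n mod 3)"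
      by (rule l_one[OF int_pow_closed[OF x]])
    also have "n mod 3 = int (nat (n mod 3))" by simp
    finally show ?thesis unfolding int_pow_int by blast
  qed
  have "range (\<lambda>n::int. x [^]\<^bsub>PGL 5\<^esub> n) \<subseteq> range (\<lambda>k::nat. x [^]\<^bsub>PGL 5\<^esub> k)"
  proof (rule image_subsetI)
    fix n :: int
    from ex[of n] obtain k :: nat where "x [^]\<^bsub>PGL 5\<^esub> n = x [^]\<^bsub>PGL 5\<^esub> k" ..
    then show "x [^]\<^bsub>PGL 5\<^esub> n \<in> range (\<lambda>k::nat. x [^]\<^bsub>PGL 5\<^esub> k)" by (rule range_eqI)
  qed
  moreover have "range (\<lambda>k::nat. x [^]\<^bsub>PGL 5\<^esub> k) \<subseteq> range (\<lambda>n::int. x [^]\<^bsub>PGL 5\<^esub> n)"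
  proof (rule image_subsetI)
    fix k :: nat
    have "x [^]\<^bsub>PGL 5\<^esub> k = x [^]\<^bsub>PGL 5\<^esub> int k" by (rule int_pow_int[symmetric])
    then show "x [^]\<^bsub>PGL 5\<^esub> k \<in> range (\<lambda>n::int. x [^]\<^bsub>PGL 5\<^esub> n)" by (rule range_eqI)
  qed
  ultimately show ?thesis unfolding G pow by blast
qed

lemma dg_mat_mult_vec:
  assumes "v \<in> carrier_vec 5" shows "dg_mat \<xi> k *\<^sub>v v = dg \<xi> k v"
proof (rule eq_vecI)
  fix i assume "i < dim_vec (dg \<xi> k v)"
  then have i: "i < 5" by (simp add: dg_def)
  then have "(dg_mat \<xi> k *\<^sub>v v) $ i = (\<Sum>j = 0..<5. (if i = j then \<xi> ^ (k * weight j) else 0) * v $ j)"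
    using assms by (auto simp: dg_mat_def mat_diag_def scalar_prod_def)
  also have "\<dots> = (\<Sum>j = 0..<5. if i = j then \<xi> ^ (k * weight j) * v $ j else 0)"
    by (rule sum.cong) auto
  also have "\<dots> = dg \<xi> k v $ i" using i by simp
  finally show "(dg_mat \<xi> k *\<^sub>v v) $ i = dg \<xi> k v $ i" .
qed (simp add: dg_mat_def mat_diag_def dg_def)

lemma smult_mat_mult_vec:
  fixes A :: "complex mat"
  assumes "A \<in> carrier_mat n n" "v \<in> carrier_vec n"
  shows "(a \<cdot>\<^sub>m A) *\<^sub>v (b \<cdot>\<^sub>v v) = (a * b) \<cdot>\<^sub>v (A *\<^sub>v v)"
  using assms by (intro eq_vecI) (auto simp: scalar_prod_def sum_distrib_left mult_ac)

lemma pgl_act_pt: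
  assumes "v \<in> carrier_vec 5"
  shows "pgl_act (pgl_class 5 (dg_mat \<xi> k)) (pt v) = pt (dg \<xi> k v)"
proof -
  have eq: "(a \<cdot>\<^sub>m dg_mat \<xi> k) *\<^sub>v (b \<cdot>\<^sub>v v) = (a * b) \<cdot>\<^sub>v dg \<xi> k v" for a b
    using smult_mat_mult_vec[OF dg_mat_carrier assms] dg_mat_mult_vec[OF assms] by simp
  show ?thesis
  proof
    show "pgl_act (pgl_class 5 (dg_mat \<xi> k)) (pt v) \<subseteq> pt (dg \<xi> k v)"
    proof
      fix w assume "w \<in> pgl_act (pgl_class 5 (dg_mat \<xi> k)) (pt v)"
      then obtain a b where "a \<noteq> 0" "b \<noteq> 0" "w = (a \<cdot>\<^sub>m dg_mat \<xi> k) *\<^sub>v (b \<cdot>\<^sub>v v)"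
        by (auto simp: pgl_act_def pgl_class_eq[OF dg_mat_carrier] pt_def)
      then show "w \<in> pt (dg \<xi> k v)"
        unfolding eq pt_def by (intro CollectI exI[of _ "a * b"]) simp
    qed
    show "pt (dg \<xi> k v) \<subseteq> pgl_act (pgl_class 5 (dg_mat \<xi> k)) (pt v)"
    proof
      fix w assume "w \<in> pt (dg \<xi> k v)"
      then obtain c where c: "c \<noteq> 0" "w = (c * 1) \<cdot>\<^sub>v dg \<xi> k v" by (auto simp: pt_def)
      then have "w = (c \<cdot>\<^sub>m dg_mat \<xi> k) *\<^sub>v (1 \<cdot>\<^sub>v v)" unfolding eq by simp
      moreover have "c \<cdot>\<^sub>m dg_mat \<xi> k \<in> pgl_class 5 (dg_mat \<xi> k)"
        unfolding pgl_class_eq[OF dg_mat_carrier] by (intro CollectI exI[of _ c]) (use c(1) in simp)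
      moreover have "1 \<cdot>\<^sub>v v \<in> pt v" unfolding pt_def by (intro CollectI exI[of _ 1]) simp
      ultimately show "w \<in> pgl_act (pgl_class 5 (dg_mat \<xi> k)) (pt v)"
        unfolding pgl_act_def by (intro CollectI exI conjI)
    qed
  qed
qed

lemma orbit_G1_pt:
  assumes "\<xi> ^ 3 = 1" "v \<in> carrier_vec 5"
  shows "orbit (G\<^sub>1 \<xi>) pgl_act (pt v) = range (\<lambda>k. pt (dg \<xi> k v))"
  unfolding orbit_def carrier_G1[OF assms(1)] using pgl_act_pt[OF assms(2)] by auto

text \<open>\<open>dg \<xi> (2 * k)\<close> inverts \<open>dg \<xi> k\<close>, since together the
  exponents are multiples of 3.\<close>

lemma orbit_G1_dg:
  assumes "\<xi> ^ 3 = 1" "v \<in> carrier_vec 5"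
  shows "orbit (G\<^sub>1 \<xi>) pgl_act (pt (dg \<xi> k v)) = orbit (G\<^sub>1 \<xi>) pgl_act (pt v)"
proof -
  have "dg \<xi> (2 * k) (dg \<xi> k v) = v" 
  proof (rule eq_vecI)
    have *: "\<xi> ^ (3 * j) = 1" for j using assms(1) by (simp add: power_mult)
    fix i assume "i < dim_vec v"
    then have i: "i < 5" using assms(2) by simp
    have "\<xi> ^ (2 * k * weight i) * \<xi> ^ (k * weight i) = \<xi> ^ (3 * (k * weight i))"
      by (simp flip: power_add)
    then have "\<xi> ^ (2 * k * weight i) * \<xi> ^ (k * weight i) = 1" unfolding * .
    then show "dg \<xi> (2 * k) (dg \<xi> k v) $ i = v $ i" using i by (simp flip: mult.assoc)
  qed (use assms(2) in \<open>simp add: dg_def\<close>)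
  then have "pt (dg \<xi> l v) = pt (dg \<xi> (l + 2 * k) (dg \<xi> k v))" for l by (simp add: dg_add)
  moreover have "pt (dg \<xi> l (dg \<xi> k v)) = pt (dg \<xi> (l + k) v)" for l by (simp add: dg_add)
  ultimately show ?thesis
    unfolding orbit_G1_pt[OF assms] orbit_G1_pt[OF assms(1) dg_carrier] by blast
qed

section \<open>The dense set of good points\<close>

lemma hform_degree_eq: "hform n d f \<Longrightarrow> d = e \<Longrightarrow> hform n e f"
  by simp

lemma regular_proj_variety_quotient:
  assumes "openin (subtopology (zariski n) X) U" "hform n d F" "hform n d G"
    "\<And>p v. p \<in> U \<Longrightarrow> v \<in> p \<Longrightarrow> G v \<noteq> 0 \<and> f p = F v / G v"
  shows "regular (proj_variety n X) U f"
  unfolding regular_proj_variety_iff using assms(1) quotient_onI[OF assms(2,3), of U f] assms(4)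
  by (intro ballI exI[of _ U]) simp

text \<open>The product of the three roots is -f, so they cannot all be larger in norm than the cube
  root of |f|. This yields a root that tends to 0 with f.\<close>

lemma monic_cubic_small_root:
  fixes b c f :: complex
  obtains r where "r ^ 3 + b * r ^ 2 + c * r + f = 0" "norm r ^ 3 \<le> norm f"
proof -
  obtain r s t where rst: "\<And>u. 1 * u ^ 3 + b * u ^ 2 + c * u + f = 1 * (u - r) * (u - s) * (u - t)"
    using cubic_factorization[of 1 b c f] by auto
  have "f = - (r * s * t)" using rst[of 0] by simp
  then have f: "norm f = norm r * norm s * norm t" by (simp add: norm_mult)
  have "\<exists>x\<in>{r, s, t}. norm x ^ 3 \<le> norm f"
  proof (rule ccontr)
    assume "\<not> ?thesis"
    then have *: "norm f < norm r ^ 3" "norm f < norm s ^ 3" "norm f < norm t ^ 3" by auto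
    then have "0 < norm r ^ 3" "0 < norm s ^ 3" using order.strict_trans1[OF norm_ge_zero] by blast+
    then have "norm f * norm f * norm f < norm r ^ 3 * norm s ^ 3 * norm t ^ 3"
      by (intro mult_strict_mono * mult_pos_pos mult_nonneg_nonneg norm_ge_zero)
    also have "\<dots> = norm f * norm f * norm f" unfolding f by (simp add: power3_eq_cube)
    finally show False by simp
  qed
  then obtain x where "x \<in> {r, s, t}" "norm x ^ 3 \<le> norm f" by blast
  with that[of x] rst[of x] show thesis by auto
qed

text \<open>
  Continuity of the roots of a monic cubic: a zero of \<open>E\<close> is a limit of zeros lying over points
  of any line that projects onto the hyperplane complementary to \<open>p\<close>.
\<close>

lemma hypersurface_zero_near:
  assumes E: "hform n 3 E" "p \<in> carrier_vec (n + 1)" "E p = 1"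
    and H: "hform n e H" and v: "v \<in> carrier_vec (n + 1)" "E v = 0" "H v \<noteq> 0"
    and d: "d \<in> carrier_vec (n + 1)" and B: "finite B"
  obtains t r where "t \<notin> B" "E (v + t \<cdot>\<^sub>v d + r \<cdot>\<^sub>v p) = 0" "H (v + t \<cdot>\<^sub>v d + r \<cdot>\<^sub>v p) \<noteq> 0"
proof (rule ccontr)
  assume "\<not> thesis"
  with that have no: "H (v + t \<cdot>\<^sub>v d + r \<cdot>\<^sub>v p) = 0" if "t \<notin> B" "E (v + t \<cdot>\<^sub>v d + r \<cdot>\<^sub>v p) = 0" for t r
    using that by blast
  have yc: "v + t \<cdot>\<^sub>v d \<in> carrier_vec (n + 1)" for t using v(1) d by simp
  have v0: "v + 0 \<cdot>\<^sub>v d = v" using v(1) d by (intro eq_vecI) auto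
  obtain b c where "hform n 1 b" "hform n 2 c"
    and bc: "\<And>x u. x \<in> carrier_vec (n + 1) \<Longrightarrow> E (x + u \<cdot>\<^sub>v p) = E p * u ^ 3 + b x * u ^ 2 + c x * u + E x"
    using hform_cubic_expand[OF E(1,2)] by blast
  \<comment> \<open>\<open>E\<close> is monic in the direction \<open>p\<close>, so over every t
    there is a root whose cube is bounded by E(v + t d), and this tends to E v = 0.\<close>
  have "\<exists>r. E (v + t \<cdot>\<^sub>v d + r \<cdot>\<^sub>v p) = 0 \<and> norm r ^ 3 \<le> norm (E (v + t \<cdot>\<^sub>v d))" for t
  proof -
    obtain r where "r ^ 3 + b (v + t \<cdot>\<^sub>v d) * r ^ 2 + c (v + t \<cdot>\<^sub>v d) * r + E (v + t \<cdot>\<^sub>v d) = 0"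
      "norm r ^ 3 \<le> norm (E (v + t \<cdot>\<^sub>v d))" using monic_cubic_small_root by blast
    then show ?thesis using bc[OF yc] E(3) by (intro exI[of _ r]) simp
  qed
  then obtain r where r: "\<And>t. E (v + t \<cdot>\<^sub>v d + r t \<cdot>\<^sub>v p) = 0" "\<And>t. norm (r t) ^ 3 \<le> norm (E (v + t \<cdot>\<^sub>v d))" by metis
  have cont: "((\<lambda>t. f (v + t \<cdot>\<^sub>v d)) \<longlongrightarrow> f v) (at 0)" if hf: "hform n k f" for f k
  proof -
    obtain P where P: "\<And>t. poly P t = f (v + t \<cdot>\<^sub>v d)" using hform_line[OF hf v(1) d] by blast
    have isCont_poly0: "isCont (poly P) 0" by simp
    then have "(poly P \<longlongrightarrow> poly P 0) (at 0)" by (simp add: isCont_def)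
    moreover have "poly P = (\<lambda>t. f (v + t \<cdot>\<^sub>v d))" by (rule ext) (rule P)
    ultimately show ?thesis by (simp only: v0)
  qed
  have "((\<lambda>t. norm (E (v + t \<cdot>\<^sub>v d))) \<longlongrightarrow> 0) (at 0)"
    using tendsto_norm[OF cont[OF E(1)]] v(2) by simp
  then have "((\<lambda>t. norm (r t) ^ 3) \<longlongrightarrow> 0) (at 0)"
    by (rule tendsto_sandwich[OF _ _ tendsto_const, rotated 2]) (use r(2) in auto)
  then have "((\<lambda>t. root 3 (norm (r t) ^ 3)) \<longlongrightarrow> root 3 0) (at 0)" by (rule tendsto_real_root)
  then have "((\<lambda>t. norm (r t)) \<longlongrightarrow> 0) (at 0)" by (simp add: real_root_power_cancel)
  then have rlim: "(r \<longlongrightarrow> 0) (at 0)" by (rule tendsto_norm_zero_cancel)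
  \<comment> \<open>About \<open>r\<close> only the limit 0 is known; expanding \<open>H\<close> in
    powers of it leaves limits of forms along a line.\<close>
  obtain h where h: "\<And>j. j \<le> e \<Longrightarrow> hform n (e - j) (h j)"
    "\<And>x u. x \<in> carrier_vec (n + 1) \<Longrightarrow> H (x + u \<cdot>\<^sub>v p) = (\<Sum>j\<le>e. h j x * u ^ j)"
    using hform_shift_expand[OF H E(2)] by blast
  have "((\<lambda>t. \<Sum>j\<le>e. h j (v + t \<cdot>\<^sub>v d) * r t ^ j) \<longlongrightarrow> (\<Sum>j\<le>e. h j v * 0 ^ j)) (at 0)"
    by (intro tendsto_sum tendsto_mult tendsto_power rlim) (use cont[OF h(1)] in auto)
  moreover have "(\<Sum>j\<le>e. h j v * 0 ^ j) = H v"
  proof -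
    have "v + 0 \<cdot>\<^sub>v p = v" using v(1) E(2) by (intro eq_vecI) auto
    then show ?thesis using h(2)[OF v(1), of 0] by simp
  qed
  ultimately have lim: "((\<lambda>t. H (v + t \<cdot>\<^sub>v d + r t \<cdot>\<^sub>v p)) \<longlongrightarrow> H v) (at 0)"
    by (simp only: h(2)[OF yc])
  \<comment> \<open>Close to 0 only the parameter 0 itself can lie in \<open>B\<close>, and a limit
    at 0 disregards it.\<close>
  have "open (- (B - {0}))" using B by (intro open_Compl finite_imp_closed) simp
  then have "eventually (\<lambda>t. t \<in> - (B - {0})) (nhds 0)" by (rule eventually_nhds_in_open) simp
  then have "eventually (\<lambda>t. H (v + t \<cdot>\<^sub>v d + r t \<cdot>\<^sub>v p) = 0) (at 0)"
    unfolding eventually_at_filter by (rule eventually_mono) (use no r(1) in auto)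
  then have "((\<lambda>t. H (v + t \<cdot>\<^sub>v d + r t \<cdot>\<^sub>v p)) \<longlongrightarrow> 0) (at 0)" by (rule tendsto_eventually)
  then show False using LIM_unique[OF lim] v(3) by blast
qed

text \<open>From here on smoothness enters only through the shape of the normal form, the two
  determinants and \<open>h12\<close>.\<close>

locale normal_cubic =
  fixes \<xi> l0 l1 m0 m1 s2 s3 t2 t3 f1 f2 h1 h2 b00 b10 b01 b11 :: complex
  assumes prim: "primitive_root_of_unity 3 \<xi>"
    and det_ab: "l0 * m1 - l1 * m0 \<noteq> 0"
    and det_st: "s2 * t3 - s3 * t2 \<noteq> 0"
    and h12: "h1 \<noteq> 0 \<or> h2 \<noteq> 0"
begin

definition la :: "complex vec \<Rightarrow> complex" where "la v = l0 * v $ 0 + l1 * v $ 4"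
definition lb :: "complex vec \<Rightarrow> complex" where "lb v = m0 * v $ 0 + m1 * v $ 4"
definition ls :: "complex vec \<Rightarrow> complex" where "ls v = s2 * v $ 2 + s3 * v $ 3"
definition lt :: "complex vec \<Rightarrow> complex" where "lt v = t2 * v $ 2 + t3 * v $ 3"

definition equation :: "complex \<Rightarrow> complex \<Rightarrow> complex \<Rightarrow> complex \<Rightarrow> complex \<Rightarrow> complex" where
  "equation a b u s t = a * b * (f1 * a + f2 * b) + u ^ 3
     + u * (b00 * a * s + b10 * b * s + b01 * a * t + b11 * b * t) + s * t * (h1 * s + h2 * t)"

definition eqn :: "complex vec \<Rightarrow> complex" where
  "eqn v = equation (la v) (lb v) (v $ 1) (ls v) (lt v)"

definition X :: "ppoint set" where
  "X = {p \<in> proj_points 4. \<forall>v\<in>p. eqn v = 0}"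

text \<open>Equals \<open>bsu \<cdot> dnm\<close> for the denominator \<open>dnm\<close> of the parametrisation defined below.\<close>

definition den :: "complex vec \<Rightarrow> complex" where
  "den v = v $ 1 ^ 3 + v $ 1 * (lb v * (b10 * ls v + b11 * lt v)) + f2 * (la v * lb v ^ 2)"

text \<open>The linear factors make \<alpha>, \<beta>, z defined and nonzero. On X,
  \<open>den\<close> agrees up to sign and nonzero monomials with both \<open>dnm\<close> and
  \<open>num\<close>, so \<open>den\<close> \<noteq> 0 permits solving for y = b/a and gives y
  \<noteq> 0.\<close>

definition good :: "complex vec \<Rightarrow> complex" where
  "good v = la v * lb v * v $ 1 * ls v * lt v * den v"

definition Xg :: "ppoint set" where
  "Xg = {p \<in> X. \<forall>v\<in>p. good v \<noteq> 0}"

text \<open>The inverse of the linear change of coordinates to (la v, lb v, v $ 1, ls v, lt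
  v).\<close>

definition mk :: "complex \<Rightarrow> complex \<Rightarrow> complex \<Rightarrow> complex \<Rightarrow> complex \<Rightarrow> complex vec" where
  "mk a b u s t = vec5 ((m1 * a - l1 * b) / (l0 * m1 - l1 * m0)) u
     ((t3 * s - s3 * t) / (s2 * t3 - s3 * t2)) ((s2 * t - t2 * s) / (s2 * t3 - s3 * t2))
     ((l0 * b - m0 * a) / (l0 * m1 - l1 * m0))"

lemma mk_simps [simp]:
  "mk a b u s t \<in> carrier_vec 5" "la (mk a b u s t) = a" "lb (mk a b u s t) = b" "mk a b u s t $ 1 = u"
  "mk a b u s t $ Suc 0 = u" "ls (mk a b u s t) = s" "lt (mk a b u s t) = t"
proof -
  define d e where "d = l0 * m1 - l1 * m0" and "e = s2 * t3 - s3 * t2"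
  have de: "d \<noteq> 0" "e \<noteq> 0" using det_ab det_st by (auto simp: d_def e_def)
  have "la (mk a b u s t) = (l0 * (m1 * a - l1 * b) + l1 * (l0 * b - m0 * a)) / d"
    by (simp add: mk_def la_def d_def[symmetric] add_divide_distrib)
  also have "l0 * (m1 * a - l1 * b) + l1 * (l0 * b - m0 * a) = a * d" by (simp add: d_def algebra_simps)
  finally show "la (mk a b u s t) = a" using de by simp
  have "lb (mk a b u s t) = (m0 * (m1 * a - l1 * b) + m1 * (l0 * b - m0 * a)) / d"
    by (simp add: mk_def lb_def d_def[symmetric] add_divide_distrib)
  also have "m0 * (m1 * a - l1 * b) + m1 * (l0 * b - m0 * a) = b * d" by (simp add: d_def algebra_simps)
  finally show "lb (mk a b u s t) = b" using de by simp
  have "ls (mk a b u s t) = (s2 * (t3 * s - s3 * t) + s3 * (s2 * t - t2 * s)) / e"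
    by (simp add: mk_def ls_def e_def[symmetric] add_divide_distrib)
  also have "s2 * (t3 * s - s3 * t) + s3 * (s2 * t - t2 * s) = s * e" by (simp add: e_def algebra_simps)
  finally show "ls (mk a b u s t) = s" using de by simp
  have "lt (mk a b u s t) = (t2 * (t3 * s - s3 * t) + t3 * (s2 * t - t2 * s)) / e"
    by (simp add: mk_def lt_def e_def[symmetric] add_divide_distrib)
  also have "t2 * (t3 * s - s3 * t) + t3 * (s2 * t - t2 * s) = t * e" by (simp add: e_def algebra_simps)
  finally show "lt (mk a b u s t) = t" using de by simp
qed (auto simp: mk_def)

lemma mk_coords:
  assumes "v \<in> carrier_vec 5" shows "mk (la v) (lb v) (v $ 1) (ls v) (lt v) = v"
proof -
  define d e where "d = l0 * m1 - l1 * m0" and "e = s2 * t3 - s3 * t2"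
  have de: "d \<noteq> 0" "e \<noteq> 0" using det_ab det_st by (auto simp: d_def e_def)
  have "m1 * la v - l1 * lb v = d * v $ 0" "l0 * lb v - m0 * la v = d * v $ 4"
    "t3 * ls v - s3 * lt v = e * v $ 2" "s2 * lt v - t2 * ls v = e * v $ 3"
    by (simp_all add: la_def lb_def ls_def lt_def d_def e_def algebra_simps)
  then have m: "mk (la v) (lb v) (v $ 1) (ls v) (lt v) = vec5 (v $ 0) (v $ 1) (v $ 2) (v $ 3) (v $ 4)"
    unfolding mk_def d_def[symmetric] e_def[symmetric] using de by simp
  show ?thesis unfolding m
  proof (rule eq_vecI)
    fix i assume "i < dim_vec v"
    then have "i \<le> 4" using assms by simp
    then show "vec5 (v $ 0) (v $ 1) (v $ 2) (v $ 3) (v $ 4) $ i = v $ i" using nat_le_4_cases[of i] by auto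
  qed (use assms in \<open>simp add: vec5_def\<close>)
qed

lemma hform_lin: "hform 4 1 la" "hform 4 1 lb" "hform 4 1 ls" "hform 4 1 lt" "hform 4 1 (\<lambda>v. v $ 1)"
  unfolding la_def lb_def ls_def lt_def by (intro hform_add hform_cmult hform_coord; simp)+

lemma hform_eqn: "hform 4 3 eqn"
proof -
  have 1: "hform 4 3 (\<lambda>v. la v * lb v * (f1 * la v + f2 * lb v))"
    by (rule hform_degree_eq[of _ "1 + 1 + 1"], intro hform_mult hform_power hform_add hform_cmult hform_lin, simp)
  have 2: "hform 4 3 (\<lambda>v. v $ 1 ^ 3)"
    by (rule hform_degree_eq[of _ "3 * 1"], intro hform_mult hform_power hform_add hform_cmult hform_lin, simp)
  have 3: "hform 4 3 (\<lambda>v. v $ 1 * (b00 * (la v * ls v) + b10 * (lb v * ls v) + b01 * (la v * lt v) + b11 * (lb v * lt v)))"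
    by (rule hform_degree_eq[of _ "1 + (1 + 1)"], intro hform_mult hform_power hform_add hform_cmult hform_lin, simp)
  have 4: "hform 4 3 (\<lambda>v. ls v * lt v * (h1 * ls v + h2 * lt v))"
    by (rule hform_degree_eq[of _ "1 + 1 + 1"], intro hform_mult hform_power hform_add hform_cmult hform_lin, simp)
  have "eqn = (\<lambda>v. la v * lb v * (f1 * la v + f2 * lb v) + v $ 1 ^ 3
     + v $ 1 * (b00 * (la v * ls v) + b10 * (lb v * ls v) + b01 * (la v * lt v) + b11 * (lb v * lt v))
     + ls v * lt v * (h1 * ls v + h2 * lt v))"
    by (rule ext) (simp add: eqn_def equation_def mult.assoc)
  then show ?thesis using hform_add[OF hform_add[OF hform_add[OF 1 2] 3] 4] by metis
qed

lemma hform_den: "hform 4 3 den"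
proof -
  have 1: "hform 4 3 (\<lambda>v. v $ 1 ^ 3)"
    by (rule hform_degree_eq[of _ "3 * 1"], intro hform_mult hform_power hform_add hform_cmult hform_lin, simp)
  have 2: "hform 4 3 (\<lambda>v. v $ 1 * (lb v * (b10 * ls v + b11 * lt v)))"
    by (rule hform_degree_eq[of _ "1 + (1 + 1)"], intro hform_mult hform_power hform_add hform_cmult hform_lin, simp)
  have 3: "hform 4 3 (\<lambda>v. f2 * (la v * lb v ^ 2))"
    by (rule hform_degree_eq[of _ "1 + 2 * 1"], intro hform_mult hform_power hform_add hform_cmult hform_lin, simp)
  have "den = (\<lambda>v. v $ 1 ^ 3 + v $ 1 * (lb v * (b10 * ls v + b11 * lt v)) + f2 * (la v * lb v ^ 2))"
    by (rule ext) (simp add: den_def)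
  then show ?thesis using hform_add[OF hform_add[OF 1 2] 3] by metis
qed

lemma hform_good: "hform 4 8 good"
proof -
  have "good = (\<lambda>v. la v * lb v * v $ 1 * ls v * lt v * den v)" by (rule ext) (rule good_def)
  moreover have "hform 4 8 (\<lambda>v. la v * lb v * v $ 1 * ls v * lt v * den v)"
    by (rule hform_degree_eq[of _ "1 + 1 + 1 + 1 + 1 + 3"], intro hform_mult hform_lin hform_den, simp)
  ultimately show ?thesis by metis
qed

text \<open>The eliminant of the coordinate \<open>u = v $ 1\<close> from \<open>eqn = 0\<close> and \<open>good = 0\<close>.\<close>

definition bad :: "complex vec \<Rightarrow> complex" where
  "bad v = (let a = la v; b = lb v; s = ls v; t = lt v;
      h = s * t * (h1 * s + h2 * t); k = f1 * a ^ 2 * b + h; m = (b00 * s + b01 * t) * a in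
    a * b * s * t * ((a * b * (f1 * a + f2 * b) + h) *
      (f2 * a * b ^ 2 * m ^ 3 - k ^ 3 - k * m ^ 2 * b * (b10 * s + b11 * t))))"

lemma bad_eq_0:
  assumes "eqn v = 0" "good v = 0" shows "bad v = 0"
proof -
  define a b s t u where "a = la v" and "b = lb v" and "s = ls v" and "t = lt v" and "u = v $ 1"
  define h where "h = s * t * (h1 * s + h2 * t)"
  define k m where "k = f1 * a ^ 2 * b + h" and "m = (b00 * s + b01 * t) * a"
  have e: "a * b * (f1 * a + f2 * b) + u ^ 3 + u * (b00 * a * s + b10 * b * s + b01 * a * t + b11 * b * t) + h = 0"
    using assms(1) by (simp add: eqn_def equation_def a_def b_def s_def t_def u_def h_def)
  have bad: "bad v = a * b * s * t * ((a * b * (f1 * a + f2 * b) + h) *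
      (f2 * a * b ^ 2 * m ^ 3 - k ^ 3 - k * m ^ 2 * b * (b10 * s + b11 * t)))"
    by (simp add: bad_def Let_def a_def b_def s_def t_def h_def k_def m_def)
  from assms(2) consider "a * b * s * t = 0" | "u = 0" | "den v = 0"
    by (auto simp: good_def a_def b_def s_def t_def u_def)
  then show ?thesis
  proof cases
    case 1 then show ?thesis unfolding bad by simp
  next
    case 2 then show ?thesis using e unfolding bad by simp
  next
    case 3
    then have d: "u ^ 3 + u * (b * (b10 * s + b11 * t)) + f2 * (a * b ^ 2) = 0"
      by (simp add: den_def a_def b_def s_def t_def u_def)
    \<comment> \<open>The difference of \<open>eqn\<close> and \<open>den\<close> is k + u m, linear
      in u. Multiplying \<open>den\<close> = 0 by m^3 and substituting -k for u m eliminates u; this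
      is the last factor of \<open>bad\<close>.\<close>
    have um: "u * m = - k" using e d unfolding k_def m_def by Groebner_Basis.algebra
    have "f2 * a * b ^ 2 * m ^ 3 - k ^ 3 - k * m ^ 2 * b * (b10 * s + b11 * t) = 0"
      using um d by Groebner_Basis.algebra
    then show ?thesis unfolding bad by simp
  qed
qed

text \<open>Lifting a point to X changes only the coordinate u, so the parameters to be avoided on a
  line can be determined before the lift.\<close>

lemma bad_indep: "v \<in> carrier_vec 5 \<Longrightarrow> bad (v + r \<cdot>\<^sub>v unit_vec 5 1) = bad v"
  by (simp add: bad_def la_def lb_def ls_def lt_def)

lemma hform_bad: "hform 4 16 bad"
proof -
  let ?h = "\<lambda>v. ls v * lt v * (h1 * ls v + h2 * lt v)"
  let ?k = "\<lambda>v. f1 * (la v ^ 2 * lb v) + ?h v"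
  let ?m = "\<lambda>v. (b00 * ls v + b01 * lt v) * la v"
  have h: "hform 4 3 ?h"
    by (rule hform_degree_eq[of _ "1 + 1 + 1"], intro hform_mult hform_power hform_add hform_cmult hform_lin, simp)
  have "hform 4 3 (\<lambda>v. f1 * (la v ^ 2 * lb v))"
    by (rule hform_degree_eq[of _ "2 * 1 + 1"], intro hform_mult hform_power hform_add hform_cmult hform_lin, simp)
  then have k: "hform 4 3 ?k" by (intro hform_add h)
  have m: "hform 4 2 ?m"
    by (rule hform_degree_eq[of _ "1 + 1"], intro hform_mult hform_power hform_add hform_cmult hform_lin, simp)
  have 1: "hform 4 4 (\<lambda>v. la v * lb v * ls v * lt v)"
    by (rule hform_degree_eq[of _ "1 + 1 + 1 + 1"], intro hform_mult hform_power hform_add hform_cmult hform_lin, simp)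
  have "hform 4 3 (\<lambda>v. la v * lb v * (f1 * la v + f2 * lb v))"
    by (rule hform_degree_eq[of _ "1 + 1 + 1"], intro hform_mult hform_power hform_add hform_cmult hform_lin, simp)
  then have 2: "hform 4 3 (\<lambda>v. la v * lb v * (f1 * la v + f2 * lb v) + ?h v)"
    by (intro hform_add h)
  have 3: "hform 4 9 (\<lambda>v. f2 * (la v * lb v ^ 2 * ?m v ^ 3) - ?k v ^ 3 - ?k v * ?m v ^ 2 * lb v * (b10 * ls v + b11 * lt v))"
  proof -
    have a: "hform 4 9 (\<lambda>v. la v * lb v ^ 2 * ?m v ^ 3)"
      by (rule hform_degree_eq[of _ "1 + 2 * 1 + 3 * 2"], intro hform_mult hform_power hform_lin m, simp)
    have b: "hform 4 9 (\<lambda>v. ?k v ^ 3)"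
      by (rule hform_degree_eq[of _ "3 * 3"], intro hform_power k, simp)
    have c: "hform 4 9 (\<lambda>v. ?k v * ?m v ^ 2 * lb v * (b10 * ls v + b11 * lt v))"
      by (rule hform_degree_eq[of _ "3 + 2 * 2 + 1 + 1"], rule hform_mult, rule hform_mult, rule hform_mult, rule k,
          rule hform_power, rule m, rule hform_lin, intro hform_add hform_cmult hform_lin, simp)
    show ?thesis by (intro hform_diff hform_cmult a b c)
  qed
  have "hform 4 16 (\<lambda>v. la v * lb v * ls v * lt v * ((la v * lb v * (f1 * la v + f2 * lb v) + ?h v) *
     (f2 * (la v * lb v ^ 2 * ?m v ^ 3) - ?k v ^ 3 - ?k v * ?m v ^ 2 * lb v * (b10 * ls v + b11 * lt v))))"
    using hform_mult[OF 1 hform_mult[OF 2 3]] by simp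
  moreover have "bad = (\<lambda>v. la v * lb v * ls v * lt v * ((la v * lb v * (f1 * la v + f2 * lb v) + ?h v) *
     (f2 * (la v * lb v ^ 2 * ?m v ^ 3) - ?k v ^ 3 - ?k v * ?m v ^ 2 * lb v * (b10 * ls v + b11 * lt v))))"
    by (rule ext) (simp add: bad_def Let_def mult.assoc)
  ultimately show ?thesis by simp
qed

lemma bad_nonzero: obtains d where "d \<in> carrier_vec 5" "bad d \<noteq> 0"
proof -
  \<comment> \<open>One of 1 and -1 works, because h1 + h2 and h1 - h2 are not both 0.\<close>
  obtain t where t: "t \<noteq> 0" "h1 + h2 * t \<noteq> 0"
  proof (cases "h1 + h2 = 0")
    case True
    have "h1 + h2 * (-1) \<noteq> 0"
    proof
      assume "h1 + h2 * (-1) = 0"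
      then have "2 * h1 = 0" using True by Groebner_Basis.algebra
      then show False using h12 True by simp
    qed
    then show ?thesis using that[of "-1"] by simp
  qed (use that[of 1] in simp)
  text \<open>Near \<open>a = 0\<close> the last factor of \<open>bad\<close> is close to \<open>-h\<^sup>3\<close>.\<close>
  define g :: "complex \<Rightarrow> complex" where "g = (\<lambda>x. bad (mk x 1 0 1 t))"
  define q where "q = (\<lambda>x. (x * (f1 * x + f2) + t * (h1 + h2 * t)) *
      (f2 * x * ((b00 + b01 * t) * x) ^ 3 - (f1 * x ^ 2 + t * (h1 + h2 * t)) ^ 3
        - (f1 * x ^ 2 + t * (h1 + h2 * t)) * ((b00 + b01 * t) * x) ^ 2 * (b10 + b11 * t)))"
  have g: "g x = x * t * q x" for x
    by (simp add: g_def q_def bad_def Let_def)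
  have "isCont q 0" unfolding q_def by (intro continuous_intros)
  moreover have "q 0 \<noteq> 0" using t by (simp add: q_def)
  ultimately have "eventually (\<lambda>x. q x \<noteq> 0) (at 0)"
    unfolding isCont_def by (rule tendsto_imp_eventually_ne)
  moreover have "eventually (\<lambda>x::complex. x \<noteq> 0) (at 0)" by (simp add: eventually_at_filter)
  ultimately have "eventually (\<lambda>x. q x \<noteq> 0 \<and> x \<noteq> 0) (at 0)" by (rule eventually_conj)
  then obtain x where "q x \<noteq> 0" "x \<noteq> 0" using eventually_happens'[OF at_neq_bot] by blast
  then have "bad (mk x 1 0 1 t) \<noteq> 0" using g[of x] t(1) by (simp add: g_def)
  then show thesis by (rule that[OF mk_simps(1)])
qed

text \<open>\<open>eqn\<close> is monic in u, so a zero in \<open>W\<close> can be followed over the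
  line v + t d. As \<open>bad d\<close> is nonzero, only finitely many t are excluded, and over the
  others every zero of \<open>eqn\<close> is good.\<close>

lemma Xg_dense:
  assumes "openin (subtopology (zariski 4) X) W" "W \<noteq> {}"
  shows "W \<inter> Xg \<noteq> {}"
proof -
  obtain W0 where W0: "openin (zariski 4) W0" "W = W0 \<inter> X" using assms(1) by (auto simp: openin_subtopology)
  obtain p where p: "p \<in> W0" "p \<in> X" using assms(2) W0(2) by blast
  obtain e H where H: "hform 4 e H" "\<And>v. v \<in> p \<Longrightarrow> H v \<noteq> 0" "{q \<in> proj_points 4. \<forall>v\<in>q. H v \<noteq> 0} \<subseteq> W0"
    using zariski_basis[OF W0(1) p(1)] by blast
  have "p \<in> proj_points 4" using p(2) by (simp add: X_def)
  then obtain v where v: "v \<in> carrier_vec (4 + 1)" "p = pt v" using proj_points_cases by blast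
  have v': "eqn v = 0" "H v \<noteq> 0" using p(2) H(2) v(2) pt_self by (auto simp: X_def)
  obtain d where d: "d \<in> carrier_vec 5" "bad d \<noteq> 0" using bad_nonzero by blast
  then have d': "d \<in> carrier_vec (4 + 1)" by simp
  have "finite {t. bad (v + t \<cdot>\<^sub>v d) = 0}" using hform_line_finite[OF hform_bad v(1) d'] d(2) by blast
  moreover have "unit_vec 5 1 \<in> carrier_vec (4 + 1)" by simp
  moreover have "eqn (unit_vec 5 1) = 1" by (simp add: eqn_def equation_def la_def lb_def ls_def lt_def)
  ultimately obtain t r where tr: "t \<notin> {t. bad (v + t \<cdot>\<^sub>v d) = 0}" "eqn (v + t \<cdot>\<^sub>v d + r \<cdot>\<^sub>v unit_vec 5 1) = 0"
    "H (v + t \<cdot>\<^sub>v d + r \<cdot>\<^sub>v unit_vec 5 1) \<noteq> 0"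
    using hypersurface_zero_near[OF hform_eqn _ _ H(1) v(1) v' d', of "unit_vec 5 1"] by metis
  define x where "x = v + t \<cdot>\<^sub>v d + r \<cdot>\<^sub>v unit_vec 5 1"
  have xc: "x \<in> carrier_vec (4 + 1)" using v(1) d(1) by (simp add: x_def)
  have "bad x \<noteq> 0" using tr(1) bad_indep[of "v + t \<cdot>\<^sub>v d" r] v(1) d(1) by (simp add: x_def)
  then have g: "good x \<noteq> 0" using bad_eq_0 tr(2) by (auto simp: x_def)
  then have "x \<noteq> 0\<^sub>v (4 + 1)" using hform_at_zero[OF hform_good] by auto
  then have "pt x \<in> proj_points 4" using pt_in_proj_points xc by blast
  moreover have "\<forall>w\<in>pt x. H w \<noteq> 0" "\<forall>w\<in>pt x. eqn w = 0" "\<forall>w\<in>pt x. good w \<noteq> 0"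
    using hform_zero_pt[OF H(1) xc] hform_zero_pt[OF hform_eqn xc] hform_zero_pt[OF hform_good xc] tr(2,3) g
    by (auto simp: x_def)
  ultimately have "pt x \<in> W \<inter> Xg" using H(3) by (auto simp: W0(2) X_def Xg_def)
  then show ?thesis by blast
qed

end

section \<open>Invariant coordinates\<close>

definition vec4 :: "complex \<Rightarrow> complex \<Rightarrow> complex \<Rightarrow> complex \<Rightarrow> complex vec" where
  "vec4 x0 x1 x2 x3 = vec 4 (\<lambda>i. [x0, x1, x2, x3] ! i)"

lemma vec4_simps [simp]:
  "vec4 x0 x1 x2 x3 \<in> carrier_vec 4" "vec4 x0 x1 x2 x3 $ 0 = x0" "vec4 x0 x1 x2 x3 $ 1 = x1"
  "vec4 x0 x1 x2 x3 $ Suc 0 = x1" "vec4 x0 x1 x2 x3 $ 2 = x2" "vec4 x0 x1 x2 x3 $ 3 = x3"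
  by (auto simp: vec4_def)

definition cube_root :: "complex \<Rightarrow> complex" where
  "cube_root c = (SOME s. s ^ 3 = c)"

lemma cube_root: "cube_root c ^ 3 = c"
proof -
  obtain r s t where "\<And>u. 1 * u ^ 3 + 0 * u ^ 2 + 0 * u + - c = 1 * (u - r) * (u - s) * (u - t)"
    using cubic_factorization[of 1 0 0 "- c"] by auto
  from this[of r] have "r ^ 3 = c" by simp
  then show ?thesis unfolding cube_root_def by (rule someI)
qed

section \<open>The quotient map, the good locus in the quotient and the invariants\<close>

context normal_cubic
begin

abbreviation \<G> :: "complex mat set monoid" where "\<G> \<equiv> G\<^sub>1 \<xi>"

definition proj :: "ppoint \<Rightarrow> ppoint set" where "proj p = orbit \<G> pgl_act p"

abbreviation \<Q> :: "ppoint set fun_space" where "\<Q> \<equiv> quotient_space \<G> pgl_act (proj_variety 4 X)"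

abbreviation TX :: "ppoint topology" where "TX \<equiv> subtopology (zariski 4) X"

lemma root: "\<xi> ^ 3 = 1" "\<xi> \<noteq> 0"
  using primitive_root_3[OF prim] by auto

lemma X_sub: "X \<subseteq> proj_points 4"
  by (auto simp: X_def)

lemma top_X: "space_top (proj_variety 4 X) = TX" "topspace TX = X"
  using X_sub by (auto simp: proj_variety_def topspace_zariski)

lemma openin_Q: "openin (space_top \<Q>) W \<longleftrightarrow> W \<subseteq> proj ` X \<and> openin TX {p \<in> X. proj p \<in> W}"
proof -
  have "orbits \<G> X pgl_act = proj ` X" by (auto simp: orbits_def proj_def)
  then show ?thesis unfolding openin_quotient_space quotient_open_def top_X proj_def by (simp only:)
qed

lemma regular_Q: "regular \<Q> W f \<longleftrightarrow> regular (proj_variety 4 X) {p \<in> X. proj p \<in> W} (\<lambda>p. f (proj p))"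
  by (simp only: quotient_space_def fun_space.simps top_X proj_def)

lemma ringed_X: "ringed_space (proj_variety 4 X)"
  by (rule ringed_space_proj_variety[OF X_sub])

lemma dg_coords [simp]:
  "la (dg \<xi> k v) = la v" "lb (dg \<xi> k v) = lb v" "dg \<xi> k v $ 1 = \<xi> ^ k * v $ 1"
  "ls (dg \<xi> k v) = (\<xi> ^ k)\<^sup>2 * ls v" "lt (dg \<xi> k v) = (\<xi> ^ k)\<^sup>2 * lt v"
  by (simp_all add: la_def lb_def ls_def lt_def algebra_simps power_mult)

lemma root_power: "(\<xi> ^ k) ^ 3 = 1" "\<xi> ^ k \<noteq> 0"
proof -
  have "(\<xi> ^ k) ^ 3 = (\<xi> ^ 3) ^ k" by (simp only: power_mult[symmetric] mult.commute)
  then show "(\<xi> ^ k) ^ 3 = 1" using root by simp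
  show "\<xi> ^ k \<noteq> 0" using root by simp
qed

lemma eqn_dg: "eqn (dg \<xi> k v) = eqn v"
proof -
  have "equation a b (c * u) (c\<^sup>2 * s) (c\<^sup>2 * t) = equation a b u s t" if "c ^ 3 = 1" for a b c u s t
    unfolding equation_def using that by Groebner_Basis.algebra
  from this[OF root_power(1)] show ?thesis unfolding eqn_def dg_coords .
qed

lemma den_dg: "den (dg \<xi> k v) = den v"
proof -
  have "(c * u) ^ 3 + c * u * (b * (b10 * (c\<^sup>2 * s) + b11 * (c\<^sup>2 * t))) = u ^ 3 + u * (b * (b10 * s + b11 * t))"
    if "c ^ 3 = 1" for b c u s t
    using that by Groebner_Basis.algebra
  from this[OF root_power(1)] show ?thesis unfolding den_def dg_coords by simp
qed

lemma good_dg: "good (dg \<xi> k v) = 0 \<longleftrightarrow> good v = 0"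
  unfolding good_def dg_coords den_dg using root(2) by simp

lemma pt_X:
  assumes "v \<in> carrier_vec 5" "v \<noteq> 0\<^sub>v 5"
  shows "pt v \<in> X \<longleftrightarrow> eqn v = 0"
proof
  assume "pt v \<in> X"
  then have "\<forall>w\<in>pt v. eqn w = 0" by (simp add: X_def)
  then show "eqn v = 0" using pt_self by (rule bspec)
next
  assume e: "eqn v = 0"
  have "eqn w = 0" if "w \<in> pt v" for w
    using hform_zero_pt[OF hform_eqn _ that] assms(1) e by simp
  moreover have "pt v \<in> proj_points 4" using pt_in_proj_points[of v 4] assms by simp
  ultimately show "pt v \<in> X" by (simp add: X_def)
qed

lemma good_nonzero: "good v \<noteq> 0 \<Longrightarrow> v \<noteq> 0\<^sub>v 5"
  using hform_at_zero[OF hform_good] by auto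

lemma pt_Xg:
  assumes "v \<in> carrier_vec 5"
  shows "pt v \<in> Xg \<longleftrightarrow> eqn v = 0 \<and> good v \<noteq> 0"
proof
  assume "pt v \<in> Xg"
  then have "\<forall>w\<in>pt v. eqn w = 0" "\<forall>w\<in>pt v. good w \<noteq> 0" by (simp_all add: Xg_def X_def)
  then show "eqn v = 0 \<and> good v \<noteq> 0" using bspec[OF _ pt_self] by blast
next
  assume v: "eqn v = 0 \<and> good v \<noteq> 0"
  then have "pt v \<in> X" using pt_X[OF assms] good_nonzero by blast
  moreover have "\<forall>w\<in>pt v. good w \<noteq> 0" using hform_zero_pt[OF hform_good, of v] assms v by simp
  ultimately show "pt v \<in> Xg" by (simp add: Xg_def)
qed

lemma X_cases:
  assumes "p \<in> X" obtains v where "v \<in> carrier_vec 5" "v \<noteq> 0\<^sub>v 5" "p = pt v" "eqn v = 0"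
proof -
  obtain v where v: "v \<in> carrier_vec (4 + 1)" "v \<noteq> 0\<^sub>v (4 + 1)" "p = pt v"
    using proj_points_cases X_sub assms by blast
  with that assms pt_X[of v] show thesis by auto
qed

lemma proj_pt: "v \<in> carrier_vec 5 \<Longrightarrow> proj (pt v) = range (\<lambda>k. pt (dg \<xi> k v))"
  unfolding proj_def by (rule orbit_G1_pt[OF root(1)])

lemma proj_dg: "v \<in> carrier_vec 5 \<Longrightarrow> proj (pt (dg \<xi> k v)) = proj (pt v)"
  unfolding proj_def by (rule orbit_G1_dg[OF root(1)])

lemma proj_eqD:
  assumes "v \<in> carrier_vec 5" "w \<in> carrier_vec 5" "proj (pt v) = proj (pt w)"
  obtains k where "pt w = pt (dg \<xi> k v)"
proof -
  have "pt w = pt (dg \<xi> 0 w)" by (simp add: dg_0[OF assms(2)])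
  then have "pt w \<in> proj (pt w)" unfolding proj_pt[OF assms(2)] by (rule range_eqI)
  with that show thesis unfolding assms(3)[symmetric] proj_pt[OF assms(1)] by blast
qed

definition Uq :: "ppoint set set" where "Uq = proj ` Xg"

text \<open>\<open>Xg\<close> is a union of orbits: the generator preserves \<open>eqn\<close> and
  multiplies \<open>good\<close> by a nonzero factor.\<close>

lemma pre_Uq: "{p \<in> X. proj p \<in> Uq} = Xg"
proof
  show "Xg \<subseteq> {p \<in> X. proj p \<in> Uq}" by (auto simp: Uq_def Xg_def)
  show "{p \<in> X. proj p \<in> Uq} \<subseteq> Xg"
  proof
    fix p assume "p \<in> {p \<in> X. proj p \<in> Uq}"
    then obtain q where q: "p \<in> X" "q \<in> Xg" "proj q = proj p" by (auto simp: Uq_def)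
    obtain v where v: "v \<in> carrier_vec 5" "p = pt v" using X_cases[OF q(1)] by blast
    have "q \<in> X" using q(2) by (simp add: Xg_def)
    then obtain w where w: "w \<in> carrier_vec 5" "q = pt w" using X_cases by blast
    obtain k where "pt v = pt (dg \<xi> k w)" using proj_eqD[OF w(1) v(1)] q(3) v(2) w(2) by metis
    moreover have "eqn w = 0 \<and> good w \<noteq> 0" using q(2) pt_Xg[OF w(1)] w(2) by simp
    then have "pt (dg \<xi> k w) \<in> Xg" using pt_Xg[of "dg \<xi> k w"] eqn_dg good_dg by simp
    ultimately show "p \<in> Xg" using v(2) by simp
  qed
qed

lemma openin_Xg: "openin TX Xg"
proof -
  have "Xg = X \<inter> {p \<in> proj_points 4. \<forall>v\<in>p. good v \<noteq> 0}" using X_sub by (auto simp: Xg_def)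
  then show ?thesis using openin_subtopology_Int2[OF openin_hform_nonzero[OF hform_good]] by simp
qed

lemma openin_Uq: "openin (space_top \<Q>) Uq"
  unfolding openin_Q pre_Uq using openin_Xg by (auto simp: Uq_def Xg_def)

lemma dense_Uq: "dense_open \<Q> Uq"
proof -
  have "Uq \<inter> W \<noteq> {}" if "openin (space_top \<Q>) W" "W \<noteq> {}" for W
  proof -
    have W: "W \<subseteq> proj ` X" "openin TX {p \<in> X. proj p \<in> W}" using that(1) by (auto simp: openin_Q)
    with that(2) have "{p \<in> X. proj p \<in> W} \<noteq> {}" by auto
    from Xg_dense[OF W(2) this] obtain p where "p \<in> Xg" "proj p \<in> W" by auto
    then show ?thesis by (auto simp: Uq_def)
  qed
  then show ?thesis unfolding dense_open_def dense_intersects_open using openin_Uq by blast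
qed

text \<open>The value at an arbitrary vector of an arbitrary point of the orbit; meaningful for
  functions invariant under scaling and under \<open>dg\<close>.\<close>

definition val :: "(complex vec \<Rightarrow> complex) \<Rightarrow> ppoint set \<Rightarrow> complex" where
  "val f x = f (SOME v. v \<in> \<Union>x)"

lemma val_proj:
  assumes "\<And>c v. c \<noteq> 0 \<Longrightarrow> v \<in> carrier_vec 5 \<Longrightarrow> f (c \<cdot>\<^sub>v v) = f v" "\<And>k v. f (dg \<xi> k v) = f v"
    and v: "v \<in> carrier_vec 5"
  shows "val f (proj (pt v)) = f v"
proof -
  have "v \<in> \<Union>(proj (pt v))"
  proof
    show "v \<in> pt (dg \<xi> 0 v)" using v by (simp add: dg_0 pt_self)
    show "pt (dg \<xi> 0 v) \<in> proj (pt v)" unfolding proj_pt[OF v] by (rule range_eqI) (rule refl)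
  qed
  then have "(SOME w. w \<in> \<Union>(proj (pt v))) \<in> \<Union>(proj (pt v))" by (rule someI)
  then obtain k c where "c \<noteq> 0" "(SOME w. w \<in> \<Union>(proj (pt v))) = c \<cdot>\<^sub>v dg \<xi> k v"
    unfolding proj_pt[OF v] by (auto simp: pt_def)
  then show ?thesis unfolding val_def using assms(1)[of c "dg \<xi> k v"] assms(2) by simp
qed

definition al :: "complex vec \<Rightarrow> complex" where "al v = la v * lb v / (v $ 1 * ls v)"
definition be :: "complex vec \<Rightarrow> complex" where "be v = ls v * lt v / (v $ 1 * la v)"
definition ze :: "complex vec \<Rightarrow> complex" where "ze v = lt v / ls v"

lemma smult_coords:
  assumes "v \<in> carrier_vec 5"
  shows "la (c \<cdot>\<^sub>v v) = c * la v" "lb (c \<cdot>\<^sub>v v) = c * lb v" "(c \<cdot>\<^sub>v v) $ 1 = c * v $ 1"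
    "ls (c \<cdot>\<^sub>v v) = c * ls v" "lt (c \<cdot>\<^sub>v v) = c * lt v"
  using assms by (simp_all add: la_def lb_def ls_def lt_def algebra_simps)

text \<open>For b = 0 both sides are 0 by the convention for division, so the coordinates are
  invariant as functions on all of \<open>carrier_vec 5\<close>.\<close>

lemma cancel_frac: "k \<noteq> 0 \<Longrightarrow> a' = k * a \<Longrightarrow> b' = k * b \<Longrightarrow> a' / b' = a / (b :: complex)"
  by simp

lemma val_coords:
  assumes "v \<in> carrier_vec 5"
  shows "val al (proj (pt v)) = al v" "val be (proj (pt v)) = be v" "val ze (proj (pt v)) = ze v"
proof -
  show "val al (proj (pt v)) = al v"
  proof (rule val_proj[OF _ _ assms])
    show "al (c \<cdot>\<^sub>v v) = al v" if "c \<noteq> 0" "v \<in> carrier_vec 5" for c v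
      unfolding al_def smult_coords[OF that(2)] by (rule cancel_frac[of "c\<^sup>2"]) (use that(1) in \<open>auto simp: power2_eq_square\<close>)
    show "al (dg \<xi> k v) = al v" for k v
    proof -
      have "c * u * (c\<^sup>2 * s) = u * s" if "c ^ 3 = 1" for c u s :: complex
        using that by Groebner_Basis.algebra
      from this[OF root_power(1)] show ?thesis unfolding al_def dg_coords by simp
    qed
  qed
  show "val be (proj (pt v)) = be v"
  proof (rule val_proj[OF _ _ assms])
    show "be (c \<cdot>\<^sub>v v) = be v" if "c \<noteq> 0" "v \<in> carrier_vec 5" for c v
      unfolding be_def smult_coords[OF that(2)] by (rule cancel_frac[of "c\<^sup>2"]) (use that(1) in \<open>auto simp: power2_eq_square\<close>)
    show "be (dg \<xi> k v) = be v" for k v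
    proof -
      have "c\<^sup>2 * s * (c\<^sup>2 * t) = c * (s * t)" if "c ^ 3 = 1" for c s t :: complex
        using that by Groebner_Basis.algebra
      note eq = this[OF root_power(1)[of k]]
      show ?thesis unfolding be_def dg_coords by (rule cancel_frac[OF root_power(2)[of k] eq]) simp
    qed
  qed
  show "val ze (proj (pt v)) = ze v"
  proof (rule val_proj[OF _ _ assms])
    show "ze (c \<cdot>\<^sub>v v) = ze v" if "c \<noteq> 0" "v \<in> carrier_vec 5" for c v
      unfolding ze_def smult_coords[OF that(2)] using that(1) by simp
    show "ze (dg \<xi> k v) = ze v" for k v
      unfolding ze_def dg_coords using root(2) by simp
  qed
qed

text \<open>
  In terms of \<open>\<alpha> = ab/us\<close>, \<open>\<beta> = st/ua\<close>, \<open>z = t/s\<close> and \<open>y = b/a\<close> one has \<open>u\<^sup>2/as = yz/\<alpha>\<beta>\<close>, so that the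
  equation of \<open>X\<close> divided by \<open>aus\<close> reads \<open>num + y \<cdot> dnm = 0\<close>. The invariants determine the point
  normalised by \<open>a = 1\<close> up to the choice of the cube root \<open>s\<close> of \<open>y\<beta>/\<alpha>z\<close>, that is, up to the group.
\<close>

definition num :: "complex \<Rightarrow> complex \<Rightarrow> complex \<Rightarrow> complex" where
  "num \<alpha> \<beta> z = \<alpha> * f1 + \<beta> * (h1 + h2 * z) + b00 + b01 * z"

definition dnm :: "complex \<Rightarrow> complex \<Rightarrow> complex \<Rightarrow> complex" where
  "dnm \<alpha> \<beta> z = \<alpha> * f2 + b10 + b11 * z + z / (\<alpha> * \<beta>)"

definition yy :: "complex \<Rightarrow> complex \<Rightarrow> complex \<Rightarrow> complex" where
  "yy \<alpha> \<beta> z = - num \<alpha> \<beta> z / dnm \<alpha> \<beta> z"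

text \<open>For a = 1 the coordinates give us = y/\<alpha>, st = \<beta>u and t = zs; eliminating u
  and t leaves s^3 = y\<beta>/\<alpha>z.\<close>

definition ss :: "complex \<Rightarrow> complex \<Rightarrow> complex \<Rightarrow> complex" where
  "ss \<alpha> \<beta> z = cube_root (yy \<alpha> \<beta> z * \<beta> / (\<alpha> * z))"

definition psiv :: "complex \<Rightarrow> complex \<Rightarrow> complex \<Rightarrow> complex vec" where
  "psiv \<alpha> \<beta> z = mk 1 (yy \<alpha> \<beta> z) (yy \<alpha> \<beta> z / (\<alpha> * ss \<alpha> \<beta> z)) (ss \<alpha> \<beta> z) (z * ss \<alpha> \<beta> z)"

text \<open>The parameters belonging to good points; \<open>num\<close> = 0 is excluded because it
  would mean y = 0, that is b = 0.\<close>

definition adm :: "complex \<Rightarrow> complex \<Rightarrow> complex \<Rightarrow> bool" where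
  "adm \<alpha> \<beta> z \<longleftrightarrow> \<alpha> \<noteq> 0 \<and> \<beta> \<noteq> 0 \<and> z \<noteq> 0 \<and> num \<alpha> \<beta> z \<noteq> 0 \<and> dnm \<alpha> \<beta> z \<noteq> 0"

lemma psiv_carrier: "psiv \<alpha> \<beta> z \<in> carrier_vec 5"
  by (simp add: psiv_def)

lemma psiv_correct:
  assumes "adm \<alpha> \<beta> z"
  shows "eqn (psiv \<alpha> \<beta> z) = 0" "good (psiv \<alpha> \<beta> z) \<noteq> 0"
    "al (psiv \<alpha> \<beta> z) = \<alpha>" "be (psiv \<alpha> \<beta> z) = \<beta>" "ze (psiv \<alpha> \<beta> z) = z"
proof -
  have nz: "\<alpha> \<noteq> 0" "\<beta> \<noteq> 0" "z \<noteq> 0" "num \<alpha> \<beta> z \<noteq> 0" "dnm \<alpha> \<beta> z \<noteq> 0" using assms by (auto simp: adm_def)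
  define y s where "y = yy \<alpha> \<beta> z" and "s = ss \<alpha> \<beta> z"
  \<comment> \<open>On the constructed point q = us = aus, the monomial by which the equation of X
    was divided, so \<open>eqn\<close> is q times the reduced equation.\<close>
  define u q where "u = y / (\<alpha> * s)" and "q = y / \<alpha>"
  define e where "e = z / (\<alpha> * \<beta>)"
  have p: "psiv \<alpha> \<beta> z = mk 1 y u s (z * s)" by (simp add: psiv_def y_def s_def u_def)
  have ynz: "y \<noteq> 0" using nz by (simp add: y_def yy_def)
  have s3: "s ^ 3 = y * \<beta> / (\<alpha> * z)" by (simp add: s_def ss_def y_def cube_root)
  have snz: "s \<noteq> 0"
  proof
    assume "s = 0"
    then show False using s3 ynz nz by simp
  qed
  have unz: "u \<noteq> 0" and qnz: "q \<noteq> 0" using ynz snz nz by (auto simp: u_def q_def)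
  have yD: "y * dnm \<alpha> \<beta> z + num \<alpha> \<beta> z = 0" using nz by (simp add: y_def yy_def)
  have D: "dnm \<alpha> \<beta> z = \<alpha> * f2 + b10 + b11 * z + e" by (simp add: dnm_def e_def)
  have yq: "y = q * \<alpha>" using nz by (simp add: q_def)
  have us: "u * s = q" using snz nz by (simp add: u_def q_def)
  have zs: "z * s ^ 3 = q * \<beta>" using nz unfolding s3 q_def by simp
  have ez: "e * \<alpha> * \<beta> = z" using nz by (simp add: e_def)
  have u3: "u ^ 3 = q * y * e"
  proof -
    have "u ^ 3 * (z * s ^ 3) = z * (u * s) ^ 3" by (simp add: power_mult_distrib)
    then have "(q * \<beta>) * u ^ 3 = (q * \<beta>) * (q * y * e)"
      unfolding zs us using ez yq by Groebner_Basis.algebra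
    then show ?thesis using qnz nz by simp
  qed
  have "eqn (psiv \<alpha> \<beta> z) = y * (f1 + f2 * y) + u ^ 3 + (u * s) * (b00 + b10 * y + b01 * z + b11 * y * z)
      + (z * s ^ 3) * (h1 + h2 * z)"
    unfolding p eqn_def equation_def mk_simps by (simp add: algebra_simps power2_eq_square power3_eq_cube)
  also have "\<dots> = q * (y * dnm \<alpha> \<beta> z + num \<alpha> \<beta> z)"
    unfolding u3 us zs D num_def using yq by Groebner_Basis.algebra
  finally show "eqn (psiv \<alpha> \<beta> z) = 0" using yD by simp
  have "den (psiv \<alpha> \<beta> z) = u ^ 3 + (u * s) * y * (b10 + b11 * z) + f2 * y ^ 2"
    unfolding p den_def mk_simps by (simp add: algebra_simps)
  also have "\<dots> = q * y * dnm \<alpha> \<beta> z" unfolding u3 us D using yq by Groebner_Basis.algebra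
  finally have "den (psiv \<alpha> \<beta> z) \<noteq> 0" using qnz ynz nz by simp
  then show "good (psiv \<alpha> \<beta> z) \<noteq> 0" using ynz unz snz nz by (simp add: good_def p)
  show "al (psiv \<alpha> \<beta> z) = \<alpha>" unfolding al_def p mk_simps us using qnz yq by simp
  show "ze (psiv \<alpha> \<beta> z) = z" unfolding ze_def p mk_simps using snz by simp
  have "s * (z * s) * s = q * \<beta>" using zs by (simp add: power3_eq_cube mult_ac)
  then have "s * (z * s) * s = \<beta> * u * s" using us by (simp add: mult_ac)
  then have "s * (z * s) = \<beta> * u" using snz by simp
  then show "be (psiv \<alpha> \<beta> z) = \<beta>" unfolding be_def p mk_simps using unz by simp
qed

lemma good_point:
  assumes v: "v \<in> carrier_vec 5" "eqn v = 0" "good v \<noteq> 0"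
  shows "adm (al v) (be v) (ze v)" "proj (pt (psiv (al v) (be v) (ze v))) = proj (pt v)"
proof -
  define a b u s t where "a = la v" and "b = lb v" and "u = v $ 1" and "s = ls v" and "t = lt v"
  define \<alpha> \<beta> z where "\<alpha> = al v" and "\<beta> = be v" and "z = ze v"
  define e where "e = z / (\<alpha> * \<beta>)"
  have nz: "a \<noteq> 0" "b \<noteq> 0" "u \<noteq> 0" "s \<noteq> 0" "t \<noteq> 0" "den v \<noteq> 0"
    using v(3) by (auto simp: good_def a_def b_def u_def s_def t_def)
  have al: "\<alpha> * u * s = a * b" using nz by (simp add: \<alpha>_def al_def a_def b_def u_def s_def)
  have be: "\<beta> * u * a = s * t" using nz by (simp add: \<beta>_def be_def a_def t_def u_def s_def)
  have ze: "z * s = t" using nz by (simp add: z_def ze_def t_def s_def)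
  have nz': "\<alpha> \<noteq> 0" "\<beta> \<noteq> 0" "z \<noteq> 0" using al be ze nz by auto
  have ez: "e * \<alpha> * \<beta> = z" using nz' by (simp add: e_def)
  \<comment> \<open>Since e = z/\<alpha>\<beta> and zs = t, this is the relation \<alpha>\<beta> =
    bt/u^2.\<close>
  have eu: "e * b * s = u ^ 2"
  proof -
    have "(\<alpha> * \<beta> * u * u * s * a) = a * b * s * t" using al be by Groebner_Basis.algebra
    then have "\<alpha> * \<beta> * u * u = b * t" using nz by (simp add: mult_ac)
    then have "e * (b * t) = z * u * u" using ez by Groebner_Basis.algebra
    then have "t * (e * b * s) = t * u ^ 2" using ze by Groebner_Basis.algebra
    then show ?thesis using nz by simp
  qed
  have dnm: "dnm \<alpha> \<beta> z * (b * s * u) = den v"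
  proof -
    have "dnm \<alpha> \<beta> z * (b * s * u) = f2 * b * (\<alpha> * u * s) + b10 * b * s * u + b11 * b * u * (z * s) + (e * b * s) * u"
      by (simp add: dnm_def e_def[symmetric] algebra_simps)
    also have "\<dots> = den v" unfolding al ze eu
      by (simp add: den_def a_def b_def u_def s_def t_def algebra_simps power2_eq_square power3_eq_cube)
    finally show ?thesis .
  qed
  \<comment> \<open>On X the two parts of the reduced equation cancel, so \<open>den\<close>
    controls the nonvanishing of both \<open>num\<close> and \<open>dnm\<close>.\<close>
  have num: "num \<alpha> \<beta> z * (a * u * s) = - den v"
  proof -
    have "num \<alpha> \<beta> z * (a * u * s) = f1 * a * (\<alpha> * u * s) + (\<beta> * u * a) * (h1 * s + h2 * (z * s)) + b00 * a * u * s + b01 * a * u * (z * s)"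
      by (simp add: num_def algebra_simps)
    also have "\<dots> = eqn v - den v" unfolding al be ze
      by (simp add: den_def eqn_def equation_def a_def b_def u_def s_def t_def algebra_simps power2_eq_square power3_eq_cube)
    finally show ?thesis using v(2) by simp
  qed
  have dn: "dnm \<alpha> \<beta> z \<noteq> 0" "num \<alpha> \<beta> z \<noteq> 0" using dnm num nz by auto
  show "adm (al v) (be v) (ze v)" using nz' dn by (simp add: adm_def \<alpha>_def \<beta>_def z_def)
  define y \<sigma> where "y = yy \<alpha> \<beta> z" and "\<sigma> = ss \<alpha> \<beta> z"
  have ya: "y * a = b"
  proof -
    have 1: "y * dnm \<alpha> \<beta> z = - num \<alpha> \<beta> z" using dn by (simp add: y_def yy_def)
    have "(num \<alpha> \<beta> z * a) * (u * s) = - (dnm \<alpha> \<beta> z * b) * (u * s)"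
      using dnm num by (simp add: mult_ac)
    then have "num \<alpha> \<beta> z * a = - (dnm \<alpha> \<beta> z * b)"
      using nz mult_right_cancel[of "u * s" "num \<alpha> \<beta> z * a" "- (dnm \<alpha> \<beta> z * b)"] by simp
    then have "(y * dnm \<alpha> \<beta> z) * a = dnm \<alpha> \<beta> z * b" unfolding 1 by simp
    then have "dnm \<alpha> \<beta> z * (y * a) = dnm \<alpha> \<beta> z * b" by (simp add: mult_ac)
    then show ?thesis using dn by simp
  qed
  then have ynz: "y \<noteq> 0" using nz by auto
  have s3: "\<sigma> ^ 3 = y * \<beta> / (\<alpha> * z)" by (simp add: \<sigma>_def ss_def y_def cube_root)
  \<comment> \<open>\<sigma> and s/a have the same cube y\<beta>/\<alpha>z.\<close>
  have "(\<sigma> * a / s) ^ 3 = 1"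
  proof -
    have 1: "\<sigma> ^ 3 * \<alpha> * z = y * \<beta>" using nz' unfolding s3 by simp
    have "(\<sigma> ^ 3 * a ^ 3 - s ^ 3) * (\<alpha> * z * u) = a ^ 2 * (y * a) * \<beta> * u - s * (z * s) * (\<alpha> * u * s)"
      using 1 by Groebner_Basis.algebra
    also have "\<dots> = 0" unfolding ya ze al using be by Groebner_Basis.algebra
    finally have "\<sigma> ^ 3 * a ^ 3 = s ^ 3" using nz nz' by simp
    then show ?thesis using nz by (simp add: power_mult_distrib power_divide)
  qed
  then have "\<sigma> * a / s = 1 \<or> \<sigma> * a / s = \<xi> \<or> \<sigma> * a / s = \<xi>\<^sup>2"
    by (rule cube_root_of_unity_cases[OF prim])
  \<comment> \<open>The coordinate s has weight 2, so the group element sought is given by the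
    exponent k whose \<xi>^k squares to the root of unity: 0, 2, 1 for 1, \<xi>, \<xi>^2.\<close>
  moreover have "(\<xi> ^ 0)\<^sup>2 = 1" "(\<xi> ^ 2)\<^sup>2 = \<xi>" "(\<xi> ^ 1)\<^sup>2 = \<xi>\<^sup>2"
    using root(1) by (simp, Groebner_Basis.algebra, simp)
  ultimately obtain k where k: "\<sigma> * a / s = (\<xi> ^ k)\<^sup>2" by metis
  define c where "c = \<xi> ^ k"
  have c: "c ^ 3 = 1" "c \<noteq> 0" using root_power[of k] by (auto simp: c_def)
  have \<sigma>: "\<sigma> * a = c\<^sup>2 * s" using k nz by (simp add: c_def field_simps)
  define w where "w = inverse a \<cdot>\<^sub>v v"
  have w: "w \<in> carrier_vec 5" using v(1) by (simp add: w_def)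
  have snz: "\<sigma> \<noteq> 0" using \<sigma> nz c by auto
  have "dg \<xi> k w = mk (la (dg \<xi> k w)) (lb (dg \<xi> k w)) (dg \<xi> k w $ 1) (ls (dg \<xi> k w)) (lt (dg \<xi> k w))"
    by (rule mk_coords[symmetric]) simp
  also have "\<dots> = mk (inverse a * a) (inverse a * b) (c * (inverse a * u)) (c\<^sup>2 * (inverse a * s)) (c\<^sup>2 * (inverse a * t))"
    unfolding dg_coords w_def smult_coords[OF v(1)] by (simp add: a_def b_def u_def s_def t_def c_def)
  also have "\<dots> = mk 1 y (y / (\<alpha> * \<sigma>)) \<sigma> (z * \<sigma>)"
  proof -
    have 1: "inverse a * a = 1" using nz by simp
    have 2: "inverse a * b = y" using ya nz by (simp add: field_simps)
    have 3: "c\<^sup>2 * (inverse a * s) = \<sigma>" using \<sigma> nz by (simp add: field_simps)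
    have 4: "c\<^sup>2 * (inverse a * t) = z * \<sigma>" using 3 ze by (simp add: mult_ac flip: ze)
    have "(c * (inverse a * u)) * (\<alpha> * \<sigma>) = c ^ 3 * (inverse a * inverse a) * (\<alpha> * u * s)"
      unfolding 3[symmetric] by (simp add: power2_eq_square power3_eq_cube mult_ac)
    also have "\<dots> = y" unfolding al c(1) using 1 2 by Groebner_Basis.algebra
    finally have 5: "c * (inverse a * u) = y / (\<alpha> * \<sigma>)" using nz' snz by (simp add: field_simps)
    show ?thesis unfolding 1 2 3 4 5 ..
  qed
  also have "\<dots> = psiv \<alpha> \<beta> z" by (simp add: psiv_def y_def \<sigma>_def)
  finally have "proj (pt (psiv \<alpha> \<beta> z)) = proj (pt w)" using proj_dg[OF w, of k] by simp
  also have "pt w = pt v" unfolding w_def by (rule pt_smult) (use nz in simp)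
  finally show "proj (pt (psiv (al v) (be v) (ze v))) = proj (pt v)" by (simp add: \<alpha>_def \<beta>_def z_def)
qed

end

section \<open>The birational isomorphism\<close>

context normal_cubic
begin

text \<open>The homogenisation of \<open>num\<close>, with \<alpha>, \<beta>, z as the first three
  coordinates and w $ 3 as the homogenising one. \<open>dform\<close> is likewise the homogenisation
  of \<alpha>\<beta> \<open>dnm\<close>, where the factor clears the denominator.\<close>

definition nform :: "complex vec \<Rightarrow> complex" where
  "nform w = f1 * (w $ 0 * w $ 3) + w $ 1 * (h1 * w $ 3 + h2 * w $ 2) + b00 * (w $ 3 * w $ 3) + b01 * (w $ 2 * w $ 3)"

definition dform :: "complex vec \<Rightarrow> complex" where
  "dform w = f2 * (w $ 0 * w $ 0 * w $ 1) + b10 * (w $ 0 * w $ 1 * w $ 3) + b11 * (w $ 0 * w $ 1 * w $ 2) + w $ 2 * w $ 3 * w $ 3"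

definition mform :: "complex vec \<Rightarrow> complex" where
  "mform w = w $ 0 * w $ 1 * w $ 2 * w $ 3 * nform w * dform w"

definition V :: "ppoint set" where
  "V = {p \<in> proj_points 3. \<forall>w\<in>p. mform w \<noteq> 0}"

lemma hform_mform: "hform 3 9 mform"
proof -
  have c: "hform 3 1 (\<lambda>w. w $ i)" if "i \<le> 3" for i by (rule hform_coord[OF that])
  have n: "hform 3 2 nform"
  proof -
    have "hform 3 (1 + 1) nform"
      unfolding nform_def by (intro hform_add hform_cmult hform_mult c; simp)
    then show ?thesis by (rule hform_degree_eq) simp
  qed
  have d: "hform 3 3 dform"
  proof -
    have "hform 3 (1 + 1 + 1) dform"
      unfolding dform_def by (intro hform_add hform_cmult hform_mult c; simp)
    then show ?thesis by (rule hform_degree_eq) simp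
  qed
  have "hform 3 (1 + 1 + 1 + 1 + 2 + 3) mform"
    unfolding mform_def by (intro hform_mult c n d; simp)
  then show ?thesis by (rule hform_degree_eq) simp
qed

lemma mform_iff:
  "mform w \<noteq> 0 \<longleftrightarrow> w $ 3 \<noteq> 0 \<and> adm (w $ 0 / w $ 3) (w $ 1 / w $ 3) (w $ 2 / w $ 3)"
proof (cases "w $ 0 = 0 \<or> w $ 1 = 0 \<or> w $ 2 = 0 \<or> w $ 3 = 0")
  case True then show ?thesis by (auto simp: mform_def adm_def)
next
  case False
  then have nz: "w $ 0 \<noteq> 0" "w $ 1 \<noteq> 0" "w $ 2 \<noteq> 0" "w $ 3 \<noteq> 0" by auto
  have "nform w = w $ 3 * w $ 3 * num (w $ 0 / w $ 3) (w $ 1 / w $ 3) (w $ 2 / w $ 3)"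
    using nz by (simp add: nform_def num_def field_simps)
  moreover have "dform w = w $ 0 * w $ 1 * w $ 3 * dnm (w $ 0 / w $ 3) (w $ 1 / w $ 3) (w $ 2 / w $ 3)"
    using nz by (simp add: dform_def dnm_def field_simps)
  ultimately show ?thesis using nz by (simp add: mform_def adm_def)
qed

definition ca :: "ppoint \<Rightarrow> complex" where "ca p = (SOME w. w \<in> p) $ 0 / (SOME w. w \<in> p) $ 3"
definition cb :: "ppoint \<Rightarrow> complex" where "cb p = (SOME w. w \<in> p) $ 1 / (SOME w. w \<in> p) $ 3"
definition cc :: "ppoint \<Rightarrow> complex" where "cc p = (SOME w. w \<in> p) $ 2 / (SOME w. w \<in> p) $ 3"

lemma c_pt:
  assumes "w \<in> carrier_vec 4"
  shows "ca (pt w) = w $ 0 / w $ 3" "cb (pt w) = w $ 1 / w $ 3" "cc (pt w) = w $ 2 / w $ 3"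
proof -
  have "(SOME x. x \<in> pt w) \<in> pt w" using pt_self by (rule someI)
  then obtain c where "c \<noteq> 0" "(SOME x. x \<in> pt w) = c \<cdot>\<^sub>v w" by (auto simp: pt_def)
  then show "ca (pt w) = w $ 0 / w $ 3" "cb (pt w) = w $ 1 / w $ 3" "cc (pt w) = w $ 2 / w $ 3"
    using assms by (simp_all add: ca_def cb_def cc_def)
qed

lemma V_cases:
  assumes "p \<in> V"
  obtains w where "w \<in> carrier_vec 4" "p = pt w" "mform w \<noteq> 0"
proof -
  have "p \<in> proj_points 3" using assms by (simp add: V_def)
  then obtain w where w: "w \<in> carrier_vec (3 + 1)" "p = pt w" using proj_points_cases by blast
  have "\<forall>w\<in>p. mform w \<noteq> 0" using assms by (simp add: V_def)
  from bspec[OF this] have "mform w \<noteq> 0" unfolding w(2) using pt_self by blast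
  with that w show thesis by simp
qed

lemma V_D:
  assumes "p \<in> V"
  shows "adm (ca p) (cb p) (cc p)" "pt (vec4 (ca p) (cb p) (cc p) 1) = p"
proof -
  obtain w where w: "w \<in> carrier_vec 4" "p = pt w" "mform w \<noteq> 0" using V_cases[OF assms] .
  have m: "w $ 3 \<noteq> 0 \<and> adm (w $ 0 / w $ 3) (w $ 1 / w $ 3) (w $ 2 / w $ 3)" using w(3) mform_iff by blast
  then show "adm (ca p) (cb p) (cc p)" by (simp add: w(2) c_pt[OF w(1)])
  have "w = w $ 3 \<cdot>\<^sub>v vec4 (ca p) (cb p) (cc p) 1"
  proof (rule eq_vecI)
    fix i assume "i < dim_vec (w $ 3 \<cdot>\<^sub>v vec4 (ca p) (cb p) (cc p) 1)"
    then have "i < 4" by (simp add: vec4_def)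
    then have "i = 0 \<or> i = 1 \<or> i = 2 \<or> i = 3" by auto
    then show "w $ i = (w $ 3 \<cdot>\<^sub>v vec4 (ca p) (cb p) (cc p) 1) $ i"
      using m by (auto simp: w(2) c_pt[OF w(1)] vec4_def)
  qed (use w(1) in \<open>simp add: vec4_def\<close>)
  then have "pt w = pt (w $ 3 \<cdot>\<^sub>v vec4 (ca p) (cb p) (cc p) 1)" by simp
  also have "\<dots> = pt (vec4 (ca p) (cb p) (cc p) 1)" by (rule pt_smult) (use m in simp)
  finally show "pt (vec4 (ca p) (cb p) (cc p) 1) = p" by (simp add: w(2))
qed

lemma vec4_V:
  assumes "adm \<alpha> \<beta> z"
  shows "pt (vec4 \<alpha> \<beta> z 1) \<in> V" "ca (pt (vec4 \<alpha> \<beta> z 1)) = \<alpha>" "cb (pt (vec4 \<alpha> \<beta> z 1)) = \<beta>" "cc (pt (vec4 \<alpha> \<beta> z 1)) = z"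
proof -
  let ?w = "vec4 \<alpha> \<beta> z 1"
  show "ca (pt ?w) = \<alpha>" "cb (pt ?w) = \<beta>" "cc (pt ?w) = z" by (simp_all add: c_pt)
  have m: "mform ?w \<noteq> 0" unfolding mform_iff using assms by simp
  have c: "?w \<in> carrier_vec (3 + 1)" by simp
  have "?w \<noteq> 0\<^sub>v (3 + 1)" using hform_at_zero[OF hform_mform] m by auto
  then have "pt ?w \<in> proj_points 3" using pt_in_proj_points[OF c] by blast
  moreover have "mform x \<noteq> 0" if "x \<in> pt ?w" for x using hform_zero_pt[OF hform_mform c that] m by simp
  ultimately show "pt ?w \<in> V" by (simp add: V_def)
qed

text \<open>Written with \<open>vec (3 + 1)\<close> and a list in order to match
  \<open>morphism_to_proj_space\<close>.\<close>

definition phi :: "ppoint set \<Rightarrow> ppoint" where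
  "phi x = pt (vec (3 + 1) (\<lambda>i. [val al x, val be x, val ze x, 1] ! i))"

lemma phi_eq: "phi x = pt (vec4 (val al x) (val be x) (val ze x) 1)"
  by (simp add: phi_def vec4_def)

text \<open>A set-theoretic section: a vector over each parameter point, depending on the choice of
  a cube root.\<close>

definition PS :: "ppoint \<Rightarrow> complex vec" where "PS p = psiv (ca p) (cb p) (cc p)"

definition psi :: "ppoint \<Rightarrow> ppoint set" where "psi p = proj (pt (PS p))"

lemma Uq_cases:
  assumes "x \<in> Uq"
  obtains v where "v \<in> carrier_vec 5" "eqn v = 0" "good v \<noteq> 0" "x = proj (pt v)"
proof -
  obtain p where p: "p \<in> Xg" "x = proj p" using assms by (auto simp: Uq_def)
  have "p \<in> X" using p(1) by (simp add: Xg_def)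
  then obtain v where "v \<in> carrier_vec 5" "p = pt v" using X_cases by blast
  with that p pt_Xg[of v] show thesis by auto
qed

lemma phi_V:
  assumes "x \<in> Uq" shows "phi x \<in> V" "psi (phi x) = x"
proof -
  obtain v where v: "v \<in> carrier_vec 5" "eqn v = 0" "good v \<noteq> 0" "x = proj (pt v)" using Uq_cases[OF assms] .
  have p: "phi x = pt (vec4 (al v) (be v) (ze v) 1)" unfolding phi_eq v(4) val_coords[OF v(1)] ..
  note g = good_point[OF v(1-3)]
  show "phi x \<in> V" unfolding p by (rule vec4_V[OF g(1)])
  have "PS (phi x) = psiv (al v) (be v) (ze v)" unfolding PS_def p vec4_V(2-4)[OF g(1)] ..
  then have "psi (phi x) = proj (pt v)" using g(2) by (simp only: psi_def)
  then show "psi (phi x) = x" using v(4) by simp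
qed

lemma PS_D:
  assumes "p \<in> V"
  shows "PS p \<in> carrier_vec 5" "eqn (PS p) = 0" "good (PS p) \<noteq> 0"
  using psiv_correct[OF V_D(1)[OF assms]] psiv_carrier by (auto simp: PS_def)

lemma psi_Uq:
  assumes "p \<in> V" shows "psi p \<in> Uq" "phi (psi p) = p"
proof -
  have "pt (PS p) \<in> Xg" using pt_Xg PS_D[OF assms] by blast
  then show "psi p \<in> Uq" by (simp add: psi_def Uq_def)
  show "phi (psi p) = p"
    unfolding phi_eq psi_def val_coords[OF PS_D(1)[OF assms]]
    using psiv_correct(3-5)[OF V_D(1)[OF assms]] V_D(2)[OF assms] by (simp add: PS_def)
qed

lemma openin_V: "openin (zariski 3) V"
  unfolding V_def by (rule openin_hform_nonzero[OF hform_mform])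

abbreviation \<U> :: "ppoint set fun_space" where "\<U> \<equiv> open_subspace \<Q> Uq"
abbreviation \<V> :: "ppoint fun_space" where "\<V> \<equiv> open_subspace (proj_space 3) V"

lemma openin_U: "openin (space_top \<U>) W \<longleftrightarrow> openin (space_top \<Q>) W \<and> W \<subseteq> Uq"
  using openin_open_subtopology[OF openin_Uq] by (simp add: open_subspace_def)

lemma openin_VV: "openin (space_top \<V>) W \<longleftrightarrow> openin (zariski 3) W \<and> W \<subseteq> V"
  using openin_open_subtopology[OF openin_V] by (simp add: open_subspace_def space_top_proj_space)

lemma topspace_U: "topspace (space_top \<U>) = Uq"
  using openin_subset[OF openin_Uq] by (simp add: open_subspace_def Int_absorb1)

lemma topspace_V: "topspace (space_top \<V>) = V"
  using openin_subset[OF openin_V] by (simp add: open_subspace_def space_top_proj_space Int_absorb1)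

section \<open>Regularity of the map to projective space and of its inverse\<close>

lemma regular_val:
  assumes F: "hform 4 d F" "hform 4 d K" and K: "\<And>v. good v \<noteq> 0 \<Longrightarrow> K v \<noteq> 0"
    and f: "\<And>v. v \<in> carrier_vec 5 \<Longrightarrow> val f (proj (pt v)) = F v / K v"
  shows "regular \<U> Uq (val f)"
proof -
  have "regular (proj_variety 4 X) Xg (\<lambda>p. val f (proj p))"
  proof (rule regular_proj_variety_quotient[OF openin_Xg F])
    fix p v assume p: "p \<in> Xg" "v \<in> p"
    have "p \<in> proj_points 4" using p(1) X_sub by (auto simp: Xg_def)
    from proj_points_mem[OF this p(2)] have v: "v \<in> carrier_vec 5" "p = pt v" by auto
    have "good v \<noteq> 0" using p by (simp add: Xg_def)
    then show "K v \<noteq> 0 \<and> val f (proj p) = F v / K v" using K f[OF v(1)] v(2) by simp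
  qed
  then have "regular \<Q> Uq (val f)" unfolding regular_Q pre_Uq .
  then show ?thesis by (simp add: open_subspace_def)
qed

lemma morphism_phi: "morphism \<U> \<V> phi"
proof -
  interpret ringed_space \<U>
    by (rule ringed_space_open_subspace[OF ringed_space_quotient[OF ringed_X] openin_Uq])
  have m: "hform 4 (1 + 1) (\<lambda>v. la v * lb v)" "hform 4 (1 + 1) (\<lambda>v. v $ 1 * ls v)"
    "hform 4 (1 + 1) (\<lambda>v. ls v * lt v)" "hform 4 (1 + 1) (\<lambda>v. v $ 1 * la v)"
    by (intro hform_mult hform_lin)+
  have al: "regular \<U> Uq (val al)"
    by (rule regular_val[OF m(1,2)]) (auto simp: good_def val_coords al_def)
  have be: "regular \<U> Uq (val be)"
    by (rule regular_val[OF m(3,4)]) (auto simp: good_def val_coords be_def)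
  have ze: "regular \<U> Uq (val ze)"
    by (rule regular_val[OF hform_lin(4,3)]) (auto simp: good_def val_coords ze_def)
  have o: "openin (space_top \<U>) Uq" unfolding openin_U using openin_Uq by simp
  have "morphism \<U> \<V> (\<lambda>x. pt (vec (3 + 1) (\<lambda>i. [val al x, val be x, val ze x, 1] ! i)))"
  proof (rule morphism_to_proj_space[OF _ _ openin_V]; unfold topspace_U)
    show "regular \<U> Uq (\<lambda>x. [val al x, val be x, val ze x, 1] ! i)" if "i \<le> 3" for i
    proof -
      have "i = 0 \<or> i = 1 \<or> i = 2 \<or> i = 3" using that by auto
      then show ?thesis using al be ze reg_const[OF o, of 1] by auto
    qed
    show "\<exists>i\<le>3. [val al x, val be x, val ze x, 1] ! i \<noteq> 0" if "x \<in> Uq" for x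
      by (rule exI[of _ 3]) simp
    show "pt (vec (3 + 1) (\<lambda>i. [val al x, val be x, val ze x, 1] ! i)) \<in> V" if "x \<in> Uq" for x
      using phi_V(1)[OF that] by (simp add: phi_def)
  qed
  then show ?thesis by (simp add: phi_def[abs_def])
qed

lemma ringed_V: "ringed_space \<V>"
proof (rule ringed_space_open_subspace)
  show "ringed_space (proj_space 3)" unfolding proj_space_def by (rule ringed_space_proj_variety) simp
  show "openin (space_top (proj_space 3)) V" using openin_V by (simp add: space_top_proj_space)
qed

lemma regular_c: "regular \<V> V ca" "regular \<V> V cb" "regular \<V> V cc"
proof -
  have o: "openin (subtopology (zariski 3) (proj_points 3)) V"
    using openin_V space_top_proj_space[of 3] by (simp add: proj_space_def proj_variety_def)
  have *: "v \<in> carrier_vec 4 \<and> p = pt v \<and> v $ 3 \<noteq> 0" if "p \<in> V" "v \<in> p" for p v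
  proof -
    have "p \<in> proj_points 3" using that(1) by (simp add: V_def)
    from proj_points_mem[OF this that(2)] have "v \<in> carrier_vec 4" "p = pt v" by auto
    moreover have "mform v \<noteq> 0" using that by (simp add: V_def)
    ultimately show ?thesis using mform_iff by blast
  qed
  have **: "v $ 3 \<noteq> 0 \<and> ca p = v $ 0 / v $ 3 \<and> cb p = v $ 1 / v $ 3 \<and> cc p = v $ 2 / v $ 3" if "p \<in> V" "v \<in> p" for p v
    using *[OF that] c_pt[of v] by metis
  have c: "hform 3 1 (\<lambda>w. w $ i)" if "i \<le> 3" for i by (rule hform_coord[OF that])
  have "regular (proj_variety 3 (proj_points 3)) V ca"
    by (rule regular_proj_variety_quotient[OF o c[of 0] c[of 3]]) (simp_all add: **)
  moreover have "regular (proj_variety 3 (proj_points 3)) V cb"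
    by (rule regular_proj_variety_quotient[OF o c[of 1] c[of 3]]) (simp_all add: **)
  moreover have "regular (proj_variety 3 (proj_points 3)) V cc"
    by (rule regular_proj_variety_quotient[OF o c[of 2] c[of 3]]) (simp_all add: **)
  ultimately show "regular \<V> V ca" "regular \<V> V cb" "regular \<V> V cc"
    by (simp_all add: open_subspace_def proj_space_def)
qed

text \<open>
  The section \<open>PS\<close> involves a cube root and is not regular, but averages of forms over the group
  only see the cube of that root.
\<close>

lemma regular_average:
  assumes "hform 4 d P"
  shows "regular \<V> V (\<lambda>p. \<Sum>k<3. P (dg \<xi> k (PS p)))"
proof -
  interpret ringed_space \<V> by (rule ringed_V)
  have o: "openin (space_top \<V>) V" unfolding openin_VV using openin_V by simp
  note rc = reg_const[OF o] and ra = reg_add[OF o] and rm = reg_mult[OF o] and rp = reg_power[OF o]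
    and rd = reg_divide[OF o] and ru = reg_uminus[OF o] and rs = reg_cong[OF o]
  define Y where "Y = (\<lambda>p. yy (ca p) (cb p) (cc p))"
  define S where "S = (\<lambda>p. ss (ca p) (cb p) (cc p))"
  define T where "T = (\<lambda>p. Y p * cb p / (ca p * cc p))"
  have nz: "ca p \<noteq> 0" "cb p \<noteq> 0" "cc p \<noteq> 0" "dnm (ca p) (cb p) (cc p) \<noteq> 0" "Y p \<noteq> 0" "T p \<noteq> 0" "S p \<noteq> 0"
    "S p ^ 3 = T p" if "p \<in> V" for p
  proof -
    have a: "ca p \<noteq> 0" "cb p \<noteq> 0" "cc p \<noteq> 0" "dnm (ca p) (cb p) (cc p) \<noteq> 0" "num (ca p) (cb p) (cc p) \<noteq> 0"
      using V_D(1)[OF that] by (auto simp: adm_def)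
    then show "ca p \<noteq> 0" "cb p \<noteq> 0" "cc p \<noteq> 0" "dnm (ca p) (cb p) (cc p) \<noteq> 0" by auto
    show "Y p \<noteq> 0" using a by (simp add: Y_def yy_def)
    then show T: "T p \<noteq> 0" using a by (simp add: T_def)
    show S3: "S p ^ 3 = T p" by (simp add: S_def ss_def cube_root T_def Y_def)
    show "S p \<noteq> 0"
    proof
      assume "S p = 0"
      then show False using S3 T by simp
    qed
  qed
  have "regular \<V> V (\<lambda>p. num (ca p) (cb p) (cc p))"
    unfolding num_def by (intro ra rm rc regular_c)
  moreover have "regular \<V> V (\<lambda>p. dnm (ca p) (cb p) (cc p))"
    unfolding dnm_def by (intro ra rm rc regular_c rd) (use nz in simp)
  ultimately have rY: "regular \<V> V Y"
    unfolding Y_def yy_def by (intro rd ru) (use nz in simp_all)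
  have rT: "regular \<V> V T"
    unfolding T_def by (intro rd rm rY regular_c) (use nz in simp)
  define D E where "D = l0 * m1 - l1 * m0" and "E = s2 * t3 - s3 * t2"
  \<comment> \<open>The parts of the coordinates that are regular in p: coordinates of weight 0 are
    free of the root S, weight 1 carries 1/S and weight 2 carries S.\<close>
  define r0 r1 r2 r3 r4 where "r0 = (\<lambda>p. (m1 + - l1 * Y p) * inverse D)" and "r1 = (\<lambda>p. Y p / ca p)"
    and "r2 = (\<lambda>p. (t3 + - s3 * cc p) * inverse E)" and "r3 = (\<lambda>p. (s2 * cc p + - t2) * inverse E)"
    and "r4 = (\<lambda>p. (l0 * Y p + - m0) * inverse D)"
  have rr: "regular \<V> V r0" "regular \<V> V r1" "regular \<V> V r2" "regular \<V> V r3" "regular \<V> V r4"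
    unfolding r0_def r1_def r2_def r3_def r4_def by (intro ra rm rd rc rY regular_c; use nz in simp)+
  have YS: "yy (ca p) (cb p) (cc p) = Y p" "ss (ca p) (cb p) (cc p) = S p" for p
    by (simp_all add: Y_def S_def)
  have PSi: "PS p $ 0 = r0 p" "PS p $ 1 = r1 p / S p" "PS p $ 2 = r2 p * S p" "PS p $ 3 = r3 p * S p" "PS p $ 4 = r4 p" for p
    by (simp_all add: PS_def psiv_def mk_def YS r0_def r1_def r2_def r3_def r4_def
      D_def[symmetric] E_def[symmetric] divide_inverse algebra_simps)
  show ?thesis
    using assms
  proof (induction rule: hform_induct)
    case zero
    have "regular \<V> V (\<lambda>p. 0)" by (rule rc)
    then show ?case by simp
  next
    case (add f g)
    then have "regular \<V> V (\<lambda>p. (\<Sum>k<3. f (dg \<xi> k (PS p))) + (\<Sum>k<3. g (dg \<xi> k (PS p))))" by (rule ra)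
    then show ?case by (simp only: sum.distrib)
  next
    case (mono e c)
    define W where "W = e 1 + 2 * e 2 + 2 * e 3"
    have sum: "(\<Sum>k<3. c * (\<Prod>i\<le>4. (dg \<xi> k (PS p) $ i) ^ e i)) =
        (1 + \<xi> ^ W + (\<xi> ^ W)\<^sup>2) * (c * (\<Prod>i\<le>4. (PS p $ i) ^ e i))" for p
      unfolding dg_monomial W_def[symmetric] by (simp add: numeral_3_eq_3 numeral_2_eq_2 algebra_simps)
    show ?case
    proof (cases "3 dvd W")
      case False
      have "regular \<V> V (\<lambda>p. 0)" by (rule rc)
      then show ?thesis unfolding sum root_of_unity_power_sum[OF prim] using False by simp
    next
      case True
      then obtain l where l: "W = 3 * l" by (elim dvdE)
      \<comment> \<open>The monomial contains S to the power e2 + e3 - e1 = (2 e1 + e2 + e3) - 3 e1.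
        The bracket is congruent to 2W mod 3, hence equal to some 3j, and the power of S becomes T^j
        / T^e1. The subtraction is not truncated, as 3l \<ge> 2(e2 + e3).\<close>
      define j where "j = 2 * l - e 2 - e 3"
      have j: "2 * e 1 + e 2 + e 3 = 3 * j"
        using l by (simp add: W_def j_def)
      have "regular \<V> V (\<lambda>p. 3 * (c * (r0 p ^ e 0 * r1 p ^ e 1 * r2 p ^ e 2 * r3 p ^ e 3 * r4 p ^ e 4 * (T p ^ j / T p ^ e 1))))"
        by (intro rm rc rp rr rd rT) (use nz in simp)
      then show ?thesis
      proof (rule rs)
        fix p assume p: "p \<in> V"
        have "S p ^ (e 2 + e 3) * S p ^ (2 * e 1) = S p ^ (3 * j)"
          unfolding power_add[symmetric] j[symmetric] by (simp add: add_ac)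
        also have "\<dots> = T p ^ j" unfolding power_mult nz(8)[OF p] ..
        finally have 1: "S p ^ (e 2 + e 3) * S p ^ (2 * e 1) = T p ^ j" .
        have 2: "S p ^ e 1 * S p ^ (2 * e 1) = T p ^ e 1"
        proof -
          have "S p ^ e 1 * S p ^ (2 * e 1) = S p ^ (3 * e 1)" unfolding power_add[symmetric] by simp
          also have "\<dots> = T p ^ e 1" unfolding power_mult nz(8)[OF p] ..
          finally show ?thesis .
        qed
        have q: "T p ^ j / T p ^ e 1 = S p ^ (e 2 + e 3) / S p ^ e 1"
          unfolding 1[symmetric] 2[symmetric] using nz(7)[OF p] by simp
        have "(\<Prod>i\<le>4. (PS p $ i) ^ e i) = r0 p ^ e 0 * (r1 p / S p) ^ e 1 * (r2 p * S p) ^ e 2 * (r3 p * S p) ^ e 3 * r4 p ^ e 4"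
          unfolding prod_atMost_4 PSi ..
        also have "\<dots> = r0 p ^ e 0 * r1 p ^ e 1 * r2 p ^ e 2 * r3 p ^ e 3 * r4 p ^ e 4 * (S p ^ (e 2 + e 3) / S p ^ e 1)"
          by (simp add: power_mult_distrib power_divide power_add)
        finally have pr: "(\<Prod>i\<le>4. (PS p $ i) ^ e i) = r0 p ^ e 0 * r1 p ^ e 1 * r2 p ^ e 2 * r3 p ^ e 3 * r4 p ^ e 4 * (T p ^ j / T p ^ e 1)"
          unfolding q .
        show "3 * (c * (r0 p ^ e 0 * r1 p ^ e 1 * r2 p ^ e 2 * r3 p ^ e 3 * r4 p ^ e 4 * (T p ^ j / T p ^ e 1))) =
            (\<Sum>k<3. c * (\<Prod>i\<le>4. (dg \<xi> k (PS p) $ i) ^ e i))"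
          unfolding sum root_of_unity_power_sum[OF prim] pr using True by simp
      qed
    qed
  qed
qed

text \<open>The average of \<open>f\<close> itself may vanish at \<open>v\<close>. But a good vector
  has a nonzero coordinate of each weight 0, 1, 2; if all averages of f times a coordinate were 0,
  so would be the three discrete Fourier coefficients of the values of f at v, gv, g^2 v, and hence
  f v.\<close>

lemma average_nonzero:
  assumes v: "v \<in> carrier_vec 5" "good v \<noteq> 0" and f: "f v \<noteq> 0"
  obtains i where "i \<le> 4" "(\<Sum>k<3. f (dg \<xi> k v) * dg \<xi> k v $ i) \<noteq> (0 :: complex)"
proof (rule ccontr)
  assume "\<not> thesis"
  with that have z: "(\<Sum>k<3. f (dg \<xi> k v) * dg \<xi> k v $ i) = 0" if "i \<le> 4" for i using that by blast
  note r = primitive_root_3[OF prim]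
  define x0 x1 x2 where "x0 = f v" and "x1 = f (dg \<xi> 1 v)" and "x2 = f (dg \<xi> 2 v)"
  have sum: "(\<Sum>k<3. f (dg \<xi> k v) * dg \<xi> k v $ i) = (x0 + \<xi> ^ weight i * x1 + (\<xi> ^ weight i)\<^sup>2 * x2) * v $ i" if "i \<le> 4" for i
    using that by (simp add: numeral_3_eq_3 x0_def x1_def x2_def dg_0[OF v(1)] algebra_simps power_mult power2_eq_square
       numeral_2_eq_2)
  have "la v \<noteq> 0" "v $ 1 \<noteq> 0" "ls v \<noteq> 0" using v(2) by (auto simp: good_def)
  then have "v $ 0 \<noteq> 0 \<or> v $ 4 \<noteq> 0" "v $ 1 \<noteq> 0" "v $ 2 \<noteq> 0 \<or> v $ 3 \<noteq> 0" by (auto simp: la_def ls_def)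
  moreover have "(x0 + \<xi> ^ weight i * x1 + (\<xi> ^ weight i)\<^sup>2 * x2) * v $ i = 0" if "i \<le> 4" for i
    using z[OF that] unfolding sum[OF that] .
  note this[of 0] this[of 1] this[of 2] this[of 3] this[of 4]
  ultimately have "x0 + x1 + x2 = 0" "x0 + \<xi> * x1 + \<xi>\<^sup>2 * x2 = 0" "x0 + \<xi>\<^sup>2 * x1 + (\<xi>\<^sup>2)\<^sup>2 * x2 = 0"
    by auto
  then have "3 * x0 = 0" using r(1,5) by Groebner_Basis.algebra
  then show False using f by (simp add: x0_def)
qed

text \<open>Where the average is nonzero, one of its summands is nonzero, so some translate of
  \<open>PS q\<close> lies in the chosen principal open set; all translates have the same orbit
  \<open>psi q\<close>.\<close>

lemma psi_open:
  assumes "openin (space_top \<U>) W"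
  shows "openin (space_top \<V>) {p \<in> V. psi p \<in> W}"
proof (subst openin_subopen, intro ballI)
  interpret ringed_space \<V> by (rule ringed_V)
  have o: "openin (space_top \<V>) V" unfolding openin_VV using openin_V by simp
  fix p assume "p \<in> {p \<in> V. psi p \<in> W}"
  then have p: "p \<in> V" "psi p \<in> W" by auto
  note PSp = PS_D[OF p(1)]
  have "openin TX {q \<in> X. proj q \<in> W}" using assms by (simp add: openin_U openin_Q)
  then obtain W0 where W0: "openin (zariski 4) W0" "{q \<in> X. proj q \<in> W} = W0 \<inter> X" by (auto simp: openin_subtopology)
  have "pt (PS p) \<in> {q \<in> X. proj q \<in> W}" using pt_X[OF PSp(1)] good_nonzero[OF PSp(3)] PSp(2) p(2) by (simp add: psi_def)
  then have "pt (PS p) \<in> W0" unfolding W0(2) by simp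
  then obtain d H where H: "hform 4 d H" "\<And>v. v \<in> pt (PS p) \<Longrightarrow> H v \<noteq> 0" "{q \<in> proj_points 4. \<forall>v\<in>q. H v \<noteq> 0} \<subseteq> W0"
    using zariski_basis[OF W0(1)] by blast
  obtain i where i: "i \<le> 4" "(\<Sum>k<3. H (dg \<xi> k (PS p)) * dg \<xi> k (PS p) $ i) \<noteq> 0"
    using average_nonzero[of "PS p" H] PSp(1,3) H(2)[of "PS p"] pt_self[of "PS p"] by blast
  define S where "S = (\<lambda>p. \<Sum>k<3. H (dg \<xi> k (PS p)) * dg \<xi> k (PS p) $ i)"
  have "regular \<V> V S"
    unfolding S_def by (rule regular_average[OF hform_mult[OF H(1) hform_coord[OF i(1)]]])
  then have "openin (space_top \<V>) {q \<in> V. S q \<noteq> 0}" by (rule reg_nonzero_open[OF o])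
  moreover have "p \<in> {q \<in> V. S q \<noteq> 0}" using p(1) i(2) by (simp add: S_def)
  moreover have "{q \<in> V. S q \<noteq> 0} \<subseteq> {p \<in> V. psi p \<in> W}"
  proof
    fix q assume "q \<in> {q \<in> V. S q \<noteq> 0}"
    then have q: "q \<in> V" "S q \<noteq> 0" by auto
    note PSq = PS_D[OF q(1)]
    obtain k where "H (dg \<xi> k (PS q)) * dg \<xi> k (PS q) $ i \<noteq> 0"
      using q(2) unfolding S_def by (meson sum.not_neutral_contains_not_neutral)
    then have k: "H (dg \<xi> k (PS q)) \<noteq> 0" by simp
    define x where "x = dg \<xi> k (PS q)"
    have x: "x \<in> carrier_vec 5" "eqn x = 0" "good x \<noteq> 0" using PSq by (auto simp: x_def eqn_dg good_dg)
    have "pt x \<in> X" using pt_X[OF x(1) good_nonzero[OF x(3)]] x(2) by blast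
    moreover have "\<forall>v\<in>pt x. H v \<noteq> 0" using hform_zero_pt[OF H(1), of x] x(1) k by (simp add: x_def)
    ultimately have "pt x \<in> {q \<in> X. proj q \<in> W}" unfolding W0(2) using H(3) X_sub by blast
    then have "proj (pt x) \<in> W" by simp
    then show "q \<in> {p \<in> V. psi p \<in> W}" using q(1) by (simp add: psi_def x_def proj_dg[OF PSq(1)])
  qed
  ultimately show "\<exists>T. openin (space_top \<V>) T \<and> p \<in> T \<and> T \<subseteq> {p \<in> V. psi p \<in> W}" by blast
qed

text \<open>Locally f = F/K where \<open>H\<close> is nonzero. Multiplication by \<open>H\<close>
  gives f H K = H F at all translates, including those where F/K does not represent f because
  \<open>H\<close> vanishes there. Summing over the group, with a coordinate as extra factor, gives
  f A = B with A and B regular and A nonzero at \<open>p\<close>.\<close>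

lemma psi_regular:
  assumes W: "openin (space_top \<U>) W" and f: "regular \<U> W f"
  shows "regular \<V> {p \<in> V. psi p \<in> W} (f \<circ> psi)"
proof -
  interpret ringed_space \<V> by (rule ringed_V)
  have o: "openin (space_top \<V>) V" unfolding openin_VV using openin_V by simp
  note oW = psi_open[OF W]
  have fX: "regular (proj_variety 4 X) {q \<in> X. proj q \<in> W} (\<lambda>q. f (proj q))"
    using f unfolding open_subspace_def by (simp add: regular_Q)
  show ?thesis
  proof (rule reg_local[OF oW])
    fix p assume "p \<in> {p \<in> V. psi p \<in> W}"
    then have p: "p \<in> V" "psi p \<in> W" by auto
    note PSp = PS_D[OF p(1)]
    have q0: "pt (PS p) \<in> {q \<in> X. proj q \<in> W}" using pt_X[OF PSp(1)] good_nonzero[OF PSp(3)] PSp(2) p(2) by (simp add: psi_def)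
    from fX q0 obtain W1 where W1: "openin TX W1" "pt (PS p) \<in> W1" "quotient_on 4 W1 (\<lambda>q. f (proj q))"
      unfolding regular_proj_variety_iff by blast
    obtain d F K where FK: "hform 4 d F" "hform 4 d K" "frac_on W1 (\<lambda>q. f (proj q)) F K"
      using W1(3) by (rule quotient_onE)
    obtain W0 where W0: "openin (zariski 4) W0" "W1 = W0 \<inter> X" using W1(1) by (auto simp: openin_subtopology)
    have "pt (PS p) \<in> W0" using W1(2) W0(2) by simp
    then obtain e H where H: "hform 4 e H" "\<And>v. v \<in> pt (PS p) \<Longrightarrow> H v \<noteq> 0" "{q \<in> proj_points 4. \<forall>v\<in>q. H v \<noteq> 0} \<subseteq> W0"
      using zariski_basis[OF W0(1)] by blast
    have HK: "H (PS p) * K (PS p) \<noteq> 0"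
      using H(2)[of "PS p"] pt_self[of "PS p"] frac_onD(1)[OF FK(3) W1(2), of "PS p"] by simp
    obtain i where i: "i \<le> 4" "(\<Sum>k<3. H (dg \<xi> k (PS p)) * K (dg \<xi> k (PS p)) * dg \<xi> k (PS p) $ i) \<noteq> 0"
      using average_nonzero[of "PS p" "\<lambda>v. H v * K v"] PSp(1,3) HK by blast
    define A where "A = (\<lambda>p. \<Sum>k<3. H (dg \<xi> k (PS p)) * K (dg \<xi> k (PS p)) * dg \<xi> k (PS p) $ i)"
    define B where "B = (\<lambda>p. \<Sum>k<3. H (dg \<xi> k (PS p)) * F (dg \<xi> k (PS p)) * dg \<xi> k (PS p) $ i)"
    have rA: "regular \<V> V A"
      unfolding A_def by (rule regular_average[OF hform_mult[OF hform_mult[OF H(1) FK(2)] hform_coord[OF i(1)]]])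
    have rB: "regular \<V> V B"
      unfolding B_def by (rule regular_average[OF hform_mult[OF hform_mult[OF H(1) FK(1)] hform_coord[OF i(1)]]])
    define N where "N = {p \<in> V. psi p \<in> W} \<inter> {q \<in> V. A q \<noteq> 0}"
    have oN: "openin (space_top \<V>) N" unfolding N_def by (intro openin_Int oW reg_nonzero_open[OF o rA])
    have NV: "N \<subseteq> V" by (auto simp: N_def)
    have "regular \<V> N (\<lambda>q. B q / A q)"
      by (rule reg_divide[OF oN reg_restrict[OF o rB oN NV] reg_restrict[OF o rA oN NV]]) (simp add: N_def)
    then have "regular \<V> N (f \<circ> psi)"
    proof (rule reg_cong[OF oN])
      fix q assume "q \<in> N"
      then have q: "q \<in> V" "A q \<noteq> 0" by (auto simp: N_def)
      note PSq = PS_D[OF q(1)]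
      have eq: "f (psi q) * (H x * K x * x $ i) = H x * F x * x $ i" if "x = dg \<xi> k (PS q)" for x k
      proof (cases "H x = 0")
        case False
        have x: "x \<in> carrier_vec 5" "eqn x = 0" "good x \<noteq> 0" using PSq by (auto simp: that eqn_dg good_dg)
        have "pt x \<in> X" using pt_X[OF x(1) good_nonzero[OF x(3)]] x(2) by blast
        moreover have "\<forall>v\<in>pt x. H v \<noteq> 0" using hform_zero_pt[OF H(1), of x] x(1) False by simp
        ultimately have "pt x \<in> W1" unfolding W0(2) using H(3) X_sub by blast
        moreover have "proj (pt x) = psi q" by (simp add: psi_def that proj_dg[OF PSq(1)])
        ultimately have "K x \<noteq> 0" "f (psi q) = F x / K x" using frac_onD[OF FK(3) _ pt_self] by metis+
        then show ?thesis by simp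
      qed simp
      have "f (psi q) * A q = B q"
        unfolding A_def B_def sum_distrib_left by (rule sum.cong[OF refl]) (rule eq[OF refl])
      then show "B q / A q = (f \<circ> psi) q" using q(2) by (simp add: field_simps)
    qed
    moreover have "p \<in> N" using p i(2) by (simp add: N_def A_def)
    moreover have "N \<subseteq> {p \<in> V. psi p \<in> W}" by (auto simp: N_def)
    ultimately show "\<exists>N. openin (space_top \<V>) N \<and> p \<in> N \<and> N \<subseteq> {p \<in> V. psi p \<in> W} \<and> regular \<V> N (f \<circ> psi)"
      using oN by (intro exI[of _ N]) simp
  qed
qed

lemma morphism_psi: "morphism \<V> \<U> psi"
  unfolding morphism_def topspace_V
proof (intro conjI allI impI)
  have "psi p \<in> topspace (space_top \<U>)" if "p \<in> topspace (space_top \<V>)" for p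
    using that psi_Uq(1) by (simp only: topspace_U topspace_V)
  then show "continuous_map (space_top \<V>) (space_top \<U>) psi"
    unfolding continuous_map_def using psi_open by (simp add: topspace_V)
  show "regular \<V> {p \<in> V. psi p \<in> W} (f \<circ> psi)" if "openin (space_top \<U>) W \<and> regular \<U> W f" for W f
    using that psi_regular by blast
qed

lemma X_nonempty: "X \<noteq> {}"
proof -
  let ?v = "mk 1 0 0 0 0"
  have "?v \<noteq> 0\<^sub>v 5"
  proof
    assume "?v = 0\<^sub>v 5"
    then have "la ?v = 0" by (simp only: la_def) simp
    then show False by simp
  qed
  moreover have "eqn ?v = 0" by (simp add: eqn_def equation_def)
  ultimately have "pt ?v \<in> X" using pt_X[of ?v] by simp
  then show ?thesis by blast
qed

lemma rational_quotient: "rational_variety \<Q>"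
proof -
  have "openin TX X" using openin_topspace[of TX] unfolding top_X(2) .
  from Xg_dense[OF this X_nonempty] obtain p where "p \<in> Xg" by blast
  then have "phi (proj p) \<in> V" using phi_V(1) by (simp add: Uq_def)
  then have V: "dense_open (proj_space 3) V" using dense_open_proj_space[OF openin_V] by blast
  have "isomorphic_spaces \<U> \<V>"
    unfolding isomorphic_spaces_def topspace_U topspace_V
    using morphism_phi morphism_psi phi_V(2) psi_Uq(2) by blast
  then show ?thesis
    unfolding rational_variety_def birational_def using dense_Uq V by blast
qed

end

theorem theorem3p2:
  fixes \<xi> :: complex and X :: "ppoint set"
  assumes "primitive_root_of_unity 3 \<xi>"
    and "smooth_hypersurface 4 3 X"
    and "\<forall>g\<in>carrier (G\<^sub>1 \<xi>). pgl_act g ` X = X"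
  shows "rational_variety (quotient_space (G\<^sub>1 \<xi>) pgl_act (proj_variety 4 X))"
proof -
  note r = primitive_root_3[OF assms(1)]
  obtain F where F: "hform 4 3 F" "X = {p \<in> proj_points 4. \<forall>v\<in>p. F v = 0}"
    "\<And>v. v \<in> carrier_vec (4 + 1) \<Longrightarrow> v \<noteq> 0\<^sub>v (4 + 1) \<Longrightarrow> \<not> singular_at 4 F v"
    using smooth_hypersurface_hform[OF assms(2)] by blast
  \<comment> \<open>Invariance of X as a set says only that \<open>F\<close> composed with the
    generator vanishes on X; \<open>cubic_vanishing_proportional\<close> turns this into a character
    \<open>k\<close>.\<close>
  have van: "F (dg \<xi> 1 v) = 0" if v: "v \<in> carrier_vec (4 + 1)" "F v = 0" for v
  proof (cases "v = 0\<^sub>v (4 + 1)")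
    case True
    then have "dg \<xi> 1 v = 0\<^sub>v (4 + 1)" by (intro eq_vecI) (auto simp: dg_def)
    then show ?thesis using hform_at_zero[OF F(1)] by simp
  next
    case False
    have "F w = 0" if "w \<in> pt v" for w using hform_zero_pt[OF F(1) v(1) that] v(2) by simp
    then have "pt v \<in> X" using pt_in_proj_points[OF v(1) False] by (simp add: F(2))
    moreover have "pgl_class 5 (dg_mat \<xi> 1) \<in> carrier (G\<^sub>1 \<xi>)" unfolding carrier_G1[OF r(1)] by (rule range_eqI) (rule refl)
    ultimately have "pgl_act (pgl_class 5 (dg_mat \<xi> 1)) (pt v) \<in> X" using assms(3) by blast
    moreover have "pgl_act (pgl_class 5 (dg_mat \<xi> 1)) (pt v) = pt (dg \<xi> 1 v)" using v(1) by (intro pgl_act_pt) simp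
    ultimately have "\<forall>w\<in>pt (dg \<xi> 1 v). F w = 0" by (simp add: F(2))
    then show ?thesis using pt_self by (rule bspec)
  qed
  obtain k p where p: "p \<in> carrier_vec (4 + 1)" "F p \<noteq> 0" and k: "\<And>v. v \<in> carrier_vec (4 + 1) \<Longrightarrow> F (dg \<xi> 1 v) = k * F v"
  proof (rule cubic_vanishing_proportional)
    show "(2 :: nat) \<le> 4" by simp
    show "hform 4 3 F" by (rule F(1))
    show "hform 4 3 (\<lambda>v. F (dg \<xi> 1 v))" by (rule hform_dg[OF F(1)])
    show "\<not> singular_at 4 F v" if "v \<in> carrier_vec (4 + 1)" "v \<noteq> 0\<^sub>v (4 + 1)" for v by (rule F(3)[OF that])
    show "F (dg \<xi> 1 v) = 0" if "v \<in> carrier_vec (4 + 1)" "F v = 0" for v by (rule van[OF that])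
    fix k p
    assume "p \<in> carrier_vec (4 + 1)" "F p \<noteq> 0" "\<And>v. v \<in> carrier_vec (4 + 1) \<Longrightarrow> F (dg \<xi> 1 v) = k * F v"
    then show thesis by (rule that)
  qed
  have smooth: "\<not> singular_at 4 F v" if "v \<in> carrier_vec 5" "v \<noteq> 0\<^sub>v 5" for v using F(3)[of v] that by simp
  have "k = 1" by (rule smooth_semi_invariant[OF assms(1) F(1) smooth _ _ p(2)]) (use k p in simp_all)
  then have inv: "F (dg \<xi> 1 v) = F v" if "v \<in> carrier_vec 5" for v using k[of v] that by simp
  obtain C where C: "\<And>v. v \<in> carrier_vec 5 \<Longrightarrow> F v = invariant_cubic C (v $ 0) (v $ 4) (v $ 1) (v $ 2) (v $ 3)"
    using invariant_cubic_form[OF assms(1) F(1) inv] by blast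
  show ?thesis
  proof (rule smooth_invariant_normal_form[OF C smooth])
    fix k l0 l1 m0 m1 s2 s3 t2 t3 f1 f2 h1 h2 b00 b10 b01 b11 :: complex
    assume nf: "k \<noteq> 0" "l0 * m1 - l1 * m0 \<noteq> 0" "s2 * t3 - s3 * t2 \<noteq> 0" "h1 \<noteq> 0 \<or> h2 \<noteq> 0"
      and eq: "\<And>v a b u s t. v \<in> carrier_vec 5 \<Longrightarrow> a = l0 * v $ 0 + l1 * v $ 4 \<Longrightarrow> b = m0 * v $ 0 + m1 * v $ 4 \<Longrightarrow>
         u = v $ 1 \<Longrightarrow> s = s2 * v $ 2 + s3 * v $ 3 \<Longrightarrow> t = t2 * v $ 2 + t3 * v $ 3 \<Longrightarrow>
         F v = k * (a * b * (f1 * a + f2 * b) + u ^ 3 + u * (b00 * a * s + b10 * b * s + b01 * a * t + b11 * b * t)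
            + s * t * (h1 * s + h2 * t))"
    interpret N: normal_cubic \<xi> l0 l1 m0 m1 s2 s3 t2 t3 f1 f2 h1 h2 b00 b10 b01 b11
      using assms(1) nf by unfold_locales
    have Fe: "F v = k * N.eqn v" if "v \<in> carrier_vec 5" for v
      unfolding N.eqn_def N.equation_def by (rule eq[OF that]) (simp_all add: N.la_def N.lb_def N.ls_def N.lt_def)
    have "F v = 0 \<longleftrightarrow> N.eqn v = 0" if "p \<in> proj_points 4" "v \<in> p" for p v
      using proj_points_mem(1)[OF that] Fe[of v] nf(1) by simp
    then have "X = N.X" unfolding F(2) N.X_def by blast
    then show ?thesis using N.rational_quotient by simp
  qed
qed

end
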